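(* Let $p$ be a prime, let $G$ be a pro-$p$ group and let $r\ge 2$ be an integer. Suppose that either $\gamma_r(G)$ is procyclic, or $p$ is odd and $\gamma_r(G)$ can be topologically generated by $2$ elements. Then there exist an integer $j$ with $1\le j\le r$ and elements $x_1,\ldots,x_{j-1},x_{j+1},\ldots,x_r\in G$ such that $$\gamma_r(G)=\{[x_1,\ldots,x_{j-1},g,x_{j+1},\ldots,x_r]\mid g\in G\}.$$
   Context: Commutators: $[x,y]=x^{-1}y^{-1}xy$, and longer commutators are left-normed: $[x_1,\ldots,x_r]=[[x_1,\ldots,x_{r-1}],x_r]$, with $[x_1]=x_1$. For a pro-$p$ group $G$, $\gamma_r(G)$ denotes the topological closure in $G$ of the subgroup generated by all elements $[g_1,\ldots,g_r]$ with $g_i\in G$. *)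

theory Defs
  imports "HOL-Analysis.Analysis" "HOL-Algebra.Algebra"
begin

locale topological_group = group G
  for G :: "('a, 'b) monoid_scheme" (structure) and T :: "'a topology" +
  assumes topspace_eq: "topspace T = carrier G"
    and continuous_mult: "continuous_map (prod_topology T T) T (\<lambda>(x, y). x \<otimes> y)"
    and continuous_inv: "continuous_map T T (\<lambda>x. inv x)"

text \<open>A profinite group is a compact Hausdorff topological group whose open subgroups form a base
  of neighbourhoods of the identity.\<close>

locale profinite_group = topological_group G T for G (structure) and T +
  assumes compact: "compact_space T"
    and hausdorff: "Hausdorff_space T"
    and open_subgroup_base:
      "\<And>U. openin T U \<Longrightarrow> \<one> \<in> U \<Longrightarrow> \<exists>H. subgroup H G \<and> openin T H \<and> H \<subseteq> U"

locale pro_p_group = profinite_group G T for p :: nat and G (structure) and T +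
  assumes index_open_normal:
    "\<And>N. N \<lhd> G \<Longrightarrow> openin T N \<Longrightarrow> \<exists>k. card (rcosets N) = p ^ k"

definition commutator :: "('a, 'b) monoid_scheme \<Rightarrow> 'a \<Rightarrow> 'a \<Rightarrow> 'a" where
  "commutator G x y = inv\<^bsub>G\<^esub> x \<otimes>\<^bsub>G\<^esub> inv\<^bsub>G\<^esub> y \<otimes>\<^bsub>G\<^esub> x \<otimes>\<^bsub>G\<^esub> y"

text \<open>The commutator of the empty list is a junk value.\<close>

fun left_normed_commutator :: "('a, 'b) monoid_scheme \<Rightarrow> 'a list \<Rightarrow> 'a" where
  "left_normed_commutator G [] = \<one>\<^bsub>G\<^esub>"
| "left_normed_commutator G (x # xs) = foldl (commutator G) x xs"

lemma left_normed_commutator_snoc: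
  "xs \<noteq> [] \<Longrightarrow>
    left_normed_commutator G (xs @ [x]) = commutator G (left_normed_commutator G xs) x"
  by (cases xs) simp_all

definition lower_central :: "('a, 'b) monoid_scheme \<Rightarrow> 'a topology \<Rightarrow> nat \<Rightarrow> 'a set" where
  "lower_central G T r =
    T closure_of (generate G
      {left_normed_commutator G xs | xs. length xs = r \<and> set xs \<subseteq> carrier G})"

text \<open>Meant for closed subgroups \<open>H\<close>, for which the closure taken in \<open>T\<close> agrees with the
  closure taken in \<open>H\<close>.\<close>

definition topologically_generates ::
    "('a, 'b) monoid_scheme \<Rightarrow> 'a topology \<Rightarrow> 'a set \<Rightarrow> 'a set \<Rightarrow> bool" where
  "topologically_generates G T S H \<longleftrightarrow> S \<subseteq> H \<and> T closure_of (generate G S) = H"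

definition procyclic :: "('a, 'b) monoid_scheme \<Rightarrow> 'a topology \<Rightarrow> 'a set \<Rightarrow> bool" where
  "procyclic G T H \<longleftrightarrow> (\<exists>a. topologically_generates G T {a} H)"

end

theory Submission
  imports Defs
begin

text \<open>By compactness of \<open>G\<close> it suffices to find, for each open normal subgroup, a position and entries
  that work modulo it, so \<open>G\<close> may be taken to be a finite \<open>p\<close>-group. Write \<open>N = \<gamma>\<^sub>r(G)\<close> and
  \<open>\<phi>(g) = [b, g, y\<^sub>1, \<dots>, y\<^sub>m]\<close>. One filters \<open>N\<close> by normal subgroups \<open>N = N\<^sub>0 \<ge> N\<^sub>1 \<ge> \<dots>\<close> with
  \<open>[N\<^sub>k, G] \<le> N\<^bsub>k+1\<^esub>\<close> such that the \<open>p\<close>-th powers of \<open>N\<^sub>k\<close> cover \<open>N\<^bsub>k+e\<^esub>\<close> modulo \<open>N\<^bsub>k+e+1\<^esub>\<close>,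
  where \<open>e\<close> is \<open>1\<close> or \<open>2\<close>. If \<open>[b, h]\<close> lies in the \<open>m\<close>-th centre of \<open>G\<close> modulo \<open>N\<^sub>k\<close>, then
  \<open>\<phi>(hg) = \<phi>(g) \<phi>(h)\<close> modulo \<open>N\<^bsub>k+1\<^esub>\<close>, so it is enough that such \<open>h\<close> cover every \<open>N\<^sub>k\<close> modulo
  \<open>N\<^bsub>k+1\<^esub>\<close>; and \<open>h \<mapsto> h\<^sup>p\<close> carries a cover of \<open>N\<^sub>k\<close> to one of \<open>N\<^bsub>k+e\<^esub>\<close>, up to error terms.
  Only the first \<open>e\<close> layers remain.

  If \<open>[N, G]\<close> lies in the Frattini subgroup of \<open>N\<close>, then \<open>e = 1\<close>, and a multilinear map whose values
  span a space of dimension at most \<open>2\<close> has a slice onto that space. Otherwise \<open>e = 2\<close>, and with \<open>D\<close>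
  the centralizer of \<open>N/N\<^sub>2\<close> and \<open>G = D\<langle>t\<rangle>\<close> one uses \<open>\<phi>(g) = [x\<^sub>1, \<dots>, x\<^sub>s, g, t, \<dots>, t]\<close> with the
  largest \<open>s \<ge> 1\<close> for which some \<open>d \<in> D\<close> gives \<open>\<phi>(d) \<notin> N\<^sub>1\<close>: then \<open>d\<close> covers the first layer and
  \<open>[d, t]\<close> the second, and maximality of \<open>s\<close> makes the error terms for small \<open>p\<close> vanish. The same
  choice, with \<open>e = 1\<close>, settles the cyclic case for all \<open>p\<close>.\<close>

section \<open>Commutators modulo a normal subgroup\<close>

text \<open>The obstacle is that \<open>[b, h^p, ...]\<close> is the \<open>p\<close>-th power of
  \<open>[b, h, ...]\<close> only up to terms \<open>[b, h, h, ...]\<close> and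
  \<open>[b, h, h, h, ...]\<close> with binomial exponents. They are controlled by the notion
  \<open>deep\<close>: commutation with a deep element gains two layers instead of one. Commutators
  and \<open>p\<close>-th powers are deep, so once \<open>h\<close> has been replaced by
  \<open>h^p\<close> all later errors vanish by themselves, and only the passage from layer
  \<open>0\<close> to layer \<open>e\<close> is delicate. Since \<open>r >= 2\<close>, the elements
  of \<open>N\<close> are products of commutators and hence deep too; therefore taking
  \<open>p\<close>-th powers is additive on layers, and if layer \<open>e\<close> consists of
  \<open>p\<close>-th powers then so do all later ones. If \<open>N\<close> has two generators and
  \<open>[N, G]\<close> is not inside its Frattini subgroup, then the first two layers have order
  \<open>p\<close> each and the third term of the chain is the Frattini subgroup. Powers then skip a
  layer. This is the origin of \<open>e = 2\<close>; it calls for a separate covering of layer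
  \<open>1\<close>, and it uses that an odd \<open>p\<close> divides
  \<open>p choose 2\<close>.\<close>

context group
begin

abbreviation cm :: "'a \<Rightarrow> 'a \<Rightarrow> 'a" where "cm \<equiv> commutator G"

lemma inv_mult_cancel [simp]: "x \<in> carrier G \<Longrightarrow> y \<in> carrier G \<Longrightarrow> inv x \<otimes> (x \<otimes> y) = y"
  by (simp flip: m_assoc)

lemma mult_inv_cancel [simp]: "x \<in> carrier G \<Longrightarrow> y \<in> carrier G \<Longrightarrow> x \<otimes> (inv x \<otimes> y) = y"
  by (simp flip: m_assoc)

lemma comm_closed [simp]: "x \<in> carrier G \<Longrightarrow> y \<in> carrier G \<Longrightarrow> cm x y \<in> carrier G"
  by (simp add: commutator_def)

lemma inv_comm: "x \<in> carrier G \<Longrightarrow> y \<in> carrier G \<Longrightarrow> inv (cm x y) = cm y x"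
  by (simp add: commutator_def inv_mult_group m_assoc)

lemma comm_mult_left:
  "\<lbrakk>x \<in> carrier G; y \<in> carrier G; z \<in> carrier G\<rbrakk> \<Longrightarrow>
    cm (x \<otimes> y) z = cm x z \<otimes> cm (cm x z) y \<otimes> cm y z"
  by (simp add: commutator_def inv_mult_group m_assoc)

lemma comm_mult_right:
  "\<lbrakk>x \<in> carrier G; y \<in> carrier G; z \<in> carrier G\<rbrakk> \<Longrightarrow>
    cm x (y \<otimes> z) = cm x z \<otimes> cm x y \<otimes> cm (cm x y) z"
  by (simp add: commutator_def inv_mult_group m_assoc)

lemma comm_eq_one_iff:
  "\<lbrakk>x \<in> carrier G; y \<in> carrier G\<rbrakk> \<Longrightarrow> cm x y = \<one> \<longleftrightarrow> x \<otimes> y = y \<otimes> x"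
proof -
  assume a: "x \<in> carrier G" "y \<in> carrier G"
  have "y \<otimes> x \<otimes> cm x y = x \<otimes> y" using a by (simp add: commutator_def m_assoc)
  then show ?thesis using a l_cancel[of "y \<otimes> x" "cm x y" "\<one>"] by auto
qed

lemma mult_comm_swap:
  "\<lbrakk>x \<in> carrier G; y \<in> carrier G\<rbrakk> \<Longrightarrow> x \<otimes> y = y \<otimes> x \<otimes> cm x y"
  by (simp add: commutator_def m_assoc)

lemma comm_one [simp]:
  "x \<in> carrier G \<Longrightarrow> cm x \<one> = \<one>" "x \<in> carrier G \<Longrightarrow> cm \<one> x = \<one>"
  by (simp_all add: commutator_def)

lemma comm_self [simp]: "x \<in> carrier G \<Longrightarrow> cm x x = \<one>"
  by (simp add: commutator_def m_assoc)

lemma comm_inv_left: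
  "\<lbrakk>x \<in> carrier G; y \<in> carrier G\<rbrakk> \<Longrightarrow> cm (inv x) y = x \<otimes> cm y x \<otimes> inv x"
  by (simp add: commutator_def m_assoc)

lemma comm_in_normal_left:
  assumes "K \<lhd> G" "x \<in> K" "y \<in> carrier G"
  shows "cm x y \<in> K"
proof -
  interpret K: normal K G by fact
  have "inv y \<otimes> x \<otimes> y \<in> K" using K.inv_op_closed1 assms by blast
  then have "inv x \<otimes> (inv y \<otimes> x \<otimes> y) \<in> K" using assms by blast
  then show ?thesis using assms(2,3) K.subset by (simp add: commutator_def m_assoc subset_iff)
qed

lemma conj_pow:
  assumes "g \<in> carrier G" "x \<in> carrier G"
  shows "g \<otimes> x [^] (i::nat) \<otimes> inv g = (g \<otimes> x \<otimes> inv g) [^] i"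
proof (induction i)
  case (Suc i)
  have "g \<otimes> x [^] Suc i \<otimes> inv g = (g \<otimes> x [^] i \<otimes> inv g) \<otimes> (g \<otimes> x \<otimes> inv g)"
    using assms by (simp add: m_assoc)
  then show ?case using Suc by simp
qed (use assms in simp)

lemma conj_comm:
  assumes "g \<in> carrier G" "x \<in> carrier G" "y \<in> carrier G"
  shows "g \<otimes> cm x y \<otimes> inv g = cm (g \<otimes> x \<otimes> inv g) (g \<otimes> y \<otimes> inv g)"
  using assms by (simp add: commutator_def m_assoc inv_mult_group)

text \<open>Congruence modulo a normal subgroup \<open>K\<close> is the equation \<open>K #> x = K #> y\<close>.\<close>

lemma coset_eq_iff:
  assumes "K \<lhd> G" "x \<in> carrier G" "y \<in> carrier G"
  shows "K #> x = K #> y \<longleftrightarrow> inv y \<otimes> x \<in> K"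
proof -
  interpret K: normal K G by fact
  have "K #> x = K #> y \<longleftrightarrow> x \<in> y <# K"
    using assms K.coset_eq repr_independence[OF _ _ K.subgroup_axioms]
    by (metis K.is_subgroup rcos_self)
  also have "\<dots> \<longleftrightarrow> inv y \<otimes> x \<in> K"
  proof
    assume "x \<in> y <# K"
    then obtain k where "k \<in> K" "x = y \<otimes> k" by (auto simp: l_coset_def)
    then show "inv y \<otimes> x \<in> K" using assms K.subset by auto
  next
    assume "inv y \<otimes> x \<in> K"
    then show "x \<in> y <# K" using assms by (auto simp: l_coset_def intro!: bexI[of _ "inv y \<otimes> x"])
  qed
  finally show ?thesis .
qed

lemma coset_eq_iff':
  assumes "K \<lhd> G" "x \<in> carrier G" "y \<in> carrier G"
  shows "K #> x = K #> y \<longleftrightarrow> (\<exists>k\<in>K. x = y \<otimes> k)"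
proof -
  interpret K: normal K G by fact
  show ?thesis unfolding coset_eq_iff[OF assms]
    using assms K.subset by (metis inv_mult_cancel inv_solve_left' m_assoc m_closed inv_closed subsetD)
qed

lemma coset_mono:
  assumes "K \<lhd> G" "L \<lhd> G" "K \<subseteq> L" "x \<in> carrier G" "y \<in> carrier G" "K #> x = K #> y"
  shows "L #> x = L #> y"
  using assms coset_eq_iff by blast

lemma coset_one_iff:
  assumes "K \<lhd> G" "x \<in> carrier G"
  shows "K #> x = K #> \<one> \<longleftrightarrow> x \<in> K"
  using coset_eq_iff[OF assms one_closed] assms by simp

lemma coset_eq_one_iff:
  "K \<lhd> G \<Longrightarrow> x \<in> carrier G \<Longrightarrow> K #> x = \<one>\<^bsub>G Mod K\<^esub> \<longleftrightarrow> x \<in> K"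
  using coset_one_iff[of K x] normal_imp_subgroup[of K G] subgroup.subset[of K G] by simp

lemma coset_mem_iff:
  assumes "K \<lhd> G" "K \<subseteq> L" "subgroup L G" "x \<in> carrier G" "y \<in> carrier G" "K #> x = K #> y"
  shows "x \<in> L \<longleftrightarrow> y \<in> L"
proof -
  interpret L: subgroup L G by fact
  from assms obtain k where k: "k \<in> K" "x = y \<otimes> k" using coset_eq_iff' by blast
  then have kL: "k \<in> L" and kc: "k \<in> carrier G" using assms L.subset by auto
  have "y = x \<otimes> inv k" using k kc assms by (simp add: m_assoc)
  then show ?thesis using k kL by (metis L.m_closed L.m_inv_closed)
qed

lemma group_hom_coset:
  assumes "K \<lhd> G" shows "group_hom G (G Mod K) (\<lambda>x. K #> x)"
  using assms normal.r_coset_hom_Mod normal.factorgroup_is_group is_group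
  by (intro group_hom.intro group_hom_axioms.intro) auto

end

lemma (in group_hom) hom_commutator:
  assumes "x \<in> carrier G" "y \<in> carrier G"
  shows "h (commutator G x y) = commutator H (h x) (h y)"
  using assms by (simp add: commutator_def)

context group
begin

lemma coset_mult:
  assumes "K \<lhd> G" "x \<in> carrier G" "y \<in> carrier G" "x' \<in> carrier G" "y' \<in> carrier G"
    and "K #> x = K #> x'" "K #> y = K #> y'"
  shows "K #> (x \<otimes> y) = K #> (x' \<otimes> y')"
proof -
  interpret h: group_hom G "G Mod K" "\<lambda>x. K #> x" by (rule group_hom_coset) fact
  show ?thesis using assms h.hom_mult by metis
qed

lemma coset_inv:
  assumes "K \<lhd> G" "x \<in> carrier G" "x' \<in> carrier G" "K #> x = K #> x'"
  shows "K #> inv x = K #> inv x'"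
proof -
  interpret h: group_hom G "G Mod K" "\<lambda>x. K #> x" by (rule group_hom_coset) fact
  show ?thesis using assms h.hom_inv by metis
qed

lemma coset_pow:
  assumes "K \<lhd> G" "x \<in> carrier G" "x' \<in> carrier G" "K #> x = K #> x'"
  shows "K #> (x [^] (n::nat)) = K #> (x' [^] n)"
proof -
  interpret h: group_hom G "G Mod K" "\<lambda>x. K #> x" by (rule group_hom_coset) fact
  show ?thesis using assms h.hom_nat_pow by metis
qed

text \<open>By \<open>c\<close> every \<open>[a, g]\<close> is central, so
  \<open>g |-> [a, g]\<close> is a homomorphism into an abelian group and kills commutators. This
  instance of the three subgroup lemma is what later makes commutators deep.\<close>

lemma comm_comm_one:
  assumes a: "a \<in> carrier G" "x \<in> carrier G" "y \<in> carrier G"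
    and c: "\<And>g h. g \<in> carrier G \<Longrightarrow> h \<in> carrier G \<Longrightarrow> cm (cm a g) h = \<one>"
  shows "cm a (cm x y) = \<one>"
proof -
  have m: "cm a (g \<otimes> h) = cm a g \<otimes> cm a h" if "g \<in> carrier G" "h \<in> carrier G" for g h
    using that a c[of g h] c[of g "cm a h"] comm_eq_one_iff[of "cm a g" "cm a h"]
    by (simp add: comm_mult_right)
  have i: "cm a (inv g) = inv (cm a g)" if "g \<in> carrier G" for g
    using m[of g "inv g"] that a by (simp add: inv_equality m comm_eq_one_iff) 
      (metis a(1) comm_closed inv_closed inv_equality inv_inv l_inv m)
  have "cm a (cm x y) = inv (cm a x) \<otimes> inv (cm a y) \<otimes> cm a x \<otimes> cm a y"
    using a by (simp add: commutator_def[of G x y] m i)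
  also have "\<dots> = cm (cm a x) (cm a y)" by (simp add: commutator_def)
  finally show ?thesis using a c by simp
qed

text \<open>A Jacobi identity: in the expansions of \<open>[b, xy]\<close> and
  \<open>[b, yx [x, y]]\<close> everything cancels except two central triple commutators.\<close>

lemma comm_comm_expand:
  assumes a: "b \<in> carrier G" "x \<in> carrier G" "y \<in> carrier G"
    and c: "\<And>g h k. g \<in> carrier G \<Longrightarrow> h \<in> carrier G \<Longrightarrow> k \<in> carrier G \<Longrightarrow> cm (cm (cm b g) h) k = \<one>"
  shows "cm b (cm x y) = cm (cm b x) y \<otimes> inv (cm (cm b y) x)"
proof -
  have z: "cm (cm b g) (cm u v) = \<one>" if "g \<in> carrier G" "u \<in> carrier G" "v \<in> carrier G" for g u v
    using that a c comm_comm_one[of "cm b g" u v] by simp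
  have com: "cm b x \<otimes> cm b y = cm b y \<otimes> cm b x"
    using z[of x b y] a comm_eq_one_iff by simp
  have "cm b (x \<otimes> y) = cm b (y \<otimes> x \<otimes> cm x y)" using a by (subst mult_comm_swap) auto
  also have "\<dots> = cm b (cm x y) \<otimes> cm b (y \<otimes> x)"
    using a by (simp add: comm_mult_right[of b "y \<otimes> x"] z)
  finally have "cm b (cm x y) = cm b (x \<otimes> y) \<otimes> inv (cm b (y \<otimes> x))"
    using a by (simp add: m_assoc)
  also have "cm b (x \<otimes> y) = cm b y \<otimes> cm b x \<otimes> cm (cm b x) y" using a by (simp add: comm_mult_right)
  also have "cm b (y \<otimes> x) = cm b y \<otimes> cm b x \<otimes> cm (cm b y) x" using a com by (simp add: comm_mult_right)
  finally have 1: "cm b (cm x y) = cm b y \<otimes> cm b x \<otimes> cm (cm b x) y \<otimes> inv (cm b y \<otimes> cm b x \<otimes> cm (cm b y) x)" .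
  define q where "q = cm b y \<otimes> cm b x"
  define s where "s = cm (cm b x) y \<otimes> inv (cm (cm b y) x)"
  have cen: "cm (cm (cm b g) h) q = \<one>" if "g \<in> carrier G" "h \<in> carrier G" for g h
    using that a c q_def by simp
  have com2: "cm (cm b g) h \<otimes> q = q \<otimes> cm (cm b g) h" if "g \<in> carrier G" "h \<in> carrier G" for g h
    using cen[OF that] comm_eq_one_iff that a q_def by simp
  have qc: "q \<in> carrier G" using a q_def by simp
  have "cm b (cm x y) = cm (cm b x) y \<otimes> q \<otimes> inv (cm (cm b y) x \<otimes> q)"
    using 1 com2[of x y] com2[of y x] a unfolding q_def[symmetric] by simp
  then show ?thesis using a qc by (simp add: inv_mult_group m_assoc)
qed

text \<open>Since \<open>[b, h^(n+1)]\<close> is \<open>[b, h]\<close> times the conjugate of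
  \<open>[b, h^n]\<close> by \<open>h\<close>, the induction only follows conjugation by
  \<open>h\<close>, which sends \<open>w\<close> to \<open>w w1\<close> and \<open>w1\<close> to
  \<open>w1 w2\<close> and fixes \<open>w2\<close>. Pascal's rule yields the exponents.\<close>

lemma comm_pow:
  assumes a: "b \<in> carrier G" "h \<in> carrier G"
    and w: "w = cm b h" "w1 = cm w h" "w2 = cm w1 h" "cm w2 h = \<one>"
    and c: "cm w1 w = \<one>" "cm w2 w = \<one>" "cm w2 w1 = \<one>"
  shows "cm b (h [^] (n::nat)) = w [^] n \<otimes> w1 [^] (n choose 2) \<otimes> w2 [^] (n choose 3)"
proof -
  have w_in: "w \<in> carrier G" using comm_closed[OF a] w(1) by simp
  have w1_in: "w1 \<in> carrier G" using comm_closed[OF w_in a(2)] w(2) by simp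
  have w2_in: "w2 \<in> carrier G" using comm_closed[OF w1_in a(2)] w(3) by simp
  note W = w_in w1_in w2_in
  have C: "w1 \<otimes> w = w \<otimes> w1" "w2 \<otimes> w = w \<otimes> w2" "w2 \<otimes> w1 = w1 \<otimes> w2" "w2 \<otimes> h = h \<otimes> w2"
    using W c w(4) a(2) comm_eq_one_iff by auto
  define cj where "cj x = inv h \<otimes> x \<otimes> h" for x
  have cj_hom: "cj (x \<otimes> y) = cj x \<otimes> cj y" if "x \<in> carrier G" "y \<in> carrier G" for x y
    using that a by (simp add: cj_def m_assoc)
  have cj_pow: "cj (x [^] i) = cj x [^] i" if "x \<in> carrier G" for x and i :: nat
  proof (induction i)
    case 0 show ?case using a by (simp add: cj_def)
  next
    case (Suc i) then show ?case using that by (simp add: cj_hom)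
  qed
  have cjw: "cj w = w \<otimes> w1" "cj w1 = w1 \<otimes> w2" "cj w2 = w2"
  proof -
    have g: "cj x = x \<otimes> cm x h" if "x \<in> carrier G" for x
      using that a(2) by (simp add: cj_def commutator_def m_assoc)
    show "cj w = w \<otimes> w1" using g[OF W(1)] w(2) by simp
    show "cj w1 = w1 \<otimes> w2" using g[OF W(2)] w(3) by simp
    show "cj w2 = w2" using g[OF W(3)] w(4) W by simp
  qed
  show ?thesis
  proof (induction n)
    case 0 show ?case using a W by (simp add: numeral_2_eq_2 numeral_3_eq_3)
  next
    case (Suc n)
    let ?i = "n choose 2" and ?k = "n choose 3"
    have s2: "Suc n choose 2 = n + ?i" "Suc n choose 3 = ?i + ?k"
      by (simp_all add: numeral_2_eq_2 numeral_3_eq_3)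
    have hn: "h [^] n \<in> carrier G" using a by simp
    have "cm b (h [^] Suc n) = w \<otimes> (cm b (h [^] n) \<otimes> cm (cm b (h [^] n)) h)"
      using a hn unfolding w(1) by (simp add: comm_mult_right m_assoc)
    also have "cm b (h [^] n) \<otimes> cm (cm b (h [^] n)) h = cj (cm b (h [^] n))"
      using a comm_closed[OF a(1) hn] by (simp add: cj_def commutator_def[of G "cm b (h [^] n)"] m_assoc del: comm_closed)
    also have "\<dots> = (w \<otimes> w1) [^] n \<otimes> (w1 \<otimes> w2) [^] ?i \<otimes> w2 [^] ?k"
      using W by (simp add: Suc.IH cj_hom cj_pow cjw)
    also have "(w \<otimes> w1) [^] n = w [^] n \<otimes> w1 [^] n" using C W by (simp add: pow_mult_distrib)
    also have "(w1 \<otimes> w2) [^] ?i = w1 [^] ?i \<otimes> w2 [^] ?i" using C W by (simp add: pow_mult_distrib)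
    finally have "cm b (h [^] Suc n) = w \<otimes> w [^] n \<otimes> (w1 [^] n \<otimes> w1 [^] ?i) \<otimes> (w2 [^] ?i \<otimes> w2 [^] ?k)"
      using W by (simp add: m_assoc)
    also have "w \<otimes> w [^] n = w [^] Suc n" using W by (metis nat_pow_Suc2)
    finally show ?case using W unfolding s2 by (simp only: nat_pow_mult)
  qed
qed

lemma coset_hom_image:
  assumes "g \<in> carrier (G Mod K)" shows "\<exists>x\<in>carrier G. g = K #> x"
  using assms by (auto simp: carrier_FactGroup)

lemma comm_comm_mem:
  assumes "C \<lhd> G" "a \<in> carrier G" "x \<in> carrier G" "y \<in> carrier G"
    and c: "\<And>g h. g \<in> carrier G \<Longrightarrow> h \<in> carrier G \<Longrightarrow> cm (cm a g) h \<in> C"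
  shows "cm a (cm x y) \<in> C"
proof -
  interpret h: group_hom G "G Mod C" "\<lambda>x. C #> x" by (rule group_hom_coset) fact
  note one = coset_eq_one_iff[OF assms(1)]
  have "commutator (G Mod C) (C #> a) (commutator (G Mod C) (C #> x) (C #> y)) = \<one>\<^bsub>G Mod C\<^esub>"
  proof (rule h.H.comm_comm_one)
    fix g h assume "g \<in> carrier (G Mod C)" "h \<in> carrier (G Mod C)"
    then obtain g' h' where "g' \<in> carrier G" "g = C #> g'" "h' \<in> carrier G" "h = C #> h'"
      using coset_hom_image by metis
    then show "commutator (G Mod C) (commutator (G Mod C) (C #> a) g) h = \<one>\<^bsub>G Mod C\<^esub>"
      using one[of "cm (cm a g') h'"] c assms by (simp add: h.hom_commutator)
  qed (use assms h.hom_closed in auto)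
  then show ?thesis using one[of "cm a (cm x y)"] assms by (simp add: h.hom_commutator)
qed

lemma comm_comm_expand_mod:
  assumes "C \<lhd> G" "b \<in> carrier G" "x \<in> carrier G" "y \<in> carrier G"
    and c: "\<And>g h k. g \<in> carrier G \<Longrightarrow> h \<in> carrier G \<Longrightarrow> k \<in> carrier G \<Longrightarrow> cm (cm (cm b g) h) k \<in> C"
  shows "C #> cm b (cm x y) = C #> (cm (cm b x) y \<otimes> inv (cm (cm b y) x))"
proof -
  interpret h: group_hom G "G Mod C" "\<lambda>x. C #> x" by (rule group_hom_coset) fact
  note one = coset_eq_one_iff[OF assms(1)]
  have "commutator (G Mod C) (C #> b) (commutator (G Mod C) (C #> x) (C #> y)) =
    commutator (G Mod C) (commutator (G Mod C) (C #> b) (C #> x)) (C #> y) \<otimes>\<^bsub>G Mod C\<^esub>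
    inv\<^bsub>G Mod C\<^esub> (commutator (G Mod C) (commutator (G Mod C) (C #> b) (C #> y)) (C #> x))"
  proof (rule h.H.comm_comm_expand)
    fix g h k assume "g \<in> carrier (G Mod C)" "h \<in> carrier (G Mod C)" "k \<in> carrier (G Mod C)"
    then obtain g' h' k' where "g' \<in> carrier G" "g = C #> g'" "h' \<in> carrier G" "h = C #> h'"
      "k' \<in> carrier G" "k = C #> k'"
      using coset_hom_image by metis
    then show "commutator (G Mod C) (commutator (G Mod C) (commutator (G Mod C) (C #> b) g) h) k = \<one>\<^bsub>G Mod C\<^esub>"
      using one[of "cm (cm (cm b g') h') k'"] c assms by (simp add: h.hom_commutator)
  qed (use assms h.hom_closed in auto)
  then show ?thesis using assms
    by (simp del: mult_FactGroup add: h.hom_commutator)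
qed

lemma comm_pow_mod:
  assumes K: "K \<lhd> G" and a: "b \<in> carrier G" "h \<in> carrier G"
    and w: "w = cm b h" "w1 = cm w h" "w2 = cm w1 h" "cm w2 h \<in> K"
    and c: "cm w1 w \<in> K" "cm w2 w \<in> K" "cm w2 w1 \<in> K"
  shows "K #> cm b (h [^] (n::nat)) = K #> (w [^] n \<otimes> w1 [^] (n choose 2) \<otimes> w2 [^] (n choose 3))"
proof -
  interpret f: group_hom G "G Mod K" "\<lambda>x. K #> x" by (rule group_hom_coset) fact
  note one = coset_eq_one_iff[OF assms(1)]
  have w_in: "w \<in> carrier G" using comm_closed[OF a] w(1) by simp
  have w1_in: "w1 \<in> carrier G" using comm_closed[OF w_in a(2)] w(2) by simp
  have w2_in: "w2 \<in> carrier G" using comm_closed[OF w1_in a(2)] w(3) by simp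
  have "commutator (G Mod K) (K #> b) ((K #> h) [^]\<^bsub>G Mod K\<^esub> n) =
    (K #> w) [^]\<^bsub>G Mod K\<^esub> n \<otimes>\<^bsub>G Mod K\<^esub> (K #> w1) [^]\<^bsub>G Mod K\<^esub> (n choose 2) \<otimes>\<^bsub>G Mod K\<^esub>
    (K #> w2) [^]\<^bsub>G Mod K\<^esub> (n choose 3)"
  proof (rule f.H.comm_pow)
    show "K #> b \<in> carrier (G Mod K)" "K #> h \<in> carrier (G Mod K)" using a by auto
    show "K #> w = commutator (G Mod K) (K #> b) (K #> h)" using a w(1) f.hom_commutator by simp
    show "K #> w1 = commutator (G Mod K) (K #> w) (K #> h)" using a w_in w(2) f.hom_commutator by simp
    show "K #> w2 = commutator (G Mod K) (K #> w1) (K #> h)" using a w1_in w(3) f.hom_commutator by simp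
    show "commutator (G Mod K) (K #> w2) (K #> h) = \<one>\<^bsub>G Mod K\<^esub>"
      using one[of "cm w2 h"] w(4) a w2_in f.hom_commutator[of w2 h] by simp
    show "commutator (G Mod K) (K #> w1) (K #> w) = \<one>\<^bsub>G Mod K\<^esub>"
      using one[of "cm w1 w"] c(1) w1_in w_in f.hom_commutator[of w1 w] by simp
    show "commutator (G Mod K) (K #> w2) (K #> w) = \<one>\<^bsub>G Mod K\<^esub>"
      using one[of "cm w2 w"] c(2) w2_in w_in f.hom_commutator[of w2 w] by simp
    show "commutator (G Mod K) (K #> w2) (K #> w1) = \<one>\<^bsub>G Mod K\<^esub>"
      using one[of "cm w2 w1"] c(3) w2_in w1_in f.hom_commutator[of w2 w1] by simp
  qed
  then show ?thesis using a w_in w1_in w2_in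
    by (simp del: mult_FactGroup add: f.hom_commutator f.hom_nat_pow)
qed

lemma center_mod_normal:
  assumes "K \<lhd> G"
  shows "{v \<in> carrier G. \<forall>g\<in>carrier G. cm v g \<in> K} \<lhd> G" (is "?Z \<lhd> G")
proof -
  interpret K: normal K G by fact
  have "subgroup ?Z G"
  proof
    fix x y assume x: "x \<in> ?Z" and y: "y \<in> ?Z"
    then show "x \<otimes> y \<in> ?Z"
      using comm_in_normal_left[OF assms] by (auto simp: comm_mult_left)
  next
    fix x assume x: "x \<in> ?Z"
    show "inv x \<in> ?Z"
    proof (clarsimp, intro conjI ballI)
      show "inv x \<in> carrier G" using x by simp
      fix g assume g: "g \<in> carrier G"
      have "cm g x \<in> K" using x g inv_comm[of x g] by (metis (no_types, lifting) K.m_inv_closed mem_Collect_eq)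
      then show "cm (inv x) g \<in> K" using x g K.inv_op_closed2 by (simp add: comm_inv_left)
    qed
  qed auto
  moreover have "x \<otimes> h \<otimes> inv x \<in> ?Z" if "x \<in> carrier G" "h \<in> ?Z" for x h
  proof (clarsimp, intro conjI ballI)
    show "x \<otimes> h \<otimes> inv x \<in> carrier G" using that by simp
    fix g assume g: "g \<in> carrier G"
    have "cm (x \<otimes> h \<otimes> inv x) g = x \<otimes> cm h (inv x \<otimes> g \<otimes> x) \<otimes> inv x"
      using that g by (simp add: commutator_def m_assoc inv_mult_group)
    then show "cm (x \<otimes> h \<otimes> inv x) g \<in> K" using that g K.inv_op_closed2 by simp
  qed
  ultimately show ?thesis unfolding normal_inv_iff by blast
qed

lemma foldl_comm_closed [simp]:
  "v \<in> carrier G \<Longrightarrow> set ys \<subseteq> carrier G \<Longrightarrow> foldl cm v ys \<in> carrier G"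
  by (induction ys arbitrary: v) auto

end

section \<open>Relative upper central series of a central chain\<close>

locale central_chain = group G for G (structure) +
  fixes N :: "nat \<Rightarrow> 'a set"
  assumes chain_normal: "N k \<lhd> G"
    and chain_comm: "x \<in> N k \<Longrightarrow> g \<in> carrier G \<Longrightarrow> commutator G x g \<in> N (Suc k)"
    and chain_desc: "N (Suc k) \<subseteq> N k"
begin

text \<open>\<open>Z m k\<close> is the preimage in \<open>G\<close> of the \<open>m\<close>-th term of the upper central series of the
  quotient by \<open>N k\<close>.\<close>

primrec Z :: "nat \<Rightarrow> nat \<Rightarrow> 'a set" where
  "Z 0 k = N k"
| "Z (Suc m) k = {v \<in> carrier G. \<forall>g\<in>carrier G. cm v g \<in> Z m k}"

lemma Z_normal: "Z m k \<lhd> G"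
proof (induction m)
  case (Suc m) show ?case using center_mod_normal[OF Suc] by simp
qed (simp add: chain_normal)

lemma Z_carrier: "v \<in> Z m k \<Longrightarrow> v \<in> carrier G"
  using Z_normal normal_imp_subgroup subgroup.mem_carrier by metis

lemma Z_subgroup: "subgroup (Z m k) G"
  using Z_normal normal_imp_subgroup by blast

lemma Z_one [simp]: "\<one> \<in> Z m k"
  using subgroup.one_closed[OF Z_subgroup] .

text \<open>The factors \<open>N k / N (k+1)\<close> are central, so one more layer costs one more
  commutation. This is the rate of exchange between the two indices.\<close>

lemma Z_subset_Suc_Suc: "Z m k \<subseteq> Z (Suc m) (Suc k)"
proof (induction m)
  case 0 show ?case using chain_comm Z_carrier[of _ 0] by auto
next
  case (Suc m)
  show ?case
  proof
    fix v assume v: "v \<in> Z (Suc m) k"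
    then have "v \<in> carrier G" "\<And>g. g \<in> carrier G \<Longrightarrow> cm v g \<in> Z m k" by auto
    then have "v \<in> carrier G" "\<And>g. g \<in> carrier G \<Longrightarrow> cm v g \<in> Z (Suc m) (Suc k)" using Suc by blast+
    then show "v \<in> Z (Suc (Suc m)) (Suc k)" unfolding Z.simps(2)[of "Suc m"] by blast
  qed
qed

lemma Z_comm: "v \<in> Z m k \<Longrightarrow> g \<in> carrier G \<Longrightarrow> cm v g \<in> Z m (Suc k)"
  using Z_subset_Suc_Suc[of m k] by auto

lemma Z_antimono_Suc: "Z m (Suc k) \<subseteq> Z m k"
  using chain_desc by (induction m) auto

lemma Z_antimono: "k \<le> l \<Longrightarrow> Z m l \<subseteq> Z m k"
  by (induction rule: dec_induct) (use Z_antimono_Suc in blast)+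

lemma Z_subset_Suc: "Z m k \<subseteq> Z (Suc m) k"
  using comm_in_normal_left[OF Z_normal] Z_carrier by auto

text \<open>A commutator has weight two: commuting with it gains two layers, or, in the next lemma,
  descends two steps of the upper central series.\<close>

lemma Z_comm_comm:
  assumes "v \<in> Z m k" "x \<in> carrier G" "y \<in> carrier G"
  shows "cm v (cm x y) \<in> Z m (k + 2)"
  using assms Z_carrier Z_comm by (intro comm_comm_mem Z_normal) auto

lemma Z_comm_comm_dec:
  assumes "v \<in> Z (Suc (Suc m)) k" "x \<in> carrier G" "y \<in> carrier G"
  shows "cm v (cm x y) \<in> Z m k"
  using assms by (intro comm_comm_mem Z_normal) auto

lemma Z_inv: "v \<in> Z m k \<Longrightarrow> inv v \<in> Z m k"
  using Z_subgroup subgroup.m_inv_closed by metis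

lemma Z_mult: "v \<in> Z m k \<Longrightarrow> u \<in> Z m k \<Longrightarrow> v \<otimes> u \<in> Z m k"
  using Z_subgroup subgroup.m_closed by metis

lemma Z_pow_closed: "v \<in> Z m k \<Longrightarrow> v [^] (n::nat) \<in> Z m k"
  by (induction n) (auto intro: Z_mult)

lemma Z_comm_swap: "x \<in> carrier G \<Longrightarrow> y \<in> carrier G \<Longrightarrow> cm x y \<in> Z m k \<Longrightarrow> cm y x \<in> Z m k"
  using inv_comm Z_inv by metis

lemma foldl_comm_mem:
  "length ys = m \<Longrightarrow> v \<in> Z m k \<Longrightarrow> set ys \<subseteq> carrier G \<Longrightarrow> foldl cm v ys \<in> N k"
  by (induction ys arbitrary: m v) auto

text \<open>Induction along \<open>ys\<close> from
  \<open>[uv, y] = [u, y] [[u, y], v] [v, y]\<close>. The middle factor is a commutator of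
  \<open>v\<close> with a commutator, so it descends two steps of the upper central series at once
  and is killed by the remaining entries.\<close>

lemma foldl_comm_mult:
  assumes "length ys = m" "v \<in> Z (Suc m) K" "u \<in> carrier G" "set ys \<subseteq> carrier G"
  shows "N K #> foldl cm (u \<otimes> v) ys = N K #> (foldl cm u ys \<otimes> foldl cm v ys)"
  using assms
proof (induction ys arbitrary: m u v)
  case Nil then show ?case by simp
next
  case (Cons y ys m u v)
  then obtain m' where m: "m = Suc m'" "length ys = m'" by auto
  have y: "y \<in> carrier G" and ys: "set ys \<subseteq> carrier G" and u: "u \<in> carrier G" using Cons by auto
  have v: "v \<in> carrier G" using Cons Z_carrier by blast
  define z where "z = cm (cm u y) v"
  have "cm v (cm u y) \<in> Z m' K" using Cons.prems m u y by (intro Z_comm_comm_dec) auto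
  then have z: "z \<in> Z m' K" using Z_comm_swap u y v z_def by simp
  have zc: "z \<in> carrier G" using z Z_carrier by blast
  have vy: "cm v y \<in> Z (Suc m') K" using Cons.prems m y by auto
  have zvy: "z \<otimes> cm v y \<in> Z (Suc m') K" using z vy Z_subset_Suc Z_mult by blast
  have "foldl cm (u \<otimes> v) (y # ys) = foldl cm (cm u y \<otimes> (z \<otimes> cm v y)) ys"
    using u v y zc by (simp add: comm_mult_left z_def m_assoc)
  also have "N K #> \<dots> = N K #> (foldl cm (cm u y) ys \<otimes> foldl cm (z \<otimes> cm v y) ys)"
    using Cons.IH[OF m(2) zvy] u y ys by simp
  also have "\<dots> = N K #> (foldl cm (cm u y) ys \<otimes> foldl cm (cm v y) ys)"
  proof (rule coset_mult[OF chain_normal])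
    have "N K #> foldl cm (z \<otimes> cm v y) ys = N K #> (foldl cm z ys \<otimes> foldl cm (cm v y) ys)"
      using Cons.IH[OF m(2) vy zc] ys by simp
    also have "\<dots> = N K #> (\<one> \<otimes> foldl cm (cm v y) ys)"
    proof (rule coset_mult[OF chain_normal])
      show "N K #> foldl cm z ys = N K #> \<one>"
        using foldl_comm_mem[OF m(2) z ys] coset_one_iff[OF chain_normal] zc ys by simp
    qed (use zc v y ys in auto)
    finally show "N K #> foldl cm (z \<otimes> cm v y) ys = N K #> foldl cm (cm v y) ys"
      using v y ys by simp
  qed (use u y ys v zc in auto)
  finally show ?case by simp
qed

lemma foldl_comm_cong:
  assumes "length ys = m" "Z m K #> x = Z m K #> y" "x \<in> carrier G" "y \<in> carrier G" "set ys \<subseteq> carrier G"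
  shows "N K #> foldl cm x ys = N K #> foldl cm y ys"
proof -
  obtain z where z: "z \<in> Z m K" "x = y \<otimes> z" using assms coset_eq_iff'[OF Z_normal] by blast
  have "N K #> foldl cm x ys = N K #> (foldl cm y ys \<otimes> foldl cm z ys)"
    using foldl_comm_mult[OF assms(1) subsetD[OF Z_subset_Suc z(1)] assms(4,5)] z(2) by simp
  also have "\<dots> = N K #> (foldl cm y ys \<otimes> \<one>)"
    using foldl_comm_mem[OF assms(1) z(1)] coset_one_iff[OF chain_normal] z assms Z_carrier
    by (intro coset_mult[OF chain_normal]) auto
  finally show ?thesis using assms by simp
qed

lemma foldl_comm_pow:
  assumes "length ys = m" "v \<in> Z (Suc m) K" "set ys \<subseteq> carrier G"
  shows "N K #> foldl cm (v [^] (n::nat)) ys = N K #> (foldl cm v ys [^] n)"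
proof (induction n)
  case 0
  have "foldl cm \<one> ys \<in> N K"
    using foldl_comm_mem[OF assms(1), of "\<one>" K] assms Z_subgroup subgroup.one_closed by blast
  then show ?case using coset_one_iff[OF chain_normal] assms by simp
next
  case (Suc n)
  have v: "v \<in> carrier G" using assms Z_carrier by blast
  have "N K #> foldl cm (v [^] Suc n) ys = N K #> (foldl cm (v [^] n) ys \<otimes> foldl cm v ys)"
    using foldl_comm_mult[OF assms(1,2) _ assms(3), of "v [^] n"] v by simp
  also have "\<dots> = N K #> (foldl cm v ys [^] n \<otimes> foldl cm v ys)"
    using Suc v assms(3) by (intro coset_mult[OF chain_normal]) auto
  finally show ?case by simp
qed

lemma foldl_comm_inv:
  assumes "length ys = m" "v \<in> Z (Suc m) K" "set ys \<subseteq> carrier G"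
  shows "N K #> foldl cm (inv v) ys = N K #> inv (foldl cm v ys)"
proof -
  have v: "v \<in> carrier G" using assms Z_carrier by blast
  have o: "foldl cm \<one> ys \<in> N K"
    using foldl_comm_mem[OF assms(1), of "\<one>" K] assms Z_subgroup subgroup.one_closed by blast
  have "N K #> (foldl cm (inv v) ys \<otimes> foldl cm v ys) = N K #> foldl cm (inv v \<otimes> v) ys"
    using foldl_comm_mult[OF assms(1,2) _ assms(3), of "inv v"] v by simp
  also have "\<dots> = N K #> \<one>" using o v assms coset_one_iff[OF chain_normal] by simp
  finally have "N K #> (foldl cm (inv v) ys \<otimes> foldl cm v ys \<otimes> inv (foldl cm v ys)) = N K #> (\<one> \<otimes> inv (foldl cm v ys))"
    using v assms by (intro coset_mult[OF chain_normal]) auto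
  then show ?thesis using v assms by (simp add: m_assoc)
qed

text \<open>Three layers are enough to cut off the power formula: each further \<open>h\<close>
  costs a layer, and \<open>[w1, w]\<close> gains two because \<open>w\<close> is itself a
  commutator.\<close>

lemma comm_pow_mod_Z:
  assumes "b \<in> carrier G" "h \<in> carrier G" "cm b h \<in> Z m k"
    and "w = cm b h" "w1 = cm w h" "w2 = cm w1 h"
  shows "Z m (k + 3) #> cm b (h [^] (n::nat)) = Z m (k + 3) #> (w [^] n \<otimes> w1 [^] (n choose 2) \<otimes> w2 [^] (n choose 3))"
proof -
  have w: "w \<in> Z m k" using assms by simp
  have w1: "w1 \<in> Z m (k + 1)" using Z_comm[OF w] assms(2,5) by simp
  have w2: "w2 \<in> Z m (k + 2)" using Z_comm[OF w1] assms(2,6) by simp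
  have c: "w \<in> carrier G" "w1 \<in> carrier G" using w w1 Z_carrier by blast+
  show ?thesis
  proof (rule comm_pow_mod[OF Z_normal assms(1,2,4,5,6)])
    show "cm w2 h \<in> Z m (k + 3)" "cm w2 w \<in> Z m (k + 3)" "cm w2 w1 \<in> Z m (k + 3)"
      using Z_comm[OF w2] assms(2) c by (simp_all add: eval_nat_numeral)
    show "cm w1 w \<in> Z m (k + 3)"
      using Z_comm_comm[OF w1 assms(1,2)] assms(4) by (simp add: eval_nat_numeral)
  qed
qed

text \<open>Commutation with an arbitrary element gains one layer (\<open>Z_comm\<close>). Deep
  elements are those of weight two, uniformly in both indices.\<close>

definition deep :: "'a \<Rightarrow> bool" where
  "deep h \<longleftrightarrow> h \<in> carrier G \<and> (\<forall>m k. \<forall>x\<in>Z m k. cm x h \<in> Z m (k + 2))"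

lemma deep_closed: "deep h \<Longrightarrow> h \<in> carrier G"
  by (simp add: deep_def)

lemma deepD: "deep h \<Longrightarrow> x \<in> Z m k \<Longrightarrow> cm x h \<in> Z m (k + 2)"
  by (simp add: deep_def)

lemma deep_comm: "x \<in> carrier G \<Longrightarrow> y \<in> carrier G \<Longrightarrow> deep (cm x y)"
  using Z_comm_comm by (simp add: deep_def)

lemma deep_one: "deep \<one>"
  using Z_subgroup subgroup.one_closed Z_carrier by (auto simp: deep_def)

lemma deep_mult:
  assumes "deep g" "deep h" shows "deep (g \<otimes> h)"
proof -
  have "cm x (g \<otimes> h) \<in> Z m (k + 2)" if x: "x \<in> Z m k" for x m k
  proof -
    have xc: "x \<in> carrier G" using x Z_carrier by blast
    have 1: "cm x g \<in> Z m (k + 2)" "cm x h \<in> Z m (k + 2)" using deepD assms x by blast+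
    have 2: "cm (cm x g) h \<in> Z m (k + 2)"
      using comm_in_normal_left[OF Z_normal 1(1)] assms deep_closed by blast
    show ?thesis using 1 2 xc assms deep_closed by (simp add: comm_mult_right Z_mult)
  qed
  then show ?thesis using assms deep_closed by (simp add: deep_def)
qed

lemma deep_inv:
  assumes "deep g" shows "deep (inv g)"
proof -
  have g: "g \<in> carrier G" using assms deep_closed by blast
  have "cm x (inv g) \<in> Z m (k + 2)" if x: "x \<in> Z m k" for x m k
  proof -
    have xc: "x \<in> carrier G" using x Z_carrier by blast
    have "cm x (inv g) = g \<otimes> inv (cm x g) \<otimes> inv g"
      using xc g by (simp add: commutator_def m_assoc inv_mult_group)
    then show ?thesis using normal.inv_op_closed2[OF Z_normal g] Z_inv[OF deepD[OF assms x]] by simp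
  qed
  then show ?thesis using g by (simp add: deep_def)
qed

lemma deep_pow_closed: "deep g \<Longrightarrow> deep (g [^] (n::nat))"
  by (induction n) (use deep_one deep_mult in auto)

lemma deep_generate:
  assumes "x \<in> generate G S" "\<And>s. s \<in> S \<Longrightarrow> deep s"
  shows "deep x"
  using assms(1) by induction (use assms(2) deep_one deep_inv deep_mult in auto)

end

section \<open>Chains compatible with powers\<close>

locale power_chain = central_chain +
  fixes p e :: nat
  assumes p_prime: "Factorial_Ring.prime p"
    and e_cases: "e = 1 \<or> e = 2 \<and> odd p"
    and chain_pow: "n \<in> N k \<Longrightarrow> n [^] p \<in> N (k + e)"
begin

lemma p_dvd_choose2: "odd p \<Longrightarrow> p dvd (p choose 2)"
proof -
  assume "odd p"
  then have "p \<noteq> 2" by auto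
  then have "2 < p" using prime_ge_2_nat[OF p_prime] by simp
  then show ?thesis using dvd_choose_prime[of 2 p] p_prime by simp
qed

lemma pow_choose2_mem:
  assumes "odd p" "v \<in> carrier G" "v [^] p \<in> Z m k"
  shows "v [^] (p choose 2) \<in> Z m k"
proof -
  obtain q where q: "p choose 2 = p * q" using p_dvd_choose2 assms by blast
  have "v [^] (p choose 2) = (v [^] p) [^] q" using assms q by (simp add: nat_pow_pow)
  then show ?thesis using Z_pow_closed assms by simp
qed

text \<open>Induction on \<open>m\<close> through the commutators of \<open>v^p\<close>. Of the
  error terms, \<open>w1\<close> lies one layer down, which suffices for \<open>e = 1\<close>, while
  for \<open>e = 2\<close> its exponent \<open>p choose 2\<close> is a multiple of \<open>p\<close>;
  and \<open>w2\<close> lies two layers down.\<close>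

lemma Z_pow: "v \<in> Z m k \<Longrightarrow> v [^] p \<in> Z m (k + e)"
proof (induction m arbitrary: k v)
  case 0 then show ?case using chain_pow by simp
next
  case (Suc m)
  have v: "v \<in> carrier G" using Suc Z_carrier by blast
  have "cm (v [^] p) y \<in> Z m (k + e)" if y: "y \<in> carrier G" for y
  proof -
    \<comment> \<open>The power formula expands the second argument, so \<open>[v^p, y]\<close> is
      reached as the inverse of \<open>[y, v^p]\<close>.\<close>
    define w w1 w2 where w: "w = cm y v" and w1: "w1 = cm w v" and w2: "w2 = cm w1 v"
    have wZ: "w \<in> Z m k" using Suc.prems y v w Z_comm_swap by simp
    have w1Z: "w1 \<in> Z m (k + 1)" using Z_comm[OF wZ v] w1 by simp
    have w2Z: "w2 \<in> Z m (k + 2)" using Z_comm[OF w1Z v] w2 by simp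
    have wc: "w \<in> carrier G" "w1 \<in> carrier G" "w2 \<in> carrier G" using wZ w1Z w2Z Z_carrier by blast+
    have 1: "w [^] p \<in> Z m (k + e)" using Suc.IH[OF wZ] .
    have 2: "w1 [^] (p choose 2) \<in> Z m (k + e)"
      using e_cases
    proof
      assume "e = 1" then show ?thesis using w1Z Z_pow_closed by simp
    next
      assume "e = 2 \<and> odd p"
      then show ?thesis using Suc.IH[OF w1Z] Z_antimono[of "k + 2" "k + 1 + e" m] wc
        by (intro pow_choose2_mem) auto
    qed
    have 3: "w2 [^] (p choose 3) \<in> Z m (k + e)"
      using w2Z Z_antimono[of "k + e" "k + 2" m] e_cases by (auto intro!: Z_pow_closed)
    have "cm y (v [^] p) \<in> Z m (k + e)"
      using coset_mem_iff[OF Z_normal _ Z_subgroup _ _ comm_pow_mod_Z[OF y v _ w w1 w2, of m k], of m "k + e" p]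
        wZ w wc 1 2 3 Z_antimono[of "k + e" "k + 3" m] e_cases v y by (auto intro!: Z_mult)
    then show ?thesis using Z_comm_swap y v by simp
  qed
  then show ?case using v by simp
qed

text \<open>\<open>[x, u]\<close> is one layer down already and its \<open>p\<close>-th power at
  least one more; both error terms begin two layers down.\<close>

lemma deep_pow:
  assumes u: "u \<in> carrier G" shows "deep (u [^] p)"
proof -
  have "cm x (u [^] p) \<in> Z m (k + 2)" if x: "x \<in> Z m k" for x m k
  proof -
    define w w1 w2 where w: "w = cm x u" and w1: "w1 = cm w u" and w2: "w2 = cm w1 u"
    have xc: "x \<in> carrier G" using x Z_carrier by blast
    have wZ: "w \<in> Z m (k + 1)" using Z_comm[OF x u] w by simp
    have w1Z: "w1 \<in> Z m (k + 2)" using Z_comm[OF wZ u] w1 by simp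
    have w2Z: "w2 \<in> Z m (k + 3)" using Z_comm[OF w1Z u] w2 by (simp add: eval_nat_numeral)
    have wc: "w \<in> carrier G" "w1 \<in> carrier G" "w2 \<in> carrier G" using wZ w1Z w2Z Z_carrier by blast+
    have 1: "w [^] p \<in> Z m (k + 2)"
      using Z_pow[OF wZ] Z_antimono[of "k + 2" "k + 1 + e" m] e_cases by auto
    have 2: "w1 [^] (p choose 2) \<in> Z m (k + 2)" using w1Z Z_pow_closed by simp
    have 3: "w2 [^] (p choose 3) \<in> Z m (k + 2)"
      using w2Z Z_antimono[of "k + 2" "k + 3" m] by (auto intro!: Z_pow_closed)
    show ?thesis
      using coset_mem_iff[OF Z_normal _ Z_subgroup _ _ comm_pow_mod_Z[OF xc u _ w w1 w2, of m "k + 1"], of m "k + 2" p]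
        wZ w wc 1 2 3 Z_antimono[of "k + 2" "k + 1 + 3" m] u xc by (auto intro!: Z_mult)
  qed
  then show ?thesis using u by (simp add: deep_def)
qed

text \<open>Deepness of \<open>v\<close> kills the error terms of the power formula.\<close>

lemma comm_pow_deep:
  assumes y: "y \<in> carrier G" and v: "deep v" and w: "cm y v \<in> Z m k"
  shows "Z m (k + e + 1) #> cm y (v [^] p) = Z m (k + e + 1) #> (cm y v [^] p)"
proof -
  define w w1 w2 where w': "w = cm y v" and w1: "w1 = cm w v" and w2: "w2 = cm w1 v"
  have vc: "v \<in> carrier G" using v deep_closed by blast
  have wZ: "w \<in> Z m k" using w w' by simp
  have w1Z: "w1 \<in> Z m (k + 2)" using deepD[OF v wZ] w1 by simp
  have w2Z: "w2 \<in> Z m (k + 4)" using deepD[OF v w1Z] w2 by (simp add: eval_nat_numeral)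
  have wc: "w \<in> carrier G" "w1 \<in> carrier G" "w2 \<in> carrier G" using wZ w1Z w2Z Z_carrier by blast+
  have 2: "w1 [^] (p choose 2) \<in> Z m (k + e + 1)"
    using e_cases
  proof
    assume "e = 1" then show ?thesis using w1Z Z_pow_closed by simp
  next
    assume "e = 2 \<and> odd p"
    then show ?thesis using Z_pow[OF w1Z] Z_antimono[of "k + e + 1" "k + 2 + e" m] wc
      by (intro pow_choose2_mem) auto
  qed
  have 3: "w2 [^] (p choose 3) \<in> Z m (k + e + 1)"
    using w2Z Z_antimono[of "k + e + 1" "k + 4" m] e_cases by (auto intro!: Z_pow_closed)
  have F: "Z m (k + 3) #> cm y (v [^] p) = Z m (k + 3) #> (w [^] p \<otimes> w1 [^] (p choose 2) \<otimes> w2 [^] (p choose 3))"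
    using comm_pow_mod_Z[OF y vc w w' w1 w2] .
  have "Z m (k + 3) \<subseteq> Z m (k + e + 1)" using e_cases by (intro Z_antimono) auto
  from coset_mono[OF Z_normal Z_normal this _ _ F]
  have "Z m (k + e + 1) #> cm y (v [^] p) = Z m (k + e + 1) #> (w [^] p \<otimes> w1 [^] (p choose 2) \<otimes> w2 [^] (p choose 3))"
    using y vc wc by simp
  also have "\<dots> = Z m (k + e + 1) #> (w [^] p)"
    using Z_mult[OF 2 3] wc by (subst coset_eq_iff'[OF Z_normal]) (auto simp: m_assoc)
  finally show ?thesis using w' by simp
qed

text \<open>Commutators are deep, so by \<open>comm_pow_deep\<close> the power passes through one
  more entry. After commutation with \<open>y\<close> the base is again a commutator; for this
  reason the induction speaks of \<open>cm x1 x2\<close> and not of a general element.\<close>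

lemma foldl_pow_comm:
  assumes "length ys = m" "x1 \<in> carrier G" "x2 \<in> carrier G" "cm x1 x2 \<in> Z m k" "set ys \<subseteq> carrier G"
  shows "N (k + e + 1) #> foldl cm (cm x1 x2 [^] p) ys = N (k + e + 1) #> (foldl cm (cm x1 x2) ys [^] p)"
  using assms
proof (induction ys arbitrary: m x1 x2)
  case Nil then show ?case by simp
next
  case (Cons y ys m)
  define v where "v = cm x1 x2"
  obtain m' where m: "m = Suc m'" "length ys = m'" using Cons.prems by auto
  have y: "y \<in> carrier G" and ys: "set ys \<subseteq> carrier G" and v: "v \<in> carrier G"
    using Cons.prems v_def by auto
  have vy: "cm v y \<in> Z m' k" using Cons.prems m y v_def by auto
  have yv: "cm y v \<in> Z m' k" using Z_comm_swap vy v y by blast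
  have "deep v" using deep_comm Cons.prems v_def by simp
  then have "Z m' (k + e + 1) #> cm y (v [^] p) = Z m' (k + e + 1) #> (cm y v [^] p)"
    using comm_pow_deep[OF y _ yv] by blast
  then have "Z m' (k + e + 1) #> inv (cm y (v [^] p)) = Z m' (k + e + 1) #> inv (cm y v [^] p)"
    using y v by (intro coset_inv[OF Z_normal]) auto
  then have "Z m' (k + e + 1) #> cm (v [^] p) y = Z m' (k + e + 1) #> (cm v y [^] p)"
    using y v by (simp add: inv_comm flip: nat_pow_inv)
  then have "N (k + e + 1) #> foldl cm (cm (v [^] p) y) ys = N (k + e + 1) #> foldl cm (cm v y [^] p) ys"
    using y v ys m by (intro foldl_comm_cong) auto
  also have "\<dots> = N (k + e + 1) #> (foldl cm (cm v y) ys [^] p)"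
    using Cons.IH[OF m(2) v y vy ys] .
  finally show ?case using v_def by simp
qed

text \<open>The error terms in the power formula for \<open>[b, h\<^sup>p, y\<^sub>1, \<dots>, y\<^sub>m]\<close> that are not automatically
  negligible are \<open>[b, h, h, y\<^sub>1, \<dots>]\<close> when \<open>p = 2\<close>, and \<open>[b, h, h, h, y\<^sub>1, \<dots>]\<close> when \<open>e = 2\<close> (and \<open>p = 3\<close>).\<close>

lemma foldl_comm_pow_arg:
  assumes m: "length ys = m" and b: "b \<in> carrier G" and h: "h \<in> carrier G"
    and ys: "set ys \<subseteq> carrier G" and bh: "cm b h \<in> Z m k"
    and err1: "p = 2 \<Longrightarrow> foldl cm (cm (cm b h) h) ys \<in> N (k + 2)"
    and err2: "e = 2 \<Longrightarrow> foldl cm (cm (cm (cm b h) h) h) ys \<in> N (k + 3)"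
  shows "cm b (h [^] p) \<in> Z m (k + e)"
    and "N (k + e + 1) #> foldl cm (cm b (h [^] p)) ys = N (k + e + 1) #> (foldl cm (cm b h) ys [^] p)"
proof -
  define w w1 w2 where w: "w = cm b h" and w1: "w1 = cm w h" and w2: "w2 = cm w1 h"
  have wZ: "w \<in> Z m k" using bh w by simp
  have w1Z: "w1 \<in> Z m (k + 1)" using Z_comm[OF wZ h] w1 by simp
  have w2Z: "w2 \<in> Z m (k + 2)" using Z_comm[OF w1Z h] w2 by simp
  have wc: "w \<in> carrier G" "w1 \<in> carrier G" "w2 \<in> carrier G" using wZ w1Z w2Z Z_carrier by blast+
  define z1 z2 where z1: "z1 = w1 [^] (p choose 2)" and z2: "z2 = w2 [^] (p choose 3)"
  have zc: "z1 \<in> carrier G" "z2 \<in> carrier G" using wc z1 z2 by auto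
  have 1: "w [^] p \<in> Z m (k + e)" using Z_pow[OF wZ] .
  have z1Z: "z1 \<in> Z m (k + e) \<and> foldl cm z1 ys \<in> N (k + e + 1)"
  proof (cases "odd p")
    case True
    have "Z m (k + 1 + e) \<subseteq> Z m (k + e)" by (intro Z_antimono) simp
    then have "z1 \<in> Z m (k + 1 + e)" using pow_choose2_mem[OF True wc(2) Z_pow[OF w1Z]] z1 by simp
    then show ?thesis using foldl_comm_mem[OF m _ ys, of z1 "k + 1 + e"] Z_antimono[of "k + e" "k + 1 + e" m]
      by auto
  next
    case False
    then have p: "p = 2" using p_prime primes_dvd_imp_eq two_is_prime_nat by blast
    then have "e = 1" using e_cases by auto
    then show ?thesis using p z1 wc w1Z err1 w w1 by simp
  qed
  have z2Z: "z2 \<in> Z m (k + e) \<and> foldl cm z2 ys \<in> N (k + e + 1)"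
  proof -
    have a: "z2 \<in> Z m (k + 2)" using w2Z z2 Z_pow_closed by simp
    show ?thesis using e_cases
    proof
      assume e: "e = 1"
      show ?thesis using foldl_comm_mem[OF m a ys] a Z_antimono[of "k + 1" "k + 2" m] e by auto
    next
      assume e: "e = 2 \<and> odd p"
      \<comment> \<open>For \<open>p = 3\<close> the exponent \<open>p choose 3\<close> is
        \<open>1\<close>, so divisibility gives nothing. The tail is multiplicative on this layer,
        which pulls the exponent out and lets \<open>err2\<close> apply.\<close>
      have E: "N (k + 3) #> foldl cm (w2 [^] (p choose 3)) ys = N (k + 3) #> (foldl cm w2 ys [^] (p choose 3))"
        using foldl_comm_pow[OF m _ ys, of w2 "k + 3"] Z_subset_Suc_Suc[of m "k + 2"] w2Z
        by (auto simp: eval_nat_numeral)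
      moreover have "foldl cm w2 ys [^] (p choose 3) \<in> N (k + 3)"
        using err2 e w w1 w2 Z_pow_closed[of _ 0 "k + 3"] by simp
      ultimately have "foldl cm z2 ys \<in> N (k + 3)"
        using coset_mem_iff[OF chain_normal subset_refl normal_imp_subgroup[OF chain_normal] _ _ E] wc ys z2
        by simp
      then show ?thesis using a e by (simp add: eval_nat_numeral)
    qed
  qed
  have F: "Z m (k + 3) #> cm b (h [^] p) = Z m (k + 3) #> (w [^] p \<otimes> (z1 \<otimes> z2))"
    using comm_pow_mod_Z[OF b h bh w w1 w2, of p] wc z1 z2 by (simp add: m_assoc)
  show G: "cm b (h [^] p) \<in> Z m (k + e)"
    using coset_mem_iff[OF Z_normal _ Z_subgroup _ _ F, of m "k + e"] Z_antimono[of "k + e" "k + 3" m] e_cases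
      b h wc zc 1 z1Z z2Z by (auto intro!: Z_mult)
  \<comment> \<open>Being in layer \<open>k + e\<close> is exchanged for one more step of the upper
    central series, the form that \<open>foldl_comm_mult\<close> requires modulo
    \<open>N (k + e + 1)\<close>.\<close>
  have up: "x \<in> Z (Suc m) (k + e + 1)" if "x \<in> Z m (k + e)" for x
    using Z_subset_Suc_Suc[of m "k + e"] that by auto
  have "Z m (k + 3) \<subseteq> Z m (k + e + 1)" using e_cases by (intro Z_antimono) auto
  from coset_mono[OF Z_normal Z_normal this _ _ F]
  have "Z m (k + e + 1) #> cm b (h [^] p) = Z m (k + e + 1) #> (w [^] p \<otimes> (z1 \<otimes> z2))"
    using b h wc zc by simp
  then have "N (k + e + 1) #> foldl cm (cm b (h [^] p)) ys = N (k + e + 1) #> foldl cm (w [^] p \<otimes> (z1 \<otimes> z2)) ys"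
    using b h wc zc ys m by (intro foldl_comm_cong) auto
  also have "\<dots> = N (k + e + 1) #> (foldl cm (w [^] p) ys \<otimes> foldl cm (z1 \<otimes> z2) ys)"
    using foldl_comm_mult[OF m up _ ys, of "z1 \<otimes> z2" "w [^] p"] z1Z z2Z wc Z_mult by simp
  also have "\<dots> = N (k + e + 1) #> (foldl cm (w [^] p) ys \<otimes> \<one>)"
  proof (rule coset_mult[OF chain_normal])
    have "N (k + e + 1) #> foldl cm (z1 \<otimes> z2) ys = N (k + e + 1) #> (foldl cm z1 ys \<otimes> foldl cm z2 ys)"
      using foldl_comm_mult[OF m up _ ys, of "z2" "z1"] z1Z z2Z zc by simp
    also have "\<dots> = N (k + e + 1) #> \<one>"
      using z1Z z2Z zc ys Z_mult[of _ 0 "k + e + 1"] by (subst coset_one_iff[OF chain_normal]) auto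
    finally show "N (k + e + 1) #> foldl cm (z1 \<otimes> z2) ys = N (k + e + 1) #> \<one>" .
  qed (use wc zc ys in auto)
  also have "\<dots> = N (k + e + 1) #> foldl cm (w [^] p) ys" using wc ys by simp
  also have "\<dots> = N (k + e + 1) #> (foldl cm w ys [^] p)"
    using foldl_pow_comm[OF m b h bh ys] w by simp
  finally show "N (k + e + 1) #> foldl cm (cm b (h [^] p)) ys = N (k + e + 1) #> (foldl cm (cm b h) ys [^] p)"
    using w by simp
qed

end

section \<open>Powers of a product in class two\<close>

context group
begin

lemma pow_mult_central:
  assumes "n \<in> carrier G" "m \<in> carrier G" "c = cm m n" "cm c m = \<one>" "cm c n = \<one>"
  shows "(n \<otimes> m) [^] (i::nat) = n [^] i \<otimes> m [^] i \<otimes> c [^] (i choose 2)"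
proof -
  have c: "c \<in> carrier G" using assms(1-3) by simp
  have cm: "c \<otimes> m = m \<otimes> c" "c \<otimes> n = n \<otimes> c"
    using comm_eq_one_iff[OF c] assms(1,2,4,5) by auto
  have mn: "m \<otimes> n = n \<otimes> m \<otimes> c" using mult_comm_swap[OF assms(2,1)] assms(3) by (simp only:)
  have cp: "c [^] j \<otimes> (n \<otimes> m) = n \<otimes> m \<otimes> c [^] j" for j :: nat
  proof (induction j)
    case (Suc j)
    have "c [^] Suc j \<otimes> (n \<otimes> m) = c [^] j \<otimes> (c \<otimes> (n \<otimes> m))" using assms(1,2) c by (simp add: m_assoc)
    also have "c \<otimes> (n \<otimes> m) = n \<otimes> m \<otimes> c" using assms(1,2) c cm by (metis m_assoc)
    also have "c [^] j \<otimes> (n \<otimes> m \<otimes> c) = (c [^] j \<otimes> (n \<otimes> m)) \<otimes> c"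
      using assms(1,2) c by (simp add: m_assoc)
    finally show ?case using Suc assms(1,2) c by (simp add: m_assoc)
  qed (use assms in simp)
  have mi: "m [^] j \<otimes> n = n \<otimes> m [^] j \<otimes> c [^] j" for j :: nat
  proof (induction j)
    case (Suc j)
    have cj: "c [^] j \<otimes> m = m \<otimes> c [^] j" using cm(1) c assms(2) group_commutes_pow by blast
    have "m [^] Suc j \<otimes> n = m [^] j \<otimes> n \<otimes> m \<otimes> c" using assms(1,2) c mn by (simp add: m_assoc)
    also have "\<dots> = n \<otimes> m [^] j \<otimes> (c [^] j \<otimes> m) \<otimes> c" using assms(1,2) c Suc by (simp add: m_assoc)
    also have "\<dots> = n \<otimes> m [^] Suc j \<otimes> c [^] Suc j" using cj assms(1,2) c by (simp add: m_assoc)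
    finally show ?case .
  qed (use assms in simp)
  show ?thesis
  proof (induction i)
    case 0 then show ?case by (simp add: numeral_2_eq_2)
  next
    case (Suc i)
    have "(n \<otimes> m) [^] Suc i = n [^] i \<otimes> m [^] i \<otimes> (c [^] (i choose 2) \<otimes> (n \<otimes> m))"
      using Suc assms(1,2) c by (simp add: m_assoc)
    also have "\<dots> = n [^] i \<otimes> (m [^] i \<otimes> n) \<otimes> m \<otimes> c [^] (i choose 2)"
      unfolding cp using assms(1,2) c by (simp add: m_assoc)
    also have "\<dots> = n [^] Suc i \<otimes> m [^] i \<otimes> (c [^] i \<otimes> m) \<otimes> c [^] (i choose 2)"
      unfolding mi using assms(1,2) c by (simp add: m_assoc)
    also have "c [^] i \<otimes> m = m \<otimes> c [^] i" using cm(1) c assms(2) group_commutes_pow by blast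
    finally have "(n \<otimes> m) [^] Suc i = n [^] Suc i \<otimes> m [^] Suc i \<otimes> (c [^] i \<otimes> c [^] (i choose 2))"
      using assms(1,2) c by (simp add: m_assoc)
    also have "c [^] i \<otimes> c [^] (i choose 2) = c [^] (Suc i choose 2)"
      using c by (simp add: nat_pow_mult numeral_2_eq_2)
    finally show ?case .
  qed
qed

lemma pow_mult_mod:
  assumes K: "K \<lhd> G" and a: "n \<in> carrier G" "m \<in> carrier G" "cm (cm m n) m \<in> K" "cm (cm m n) n \<in> K"
  shows "K #> ((n \<otimes> m) [^] (i::nat)) = K #> (n [^] i \<otimes> m [^] i \<otimes> cm m n [^] (i choose 2))"
proof -
  interpret f: group_hom G "G Mod K" "\<lambda>x. K #> x" by (rule group_hom_coset) fact
  note one = coset_eq_one_iff[OF assms(1)]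
  have "((K #> n) \<otimes>\<^bsub>G Mod K\<^esub> (K #> m)) [^]\<^bsub>G Mod K\<^esub> i =
    (K #> n) [^]\<^bsub>G Mod K\<^esub> i \<otimes>\<^bsub>G Mod K\<^esub> (K #> m) [^]\<^bsub>G Mod K\<^esub> i \<otimes>\<^bsub>G Mod K\<^esub>
      (K #> cm m n) [^]\<^bsub>G Mod K\<^esub> (i choose 2)"
  proof (rule f.H.pow_mult_central)
    show "K #> n \<in> carrier (G Mod K)" "K #> m \<in> carrier (G Mod K)" using a by auto
    show "K #> cm m n = commutator (G Mod K) (K #> m) (K #> n)" using a f.hom_commutator by simp
    show "commutator (G Mod K) (K #> cm m n) (K #> m) = \<one>\<^bsub>G Mod K\<^esub>"
      using one[of "cm (cm m n) m"] a f.hom_commutator[of "cm m n" m] by simp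
    show "commutator (G Mod K) (K #> cm m n) (K #> n) = \<one>\<^bsub>G Mod K\<^esub>"
      using one[of "cm (cm m n) n"] a f.hom_commutator[of "cm m n" n] by simp
  qed
  then show ?thesis using a by (simp del: mult_FactGroup add: f.hom_nat_pow)
qed

end

section \<open>Covering the layers of a chain by values of a slice\<close>

context central_chain
begin

lemma comm_arg_mult_mem:
  assumes "b \<in> carrier G" "g \<in> carrier G" "h \<in> carrier G" "cm b g \<in> Z m k" "cm b h \<in> Z m k"
  shows "cm b (g \<otimes> h) \<in> Z m k"
  using assms comm_in_normal_left[OF Z_normal, of "cm b g" m k h] by (simp add: comm_mult_right Z_mult)

text \<open>\<open>[b, hg] = [b, g] [b, h] [[b, h], g]\<close>, where the last factor has moved to
  layer \<open>k + 1\<close>. Only \<open>h\<close> is restricted, so any approximation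
  \<open>g\<close> can be corrected by such an \<open>h\<close>.\<close>

lemma foldl_comm_arg_mult:
  assumes m: "length ys = m" and b: "b \<in> carrier G" and g: "g \<in> carrier G" and h: "h \<in> carrier G"
    and ys: "set ys \<subseteq> carrier G" and bh: "cm b h \<in> Z m k"
  shows "N (Suc k) #> foldl cm (cm b (h \<otimes> g)) ys = N (Suc k) #> (foldl cm (cm b g) ys \<otimes> foldl cm (cm b h) ys)"
proof -
  define v where "v = cm b h \<otimes> cm (cm b h) g"
  have 1: "cm (cm b h) g \<in> Z m (Suc k)" using Z_comm[OF bh g] .
  then have v: "v \<in> Z m k" using bh v_def Z_antimono_Suc Z_mult by blast
  have vc: "v \<in> carrier G" using v Z_carrier by blast
  have "N (Suc k) #> foldl cm v ys = N (Suc k) #> foldl cm (cm b h) ys"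
  proof (rule foldl_comm_cong[OF m _ vc])
    show "Z m (Suc k) #> v = Z m (Suc k) #> cm b h"
      using 1 v_def vc b h by (subst coset_eq_iff'[OF Z_normal]) auto
  qed (use b h ys in auto)
  moreover have "cm b (h \<otimes> g) = cm b g \<otimes> v"
    using b g h by (simp add: comm_mult_right v_def m_assoc)
  moreover have "N (Suc k) #> foldl cm (cm b g \<otimes> v) ys = N (Suc k) #> (foldl cm (cm b g) ys \<otimes> foldl cm v ys)"
    using foldl_comm_mult[OF m subsetD[OF Z_subset_Suc_Suc v] _ ys] b g by simp
  moreover have "N (Suc k) #> (foldl cm (cm b g) ys \<otimes> foldl cm v ys)
     = N (Suc k) #> (foldl cm (cm b g) ys \<otimes> foldl cm (cm b h) ys)"
    using calculation(1) b g h vc ys by (intro coset_mult[OF chain_normal]) auto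
  ultimately show ?thesis by simp
qed

lemma foldl_comm_one [simp]: "set ys \<subseteq> carrier G \<Longrightarrow> foldl cm \<one> ys = \<one>"
  by (induction ys) auto

lemma foldl_comm_arg_pow:
  assumes m: "length ys = m" and b: "b \<in> carrier G" and h: "h \<in> carrier G"
    and ys: "set ys \<subseteq> carrier G" and bh: "cm b h \<in> Z m k"
  shows "cm b (h [^] (i::nat)) \<in> Z m k"
    and "N (Suc k) #> foldl cm (cm b (h [^] i)) ys = N (Suc k) #> (foldl cm (cm b h) ys [^] i)"
proof -
  have "cm b (h [^] i) \<in> Z m k \<and>
    N (Suc k) #> foldl cm (cm b (h [^] i)) ys = N (Suc k) #> (foldl cm (cm b h) ys [^] i)"
  proof (induction i)
    case 0 show ?case using b ys by simp
  next
    case (Suc i)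
    have hi: "h [^] i \<in> carrier G" using h by simp
    have "N (Suc k) #> foldl cm (cm b (h [^] i \<otimes> h)) ys =
      N (Suc k) #> (foldl cm (cm b h) ys \<otimes> foldl cm (cm b (h [^] i)) ys)"
      using foldl_comm_arg_mult[OF m b h hi ys] Suc by blast
    also have "\<dots> = N (Suc k) #> (foldl cm (cm b h) ys \<otimes> foldl cm (cm b h) ys [^] i)"
      using Suc b h hi ys by (intro coset_mult[OF chain_normal]) auto
    also have "\<dots> = N (Suc k) #> (foldl cm (cm b h) ys [^] Suc i)"
      using nat_pow_Suc2[of "foldl cm (cm b h) ys" i] b h ys by simp
    finally show ?case using comm_arg_mult_mem[OF b hi h] Suc bh by simp
  qed
  then show "cm b (h [^] i) \<in> Z m k"
    and "N (Suc k) #> foldl cm (cm b (h [^] i)) ys = N (Suc k) #> (foldl cm (cm b h) ys [^] i)" by auto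
qed

text \<open>The condition on \<open>cm b h\<close> is stronger than membership of the value in
  \<open>N k\<close>: it is what makes \<open>h\<close> usable as a correction in
  \<open>foldl_comm_arg_mult\<close>.\<close>

definition covers :: "'a \<Rightarrow> 'a list \<Rightarrow> nat \<Rightarrow> bool" where
  "covers b ys k \<longleftrightarrow> (\<forall>n\<in>N k. \<exists>h\<in>carrier G. cm b h \<in> Z (length ys) k \<and>
     N (Suc k) #> foldl cm (cm b h) ys = N (Suc k) #> n)"

text \<open>The variant that survives \<open>p\<close>-th powers: for deep \<open>h\<close> the
  error terms of the power formula are negligible.\<close>

definition deep_covers :: "'a \<Rightarrow> 'a list \<Rightarrow> nat \<Rightarrow> bool" where
  "deep_covers b ys k \<longleftrightarrow> (\<forall>n\<in>N k. \<exists>h. deep h \<and> cm b h \<in> Z (length ys) k \<and>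
     N (Suc k) #> foldl cm (cm b h) ys = N (Suc k) #> n)"

lemma deep_covers_imp_covers: "deep_covers b ys k \<Longrightarrow> covers b ys k"
  unfolding covers_def deep_covers_def using deep_closed by meson

text \<open>Successive approximation: target and current value differ by an element of
  \<open>N k\<close>, and a covering \<open>h\<close>, multiplied to the left of \<open>g\<close>,
  removes this difference modulo \<open>N (Suc k)\<close>.\<close>

lemma covers_approx:
  assumes cov: "\<And>k. covers b ys k" and b: "b \<in> carrier G" and ys: "set ys \<subseteq> carrier G" and n: "n \<in> N 0"
  shows "\<exists>g\<in>carrier G. N k #> foldl cm (cm b g) ys = N k #> n"
proof (induction k)
  case 0
  have "n \<in> carrier G" using n Z_carrier[of _ 0] by auto
  then have "N 0 #> \<one> = N 0 #> n" using coset_one_iff[OF chain_normal] n by metis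
  then show ?case using b ys by (intro bexI[of _ "\<one>"]) auto
next
  case (Suc k)
  then obtain g where g: "g \<in> carrier G" "N k #> n = N k #> foldl cm (cm b g) ys" by metis
  have nc: "n \<in> carrier G" using n Z_carrier[of _ 0] by auto
  obtain c where c: "c \<in> N k" "n = foldl cm (cm b g) ys \<otimes> c"
    using g coset_eq_iff'[OF chain_normal, of n "foldl cm (cm b g) ys" k] nc b ys by auto
  have cc: "c \<in> carrier G" using c Z_carrier[of _ 0] by auto
  obtain h where h: "h \<in> carrier G" "cm b h \<in> Z (length ys) k"
    "N (Suc k) #> foldl cm (cm b h) ys = N (Suc k) #> c"
    using cov[of k] c unfolding covers_def by blast
  have "N (Suc k) #> foldl cm (cm b (h \<otimes> g)) ys = N (Suc k) #> (foldl cm (cm b g) ys \<otimes> foldl cm (cm b h) ys)"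
    using foldl_comm_arg_mult[OF refl b g(1) h(1) ys h(2)] .
  also have "\<dots> = N (Suc k) #> n"
    unfolding c(2) using h g b ys cc by (intro coset_mult[OF chain_normal]) auto
  finally show ?case using h(1) g(1) by blast
qed

end

section \<open>Chains generated by commutators and powers\<close>

text \<open>For \<open>e = 1\<close> this is the lower exponent-\<open>p\<close> central series
  started at \<open>N 0\<close>. The truncated subtraction puts the \<open>p\<close>-th powers of
  \<open>N 0\<close> into each of \<open>N 1\<close> to \<open>N e\<close>; for \<open>e = 2\<close>
  this keeps \<open>N 2\<close> inside \<open>N 1\<close>.\<close>

locale verbal_chain = group G for G (structure) +
  fixes N :: "nat \<Rightarrow> 'a set" and p e :: nat
  assumes p_prime: "Factorial_Ring.prime p"
    and e_cases: "e = 1 \<or> e = 2 \<and> odd p"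
    and N_0_normal: "N 0 \<lhd> G"
    and N_0_comm: "N 0 \<subseteq> generate G {commutator G x y | x y. x \<in> carrier G \<and> y \<in> carrier G}"
    and N_Suc: "N (Suc k) =
      generate G ({commutator G x g | x g. x \<in> N k \<and> g \<in> carrier G} \<union> {x [^] p | x. x \<in> N (k - (e - 1))})"
begin

lemma N_normal: "N k \<lhd> G"
proof (induction k rule: less_induct)
  case (less k)
  show ?case
  proof (cases k)
    case 0 then show ?thesis using N_0_normal by simp
  next
    case (Suc l)
    have nl: "N l \<lhd> G" "N (l - (e - 1)) \<lhd> G" using less Suc by auto
    have sub: "N l \<subseteq> carrier G" "N (l - (e - 1)) \<subseteq> carrier G"
      using nl normal_imp_subgroup subgroup.subset by blast+
    show ?thesis unfolding Suc N_Suc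
    proof (rule normal_generateI)
      fix h g
      assume h: "h \<in> {cm x g |x g. x \<in> N l \<and> g \<in> carrier G} \<union> {x [^] p | x. x \<in> N (l - (e - 1))}"
        and g: "g \<in> carrier G"
      then show "g \<otimes> h \<otimes> inv g \<in> {cm x g |x g. x \<in> N l \<and> g \<in> carrier G} \<union> {x [^] p | x. x \<in> N (l - (e - 1))}"
      proof (elim UnE CollectE exE conjE)
        fix x y assume "h = cm x y" "x \<in> N l" "y \<in> carrier G"
        then have "g \<otimes> h \<otimes> inv g = cm (g \<otimes> x \<otimes> inv g) (g \<otimes> y \<otimes> inv g)"
          and "g \<otimes> x \<otimes> inv g \<in> N l" and "g \<otimes> y \<otimes> inv g \<in> carrier G"
          using conj_comm[OF g] g sub normal.inv_op_closed2[OF nl(1) g] by auto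
        then show ?thesis by blast
      next
        fix x assume "h = x [^] p" "x \<in> N (l - (e - 1))"
        then have "g \<otimes> h \<otimes> inv g = (g \<otimes> x \<otimes> inv g) [^] p" and "g \<otimes> x \<otimes> inv g \<in> N (l - (e - 1))"
          using conj_pow[OF g] g sub normal.inv_op_closed2[OF nl(2) g] by auto
        then show ?thesis by blast
      qed
    qed (use sub in auto)
  qed
qed

lemma N_subgroup: "subgroup (N k) G"
  by (rule normal_imp_subgroup[OF N_normal])

lemma N_carrier: "x \<in> N k \<Longrightarrow> x \<in> carrier G"
  by (rule subgroup.mem_carrier[OF N_subgroup])

lemmas N_one = subgroup.one_closed[OF N_subgroup]
lemmas N_mult = subgroup.m_closed[OF N_subgroup]
lemmas N_inv = subgroup.m_inv_closed[OF N_subgroup]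
lemmas N_coset_eq_iff = coset_eq_iff'[OF N_normal]
lemmas N_coset_one_iff = coset_one_iff[OF N_normal]
lemmas N_coset_mult = coset_mult[OF N_normal]
lemmas N_mem_cong = coset_mem_iff[OF N_normal subset_refl N_subgroup]

lemma N_comm: "x \<in> N k \<Longrightarrow> g \<in> carrier G \<Longrightarrow> cm x g \<in> N (Suc k)"
  unfolding N_Suc by (rule generate.incl) blast

lemma N_pow_sub: "x \<in> N (k - (e - 1)) \<Longrightarrow> x [^] p \<in> N (Suc k)"
  unfolding N_Suc by (rule generate.incl) blast

lemma N_subgroup_pow: "x \<in> N k \<Longrightarrow> x [^] (i::nat) \<in> N k"
  by (induction i) (auto intro: N_mult N_one)

lemma N_desc: "N (Suc k) \<subseteq> N k"
proof (induction k rule: less_induct)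
  case (less k)
  have "x [^] p \<in> N k" if x: "x \<in> N (k - (e - 1))" for x
  proof (cases k)
    case 0 then show ?thesis using x N_subgroup_pow by simp
  next
    case (Suc l)
    have "N (Suc l - (e - 1)) \<subseteq> N (l - (e - 1)) \<or> e = 1"
      using e_cases less[of "l - 1"] Suc by (cases l) auto
    then show ?thesis using x Suc N_pow_sub[of x l] N_subgroup_pow by auto
  qed
  then show ?case unfolding N_Suc
    using comm_in_normal_left[OF N_normal] by (intro generate_subgroup_incl N_subgroup) auto
qed

sublocale power_chain G N p e
proof (intro power_chain.intro central_chain.intro central_chain_axioms.intro power_chain_axioms.intro)
  fix n k assume "n \<in> N k"
  then show "n [^] p \<in> N (k + e)"
    using N_pow_sub[of n "k + e - 1"] e_cases by auto
qed (fact is_group p_prime e_cases N_normal N_desc | erule (1) N_comm)+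

lemma deep_N_0: "n \<in> N 0 \<Longrightarrow> deep n"
  using N_0_comm by (intro deep_generate[of n "{cm x y | x y. x \<in> carrier G \<and> y \<in> carrier G}"])
    (auto intro: deep_comm)

lemma N_antimono: "k \<le> l \<Longrightarrow> N l \<subseteq> N k"
  using Z_antimono[of k l 0] by simp

lemma deep_N: "n \<in> N k \<Longrightarrow> deep n"
  using deep_N_0 N_antimono[of 0 k] by auto

lemma comm_N_N: "x \<in> N k \<Longrightarrow> y \<in> N l \<Longrightarrow> cm x y \<in> N (k + 2)"
  using deepD[OF deep_N, of y l x 0 k] by simp

text \<open>Together with \<open>pow_cong\<close>: taking \<open>p\<close>-th powers induces a
  homomorphism from \<open>N k / N (k+1)\<close> to \<open>N (k+e) / N (k+e+1)\<close>. The
  commutator that arises gains two layers because elements of \<open>N 0\<close> are deep, and for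
  \<open>e = 2\<close> its exponent is a multiple of \<open>p\<close>.\<close>

lemma pow_mult_cong:
  assumes "n \<in> N k" "m \<in> N k"
  shows "N (k + e + 1) #> ((n \<otimes> m) [^] p) = N (k + e + 1) #> (n [^] p \<otimes> m [^] p)"
proof -
  have c: "n \<in> carrier G" "m \<in> carrier G" using assms N_carrier by blast+
  have cmn: "cm m n \<in> N (k + 2)" using comm_N_N assms by blast
  have s: "N (k + 3) \<subseteq> N (k + e + 1)" using e_cases by (intro N_antimono) auto
  have c3: "cm (cm m n) x \<in> N (k + e + 1)" if "x \<in> carrier G" for x
    using N_comm[OF cmn that] s by (auto simp: eval_nat_numeral)
  have "cm m n [^] (p choose 2) \<in> N (k + e + 1)"
    using e_cases
  proof
    assume "e = 1" then show ?thesis using cmn N_subgroup_pow by simp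
  next
    assume e: "e = 2 \<and> odd p"
    then show ?thesis using pow_choose2_mem[of "cm m n" 0 "k + e + 1"] chain_pow[OF cmn]
      N_antimono[of "k + e + 1" "k + 2 + e"] c by auto
  qed
  moreover have "N (k + e + 1) #> ((n \<otimes> m) [^] p) =
      N (k + e + 1) #> (n [^] p \<otimes> m [^] p \<otimes> cm m n [^] (p choose 2))"
    using c c3 by (intro pow_mult_mod[OF N_normal]) auto
  ultimately show ?thesis
    using c N_coset_eq_iff[of "n [^] p \<otimes> m [^] p \<otimes> cm m n [^] (p choose 2)" "n [^] p \<otimes> m [^] p" "k + e + 1"]
    by auto
qed

lemma pow_cong:
  assumes "n \<in> N k" "m \<in> N k" "N (Suc k) #> n = N (Suc k) #> m"
  shows "N (k + e + 1) #> (n [^] p) = N (k + e + 1) #> (m [^] p)"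
proof -
  have c: "n \<in> carrier G" "m \<in> carrier G" using assms N_carrier by blast+
  obtain d where d: "d \<in> N (Suc k)" "n = m \<otimes> d" using assms c N_coset_eq_iff by blast
  have dp: "d [^] p \<in> N (k + e + 1)" using chain_pow[OF d(1)] by simp
  have dk: "d \<in> N k" "d \<in> carrier G" using d N_desc N_carrier by blast+
  have "N (k + e + 1) #> (n [^] p) = N (k + e + 1) #> (m [^] p \<otimes> d [^] p)"
    using pow_mult_cong[OF assms(2) dk(1)] d by simp
  also have "\<dots> = N (k + e + 1) #> (m [^] p)"
    using c dk dp by (subst N_coset_eq_iff) auto
  finally show ?thesis .
qed

text \<open>The full preimage in \<open>G\<close> of the image of that homomorphism. It is a
  subgroup, so containing \<open>N (k + e)\<close> can be checked on generators.\<close>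

definition pth_power :: "nat \<Rightarrow> 'a \<Rightarrow> bool" where
  "pth_power k x \<longleftrightarrow> x \<in> carrier G \<and> (\<exists>n\<in>N k. N (k + e + 1) #> x = N (k + e + 1) #> (n [^] p))"

lemma pth_power_subgroup: "subgroup (Collect (pth_power k)) G"
proof
  show "Collect (pth_power k) \<subseteq> carrier G" by (auto simp: pth_power_def)
next
  fix x y assume "x \<in> Collect (pth_power k)" "y \<in> Collect (pth_power k)"
  then obtain n m where nm: "n \<in> N k" "m \<in> N k" "x \<in> carrier G" "y \<in> carrier G"
    "N (k + e + 1) #> x = N (k + e + 1) #> (n [^] p)" "N (k + e + 1) #> y = N (k + e + 1) #> (m [^] p)"
    unfolding pth_power_def by blast
  then have "N (k + e + 1) #> (x \<otimes> y) = N (k + e + 1) #> (n [^] p \<otimes> m [^] p)"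
    using N_carrier by (intro N_coset_mult) auto
  then have "N (k + e + 1) #> (x \<otimes> y) = N (k + e + 1) #> ((n \<otimes> m) [^] p)"
    using pow_mult_cong nm by simp
  then show "x \<otimes> y \<in> Collect (pth_power k)"
    using nm N_mult unfolding pth_power_def by blast
next
  show "\<one> \<in> Collect (pth_power k)"
    unfolding pth_power_def using N_one by (auto intro!: bexI[of _ "\<one>"])
next
  fix x assume "x \<in> Collect (pth_power k)"
  then obtain n where n: "n \<in> N k" "x \<in> carrier G" "N (k + e + 1) #> x = N (k + e + 1) #> (n [^] p)"
    unfolding pth_power_def by blast
  then have "N (k + e + 1) #> inv x = N (k + e + 1) #> inv (n [^] p)"
    using N_carrier by (intro coset_inv[OF N_normal]) auto
  then have "N (k + e + 1) #> inv x = N (k + e + 1) #> (inv n [^] p)"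
    using n N_carrier by (simp add: nat_pow_inv)
  then show "inv x \<in> Collect (pth_power k)"
    using n N_inv unfolding pth_power_def by blast
qed

lemma pth_power_pow: "n \<in> N k \<Longrightarrow> pth_power k (n [^] p)"
  unfolding pth_power_def using N_carrier by blast

text \<open>\<open>N (k + e)\<close> is generated by \<open>p\<close>-th powers of
  \<open>N k\<close> and by commutators \<open>[x, g]\<close> with \<open>x\<close> in
  \<open>N (k + e - 1)\<close>. If \<open>x\<close> is congruent to \<open>n^p\<close>, then
  \<open>[x, g]\<close> is congruent to \<open>[n, g]^p\<close> because \<open>n\<close> is deep; so
  the property descends the chain and only its start is assumed.\<close>

lemma pth_power_chain:
  assumes base: "\<And>x g. x \<in> N (e - 1) \<Longrightarrow> g \<in> carrier G \<Longrightarrow> pth_power 0 (cm x g)"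
  shows "n \<in> N (k + e) \<Longrightarrow> pth_power k n"
proof -
  have step: "N (k + e) \<subseteq> Collect (pth_power k)"
    if "\<And>x g. x \<in> N (k + e - 1) \<Longrightarrow> g \<in> carrier G \<Longrightarrow> pth_power k (cm x g)" for k
  proof -
    obtain l where l: "k + e = Suc l" "l - (e - 1) = k" "k + e - 1 = l" using e_cases by fastforce
    show ?thesis unfolding l(1) N_Suc l(2)
      using that pth_power_pow l by (intro generate_subgroup_incl pth_power_subgroup) auto
  qed
  have "\<forall>x\<in>N (k + e - 1). \<forall>g\<in>carrier G. pth_power k (cm x g)" for k
  proof (induction k)
    case 0 then show ?case using base by auto
  next
    case (Suc k)
    show ?case
    proof (intro ballI)
      fix x g assume x: "x \<in> N (Suc k + e - 1)" and g: "g \<in> carrier G"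
      have xN: "x \<in> N (k + e)" using x by simp
      then have "pth_power k x" using step Suc by blast
      then obtain n where n: "n \<in> N k" "N (k + e + 1) #> x = N (k + e + 1) #> (n [^] p)"
        unfolding pth_power_def by blast
      have c: "x \<in> carrier G" "n \<in> carrier G" using xN n N_carrier by blast+
      have s: "N (k + e + 1) \<subseteq> Z 1 (k + e + 2)" using Z_subset_Suc_Suc[of 0 "k + e + 1"] by simp
      have "Z 1 (k + e + 2) #> x = Z 1 (k + e + 2) #> (n [^] p)"
        using coset_mono[OF N_normal Z_normal s c(1) _ n(2)] c(2) by blast
      then have "N (k + e + 2) #> cm x g = N (k + e + 2) #> cm (n [^] p) g"
        using foldl_comm_cong[of "[g]" 1 "k + e + 2" x "n [^] p"] c g by simp
      also have "\<dots> = N (k + e + 2) #> (cm n g [^] p)"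
      proof -
        have "cm g n \<in> Z 0 (k + 1)" using Z_comm_swap[of n g 0] N_comm[OF n(1) g] c g by simp
        then have "N (k + e + 2) #> cm g (n [^] p) = N (k + e + 2) #> (cm g n [^] p)"
          using comm_pow_deep[OF g deep_N[OF n(1)], of 0 "k + 1"] by (simp add: add.commute)
        then have "N (k + e + 2) #> inv (cm g (n [^] p)) = N (k + e + 2) #> inv (cm g n [^] p)"
          using c g by (intro coset_inv[OF N_normal]) auto
        then show ?thesis using c g by (simp add: inv_comm flip: nat_pow_inv)
      qed
      finally show "pth_power (Suc k) (cm x g)"
        unfolding pth_power_def using c g N_comm[OF n(1) g] by (auto intro!: bexI[of _ "cm n g"])
    qed
  qed
  then have "N (k + e) \<subseteq> Collect (pth_power k)" using step by blast
  then show "n \<in> N (k + e) \<Longrightarrow> pth_power k n" by blast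
qed

text \<open>Layer \<open>k + e\<close> is covered by the elements \<open>h^p\<close>, which are deep
  whatever \<open>h\<close> is. Deepness is gained by the step itself, at the price of two error
  conditions on \<open>h\<close>.\<close>

lemma deep_covers_step:
  assumes C: "\<And>n. n \<in> N (k + e) \<Longrightarrow> pth_power k n"
    and b: "b \<in> carrier G" and ys: "set ys \<subseteq> carrier G"
    and cov: "\<And>n. n \<in> N k \<Longrightarrow> \<exists>h\<in>carrier G. cm b h \<in> Z (length ys) k \<and>
      N (Suc k) #> foldl cm (cm b h) ys = N (Suc k) #> n \<and>
      (p = 2 \<longrightarrow> foldl cm (cm (cm b h) h) ys \<in> N (k + 2)) \<and>
      (e = 2 \<longrightarrow> foldl cm (cm (cm (cm b h) h) h) ys \<in> N (k + 3))"
  shows "deep_covers b ys (k + e)"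
  unfolding deep_covers_def
proof
  fix n' assume "n' \<in> N (k + e)"
  then obtain n where n: "n \<in> N k" "N (k + e + 1) #> n' = N (k + e + 1) #> (n [^] p)"
    using C unfolding pth_power_def by blast
  obtain h where h: "h \<in> carrier G" "cm b h \<in> Z (length ys) k"
      "N (Suc k) #> foldl cm (cm b h) ys = N (Suc k) #> n"
      "p = 2 \<longrightarrow> foldl cm (cm (cm b h) h) ys \<in> N (k + 2)"
      "e = 2 \<longrightarrow> foldl cm (cm (cm (cm b h) h) h) ys \<in> N (k + 3)"
    using cov[OF n(1)] by blast
  note P = foldl_comm_pow_arg[OF refl b h(1) ys h(2)]
  have "N (k + e + 1) #> foldl cm (cm b (h [^] p)) ys = N (k + e + 1) #> (foldl cm (cm b h) ys [^] p)"
    using P(2) h by blast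
  also have "\<dots> = N (k + e + 1) #> (n [^] p)"
    using pow_cong[OF _ n(1) h(3)] foldl_comm_mem[OF refl h(2) ys] by blast
  finally have "N (Suc (k + e)) #> foldl cm (cm b (h [^] p)) ys = N (Suc (k + e)) #> n'" using n by simp
  then show "\<exists>h. deep h \<and> cm b h \<in> Z (length ys) (k + e) \<and>
      N (Suc (k + e)) #> foldl cm (cm b h) ys = N (Suc (k + e)) #> n'"
    using P(1) h deep_pow by blast
qed

lemma deep_covers_add_e:
  assumes C: "\<And>n. n \<in> N (k + e) \<Longrightarrow> pth_power k n"
    and b: "b \<in> carrier G" and ys: "set ys \<subseteq> carrier G" and cov: "deep_covers b ys k"
  shows "deep_covers b ys (k + e)"
proof (rule deep_covers_step[OF C b ys])
  fix n assume "n \<in> N k"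
  then obtain h where h: "deep h" "cm b h \<in> Z (length ys) k"
     "N (Suc k) #> foldl cm (cm b h) ys = N (Suc k) #> n"
    using cov unfolding deep_covers_def by blast
  have hc: "h \<in> carrier G" using h deep_closed by blast
  have 1: "cm (cm b h) h \<in> Z (length ys) (k + 2)" using deepD h by blast
  have 2: "cm (cm (cm b h) h) h \<in> Z (length ys) (k + 3)" using Z_comm[OF 1 hc] by (simp add: eval_nat_numeral)
  show "\<exists>h\<in>carrier G. cm b h \<in> Z (length ys) k \<and>
      N (Suc k) #> foldl cm (cm b h) ys = N (Suc k) #> n \<and>
      (p = 2 \<longrightarrow> foldl cm (cm (cm b h) h) ys \<in> N (k + 2)) \<and>
      (e = 2 \<longrightarrow> foldl cm (cm (cm (cm b h) h) h) ys \<in> N (k + 3))"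
    using h hc foldl_comm_mem[OF refl 1 ys] foldl_comm_mem[OF refl 2 ys] by blast
qed auto

lemma covers_generator:
  assumes b: "b \<in> carrier G" and ys: "set ys \<subseteq> carrier G"
    and h: "h \<in> carrier G" "cm b h \<in> Z (length ys) k"
    and gen: "\<And>n. n \<in> N k \<Longrightarrow> \<exists>i::nat. N (Suc k) #> n = N (Suc k) #> (foldl cm (cm b h) ys [^] i)"
  shows "covers b ys k" and "deep h \<Longrightarrow> deep_covers b ys k"
proof -
  note P = foldl_comm_arg_pow[OF refl b h(1) ys h(2)]
  show "covers b ys k" unfolding covers_def
  proof
    fix n assume "n \<in> N k"
    then obtain i :: nat where "N (Suc k) #> n = N (Suc k) #> (foldl cm (cm b h) ys [^] i)" using gen by blast
    then show "\<exists>h\<in>carrier G. cm b h \<in> Z (length ys) k \<and> N (Suc k) #> foldl cm (cm b h) ys = N (Suc k) #> n"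
      using P[of i] h by (intro bexI[of _ "h [^] i"]) auto
  qed
  show "deep_covers b ys k" if "deep h" unfolding deep_covers_def
  proof
    fix n assume "n \<in> N k"
    then obtain i :: nat where "N (Suc k) #> n = N (Suc k) #> (foldl cm (cm b h) ys [^] i)" using gen by blast
    then show "\<exists>h. deep h \<and> cm b h \<in> Z (length ys) k \<and> N (Suc k) #> foldl cm (cm b h) ys = N (Suc k) #> n"
      using P[of i] deep_pow_closed[OF that] by (intro exI[of _ "h [^] i"]) auto
  qed
qed

text \<open>Unlike in \<open>deep_covers_step\<close>, the error conditions concern one
  \<open>h\<close> and not its powers: the power formula is applied to \<open>h^p\<close> once, and
  the powers of \<open>h^p\<close> do the covering.\<close>

lemma deep_covers_generator:
  assumes C: "\<And>n. n \<in> N (k + e) \<Longrightarrow> pth_power k n"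
    and b: "b \<in> carrier G" and ys: "set ys \<subseteq> carrier G"
    and h: "h \<in> carrier G" "cm b h \<in> Z (length ys) k"
    and gen: "\<And>n. n \<in> N k \<Longrightarrow> \<exists>i::nat. N (Suc k) #> n = N (Suc k) #> (foldl cm (cm b h) ys [^] i)"
    and err1: "p = 2 \<Longrightarrow> foldl cm (cm (cm b h) h) ys \<in> N (k + 2)"
    and err2: "e = 2 \<Longrightarrow> foldl cm (cm (cm (cm b h) h) h) ys \<in> N (k + 3)"
  shows "deep_covers b ys (k + e)"
proof -
  note P = foldl_comm_pow_arg[OF refl b h(1) ys h(2) err1 err2]
  define u where "u = foldl cm (cm b h) ys"
  have u: "u \<in> N k" using foldl_comm_mem[OF refl h(2) ys] u_def by simp
  have uc: "u \<in> carrier G" using u N_carrier by blast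
  show ?thesis
  proof (rule covers_generator(2)[OF b ys])
    show "h [^] p \<in> carrier G" "cm b (h [^] p) \<in> Z (length ys) (k + e)" "deep (h [^] p)"
      using h P(1) deep_pow by auto
  next
    fix n' assume "n' \<in> N (k + e)"
    then obtain n where n: "n \<in> N k" "N (k + e + 1) #> n' = N (k + e + 1) #> (n [^] p)"
      using C unfolding pth_power_def by blast
    then obtain i :: nat where i: "N (Suc k) #> n = N (Suc k) #> (u [^] i)" using gen u_def by blast
    have "N (k + e + 1) #> n' = N (k + e + 1) #> ((u [^] i) [^] p)"
      using pow_cong[OF n(1) _ i] N_subgroup_pow u n(2) by simp
    also have "(u [^] i) [^] p = (u [^] p) [^] i" using uc by (simp add: nat_pow_pow mult.commute)
    also have "N (k + e + 1) #> ((u [^] p) [^] i) = N (k + e + 1) #> (foldl cm (cm b (h [^] p)) ys [^] i)"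
      using P(2) uc u_def b h ys by (intro coset_pow[OF N_normal]) auto
    finally show "\<exists>i::nat. N (Suc (k + e)) #> n' = N (Suc (k + e)) #> (foldl cm (cm b (h [^] p)) ys [^] i)"
      by auto
  qed
qed

text \<open>A layer beyond \<open>e\<close> is reached from the one \<open>e\<close> places earlier,
  whose index is at least \<open>1\<close>. So deepness is asked in layers \<open>1\<close> to
  \<open>e\<close>, and a plain covering is enough in layer \<open>0\<close>.\<close>

lemma covers_all:
  assumes C: "\<And>k n. n \<in> N (k + e) \<Longrightarrow> pth_power k n"
    and b: "b \<in> carrier G" and ys: "set ys \<subseteq> carrier G"
    and c0: "covers b ys 0" and c1: "deep_covers b ys 1" and c2: "e = 2 \<Longrightarrow> deep_covers b ys 2"
  shows "covers b ys k"
proof -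
  have "deep_covers b ys (Suc k)" for k
  proof (induction k rule: less_induct)
    case (less k)
    consider "k = 0" | "k = 1" "e = 2" | "k \<ge> e" using e_cases by linarith
    then show ?case
    proof cases
      case 3
      then have lt: "k - e < k" and eq: "Suc (k - e) + e = Suc k" using e_cases by linarith+
      show ?thesis using deep_covers_add_e[OF C b ys less.IH[OF lt]] unfolding eq .
    qed (use c1 c2 in \<open>simp_all add: numeral_2_eq_2\<close>)
  qed
  then show ?thesis using c0 deep_covers_imp_covers by (cases k) auto
qed

end

section \<open>Finite p-groups\<close>

lemma (in group) subgroup_pow_mem: "subgroup H G \<Longrightarrow> x \<in> H \<Longrightarrow> x [^] (n::nat) \<in> H"
  by (induction n) (auto intro: subgroup.one_closed subgroup.m_closed)

locale finite_p_group = group G for G (structure) +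
  fixes p a :: nat
  assumes prime_p: "Factorial_Ring.prime p" and order_eq: "order G = p ^ a"
begin

lemma finite_carrier: "finite (carrier G)"
  using order_eq prime_p order_gt_0_iff_finite prime_gt_0_nat by simp

lemma finite_subset_carrier: "subgroup H G \<Longrightarrow> finite H"
  using finite_carrier subgroup.subset finite_subset by metis

lemma dvd_order_cases: "n dvd p ^ a \<Longrightarrow> n = 1 \<or> p dvd n"
proof -
  assume "n dvd p ^ a"
  then obtain i where "n = p ^ i" using divides_primepow_nat[OF prime_p] by blast
  then show ?thesis by (cases i) auto
qed

lemma card_subgroup: "subgroup H G \<Longrightarrow> \<exists>i. card H = p ^ i"
  using lagrange[of H] order_eq divides_primepow_nat[OF prime_p] by (metis dvd_triv_right)

lemma card_subgroup_less:
  assumes "subgroup H G" "subgroup K G" "H \<subset> K"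
  shows "p * card H \<le> card K"
proof -
  obtain i j where ij: "card H = p ^ i" "card K = p ^ j" using card_subgroup assms by metis
  have "card H < card K" using assms finite_subset_carrier psubset_card_mono by blast
  then have "i < j" using ij prime_gt_1_nat[OF prime_p] by simp
  then have "p ^ Suc i \<le> p ^ j" using prime_gt_0_nat[OF prime_p] by (intro power_increasing) auto
  then show ?thesis using ij by simp
qed

text \<open>The class equation: if no class in \<open>M\<close> other than that of the identity were
  a singleton, all of them would have length divisible by \<open>p\<close>, and
  \<open>card M\<close> would be \<open>1\<close> modulo \<open>p\<close>.\<close>

lemma central_element:
  assumes M: "M \<lhd> G" and ne: "M \<noteq> {\<one>}"
  shows "\<exists>m\<in>M. m \<noteq> \<one> \<and> (\<forall>g\<in>carrier G. cm m g = \<one>)"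
proof (rule ccontr)
  assume nex: "\<not> ?thesis"
  interpret M: normal M G by fact
  define \<phi> where "\<phi> = (\<lambda>g. \<lambda>h\<in>carrier G. g \<otimes> h \<otimes> inv g)"
  interpret A: group_action G "carrier G" \<phi>
    using action_by_conjugation unfolding \<phi>_def .
  define O' where "O' = orbit G \<phi> ` (M - {\<one>})"
  have fixed: "\<phi> g x = g \<otimes> x \<otimes> inv g" if "x \<in> carrier G" for g x using that by (simp add: \<phi>_def)
  have one_orb: "x = \<one>" if x: "x \<in> M" and one: "\<one> \<in> orbit G \<phi> x" for x
  proof -
    have xc: "x \<in> carrier G" using x M.subset by blast
    obtain g where g: "g \<in> carrier G" "\<one> = g \<otimes> x \<otimes> inv g" using one fixed[OF xc] by (auto simp: orbit_def)
    then have "g \<otimes> x = g" using xc by (metis inv_closed inv_inv inv_unique' m_closed r_inv inv_equality)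
    then show "x = \<one>" using g(1) xc by simp
  qed
  have sub: "orbit G \<phi> x \<subseteq> M - {\<one>}" if "x \<in> M - {\<one>}" for x
  proof -
    have "x \<in> carrier G" "x \<in> M" using that M.subset by auto
    then have "orbit G \<phi> x \<subseteq> M" using M.inv_op_closed2 by (auto simp: orbit_def fixed)
    then show ?thesis using one_orb[of x] that by auto
  qed
  have self: "x \<in> orbit G \<phi> x" if "x \<in> carrier G" for x using A.orbit_refl that by blast
  have un: "\<Union>O' = M - {\<one>}"
  proof
    show "\<Union>O' \<subseteq> M - {\<one>}" using sub O'_def by auto
    show "M - {\<one>} \<subseteq> \<Union>O'" using self M.subset unfolding O'_def by blast
  qed
  have disj: "U \<inter> V = {}" if UV: "U \<in> O'" "V \<in> O'" "U \<noteq> V" for U V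
  proof (rule ccontr)
    assume ne: "U \<inter> V \<noteq> {}"
    obtain x y where xy: "U = orbit G \<phi> x" "V = orbit G \<phi> y" "x \<in> carrier G" "y \<in> carrier G"
      using UV M.subset unfolding O'_def by blast
    obtain z where z: "z \<in> orbit G \<phi> x" "z \<in> orbit G \<phi> y" using ne xy by blast
    have zc: "z \<in> carrier G" using z(1) xy(3) by (auto simp: orbit_def fixed)
    have eq: "orbit G \<phi> u = orbit G \<phi> z" if u: "u \<in> carrier G" "z \<in> orbit G \<phi> u" for u
    proof -
      have zu: "u \<in> orbit G \<phi> z" using A.orbit_sym[OF u(1) zc u(2)] .
      have in_c: "w \<in> carrier G" if "w \<in> orbit G \<phi> v" "v \<in> carrier G" for w v
        using that by (auto simp: orbit_def fixed)
      show ?thesis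
      proof
        show "orbit G \<phi> u \<subseteq> orbit G \<phi> z" using A.orbit_trans[OF zc u(1) _ zu] in_c u(1) by blast
        show "orbit G \<phi> z \<subseteq> orbit G \<phi> u" using A.orbit_trans[OF u(1) zc _ u(2)] in_c zc by blast
      qed
    qed
    show False using eq[OF xy(3) z(1)] eq[OF xy(4) z(2)] xy UV(3) by simp
  qed
  have dvd: "p dvd card U" if U: "U \<in> O'" for U
  proof -
    obtain x where x: "x \<in> M" "x \<noteq> \<one>" "U = orbit G \<phi> x" using U unfolding O'_def by blast
    have xc: "x \<in> carrier G" using x M.subset by blast
    have "card U * card (stabilizer G \<phi> x) = p ^ a"
      using A.orbit_stabilizer_theorem[OF xc] x order_eq by simp
    then have "card U dvd p ^ a" by (metis dvd_triv_left)
    moreover have "card U \<noteq> 1"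
    proof
      assume "card U = 1"
      then have X1: "U = {x}" using self[OF xc] x(3) by (metis card_1_singletonE singletonD)
      have "cm x g = \<one>" if g: "g \<in> carrier G" for g
      proof -
        have "g \<otimes> x \<otimes> inv g \<in> U" using g x(3) fixed[OF xc] by (auto simp: orbit_def)
        then have "g \<otimes> x \<otimes> inv g = x" using X1 by simp
        then have "x \<otimes> g = g \<otimes> x" using g xc by (metis inv_solve_right m_closed)
        then show ?thesis using comm_eq_one_iff xc g by simp
      qed
      then show False using nex x by blast
    qed
    ultimately show ?thesis using dvd_order_cases by blast
  qed
  have finM: "finite M" using finite_subset_carrier[OF M.is_subgroup] .
  have "card (\<Union>O') = sum card O'"
    using disj finM unfolding O'_def
    by (intro card_Union_disjoint) (auto simp: pairwise_def disjnt_def O'_def intro: finite_subset[OF sub])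
  then have "p dvd card (M - {\<one>})" using dvd un by (simp add: dvd_sum)
  moreover have "card M = Suc (card (M - {\<one>}))" using finM M.one_closed by (metis card_Suc_Diff1)
  moreover have "p dvd card M"
  proof -
    have "card M dvd p ^ a" using card_subgroup[OF M.is_subgroup] lagrange[OF M.is_subgroup] order_eq
      by (metis dvd_triv_right)
    moreover have "card M \<noteq> 1" using ne M.one_closed by (metis card_1_singletonE singletonD)
    ultimately show ?thesis using dvd_order_cases by blast
  qed
  ultimately have "p dvd 1" by (metis Suc_eq_plus1 dvd_add_right_iff)
  then show False using prime_p by simp
qed

lemma quotient_p_group:
  assumes "K \<lhd> G" shows "\<exists>b. finite_p_group (G Mod K) p b"
proof -
  have "order (G Mod K) * card K = p ^ a"
    using lagrange[OF normal_imp_subgroup[OF assms]] order_eq by (simp add: order_def FactGroup_def)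
  then have "order (G Mod K) dvd p ^ a" by (metis dvd_triv_left)
  then obtain b where "order (G Mod K) = p ^ b" using divides_primepow_nat[OF prime_p] by blast
  then show ?thesis
    using normal.factorgroup_is_group[OF assms] prime_p
    by (intro exI[of _ b] finite_p_group.intro finite_p_group_axioms.intro)
qed

lemma central_element_mod:
  assumes M: "M \<lhd> G" and K: "K \<lhd> G" and KM: "K \<subset> M"
  shows "\<exists>m\<in>M. m \<notin> K \<and> (\<forall>g\<in>carrier G. cm m g \<in> K)"
proof -
  interpret M: normal M G by fact
  interpret h: group_hom G "G Mod K" "\<lambda>x. K #> x" by (rule group_hom_coset) fact
  note one = coset_eq_one_iff[OF K]
  obtain b where "finite_p_group (G Mod K) p b" using quotient_p_group[OF K] by blast
  then interpret Q: finite_p_group "G Mod K" p b .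
  have imN: "(\<lambda>x. K #> x) ` M \<lhd> G Mod K"
    using M.surj_hom_normal_subgroup[OF h.group_hom_axioms] by (simp add: carrier_FactGroup)
  have "(\<lambda>x. K #> x) ` M \<noteq> {\<one>\<^bsub>G Mod K\<^esub>}" using KM one M.subset by (metis image_eqI psubsetE singletonD subsetD subsetI)
  from Q.central_element[OF imN this] obtain m where m: "m \<in> M" "K #> m \<noteq> \<one>\<^bsub>G Mod K\<^esub>"
    "\<forall>g\<in>carrier (G Mod K). commutator (G Mod K) (K #> m) g = \<one>\<^bsub>G Mod K\<^esub>" by blast
  have mc: "m \<in> carrier G" using m M.subset by blast
  have "cm m g \<in> K" if g: "g \<in> carrier G" for g
    using m(3) h.hom_closed[OF g] h.hom_commutator[OF mc g] one[of "cm m g"] mc g by auto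
  then show ?thesis using m one[OF mc] by blast
qed

lemma pow_p_pow_a: "x \<in> carrier G \<Longrightarrow> x [^] (p ^ a) = \<one>"
  using pow_order_eq_1[of x] order_eq by simp

text \<open>Take \<open>L\<close> maximal among the normal subgroups that contain \<open>K\<close>
  and lie properly in \<open>M\<close>. A central element of \<open>M / L\<close> and maximality
  make all of \<open>M / L\<close> central. Its \<open>p\<close>-th powers then form a subgroup,
  proper because otherwise every element of \<open>M\<close> would be a \<open>p^a\<close>-th power
  modulo \<open>L\<close>; by maximality that subgroup is trivial.\<close>

lemma frattini_like:
  assumes M: "M \<lhd> G" and K: "K \<lhd> G" and KM: "K \<subset> M"
  obtains L where "L \<lhd> G" "K \<subseteq> L" "L \<subset> M"
    "\<And>x g. x \<in> M \<Longrightarrow> g \<in> carrier G \<Longrightarrow> cm x g \<in> L" "\<And>x. x \<in> M \<Longrightarrow> x [^] p \<in> L"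
proof -
  interpret M: normal M G by fact
  define S where "S = {L. L \<lhd> G \<and> K \<subseteq> L \<and> L \<subset> M}"
  have "finite S" using finite_subset_carrier[OF M.is_subgroup]
    by (intro finite_subset[of S "Pow M"]) (auto simp: S_def)
  moreover have "K \<in> S" using K KM S_def by blast
  ultimately obtain L where L: "L \<in> S" and max: "\<And>L'. L' \<in> S \<Longrightarrow> L \<subseteq> L' \<Longrightarrow> L' = L"
    using finite_has_maximal[of S] by (metis empty_iff)
  have Ln: "L \<lhd> G" and LM: "L \<subset> M" and KL: "K \<subseteq> L" using L S_def by auto
  interpret L: normal L G by fact
  define C where "C = {v \<in> carrier G. \<forall>g\<in>carrier G. cm v g \<in> L} \<inter> M"
  have Cn: "C \<lhd> G" unfolding C_def using normal_subgroup_intersect[OF center_mod_normal[OF Ln] M] .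
  have LC: "L \<subseteq> C" using comm_in_normal_left[OF Ln] LM L.subset by (auto simp: C_def)
  obtain m where m: "m \<in> M" "m \<notin> L" "\<forall>g\<in>carrier G. cm m g \<in> L" using central_element_mod[OF M Ln LM] by blast
  then have "m \<in> C" using M.subset by (auto simp: C_def)
  then have "C \<notin> S" using max LC m by blast
  then have "C = M" using Cn LC KL S_def C_def by blast
  then have com: "\<And>x g. x \<in> M \<Longrightarrow> g \<in> carrier G \<Longrightarrow> cm x g \<in> L" unfolding C_def by blast
  have abel: "L #> ((x \<otimes> y) [^] (i::nat)) = L #> (x [^] i \<otimes> y [^] i)" if "x \<in> M" "y \<in> M" for x y i
  proof -
    have c: "x \<in> carrier G" "y \<in> carrier G" using that M.subset by auto
    have 1: "cm y x \<in> L" using com that c by blast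
    have "L #> ((x \<otimes> y) [^] i) = L #> (x [^] i \<otimes> y [^] i \<otimes> cm y x [^] (i choose 2))"
      using comm_in_normal_left[OF Ln 1] c by (intro pow_mult_mod[OF Ln]) auto
    moreover have "cm y x [^] (i choose 2) \<in> L" using subgroup_pow_mem[OF L.is_subgroup 1] .
    ultimately show ?thesis
      using c coset_eq_iff'[OF Ln, of "x [^] i \<otimes> y [^] i \<otimes> cm y x [^] (i choose 2)" "x [^] i \<otimes> y [^] i"] by auto
  qed
  define P where "P = {y \<in> M. \<exists>x\<in>M. L #> y = L #> (x [^] p)}"
  note pm = subgroup_pow_mem[OF M.is_subgroup]
  have Ps: "subgroup P G"
  proof
    show "P \<subseteq> carrier G" using M.subset P_def by auto
    show "\<one> \<in> P" unfolding P_def by (auto intro!: bexI[of _ "\<one>"])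
  next
    fix y z assume "y \<in> P" "z \<in> P"
    then obtain y' z' where yz: "y \<in> M" "z \<in> M" "y' \<in> M" "z' \<in> M" "L #> y = L #> (y' [^] p)" "L #> z = L #> (z' [^] p)"
      unfolding P_def by blast
    then have "L #> (y \<otimes> z) = L #> (y' [^] p \<otimes> z' [^] p)"
      using M.subset by (intro coset_mult[OF Ln]) auto
    then show "y \<otimes> z \<in> P" using abel[OF yz(3,4), of p] yz unfolding P_def by (auto intro!: bexI[of _ "y' \<otimes> z'"])
  next
    fix y assume "y \<in> P"
    then obtain y' where y: "y \<in> M" "y' \<in> M" "L #> y = L #> (y' [^] p)" unfolding P_def by blast
    then have "L #> inv y = L #> inv (y' [^] p)"
      using M.subset by (intro coset_inv[OF Ln]) auto
    then have "L #> inv y = L #> (inv y' [^] p)" using y M.subset by (simp add: nat_pow_inv subset_iff)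
    then show "inv y \<in> P" using y unfolding P_def by (auto intro!: bexI[of _ "inv y'"])
  qed
  have LP: "L \<subseteq> P"
  proof
    fix l assume l: "l \<in> L"
    then have "L #> l = L #> (\<one> [^] p)" using coset_one_iff[OF Ln] L.subset by auto
    then show "l \<in> P" using l LM unfolding P_def by (auto intro!: bexI[of _ "\<one>"])
  qed
  have "g \<otimes> y \<otimes> inv g \<in> P" if g: "g \<in> carrier G" and y: "y \<in> P" for g y
  proof -
    have yM: "y \<in> M" "y \<in> carrier G" using y P_def M.subset by auto
    have "cm y (inv g) \<in> P" using com[OF yM(1), of "inv g"] g LP by auto
    then have "y \<otimes> cm y (inv g) \<in> P" using subgroup.m_closed[OF Ps y] by blast
    moreover have "y \<otimes> cm y (inv g) = g \<otimes> y \<otimes> inv g" using yM g by (simp add: commutator_def m_assoc)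
    ultimately show ?thesis by simp
  qed
  then have Pn: "P \<lhd> G" using Ps normal_inv_iff by blast
  have "P \<noteq> M"
  proof
    assume PM: "P = M"
    have "\<exists>x\<in>M. L #> y = L #> (x [^] (p ^ i))" if "y \<in> M" for y i
    proof (induction i)
      case 0 then show ?case using that M.subset by (auto intro!: bexI[of _ y])
    next
      case (Suc i)
      then obtain x where x: "x \<in> M" "L #> y = L #> (x [^] (p ^ i))" by blast
      then obtain z where z: "z \<in> M" "L #> x = L #> (z [^] p)" using PM P_def by blast
      have c: "x \<in> carrier G" "z \<in> carrier G" using x z M.subset by auto
      have "L #> (x [^] (p ^ i)) = L #> ((z [^] p) [^] (p ^ i))" using z c by (intro coset_pow[OF Ln]) auto
      then show ?case using x z c by (auto simp: nat_pow_pow)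
    qed
    then have "\<exists>x\<in>M. L #> m = L #> (x [^] (p ^ a))" using m by blast
    then have "L #> m = L #> \<one>" using pow_p_pow_a M.subset by auto
    then show False using coset_one_iff[OF Ln] m M.subset by blast
  qed
  then have "P \<in> S" using Pn LP KL P_def S_def by blast
  then have "P = L" using max LP by blast
  moreover have "x [^] p \<in> P" if "x \<in> M" for x using pm[OF that] that unfolding P_def by blast
  ultimately show thesis using that[OF Ln KL LM com] by blast
qed

text \<open>For normal \<open>L\<close> this is the subgroup generated by \<open>L\<close> and
  \<open>u\<close>; natural exponents suffice in a finite group.\<close>

definition cyclic_over :: "'a set \<Rightarrow> 'a \<Rightarrow> 'a set" where
  "cyclic_over L u = {x \<in> carrier G. \<exists>i::nat. L #> x = L #> (u [^] i)}"

lemma cyclic_over_subgroup: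
  assumes L: "L \<lhd> G" and u: "u \<in> carrier G"
  shows "subgroup (cyclic_over L u) G"
proof
  show "cyclic_over L u \<subseteq> carrier G" by (auto simp: cyclic_over_def)
  show "\<one> \<in> cyclic_over L u" unfolding cyclic_over_def by (auto intro!: exI[of _ "0::nat"])
next
  fix x y assume "x \<in> cyclic_over L u" "y \<in> cyclic_over L u"
  then obtain i j :: nat where ij: "x \<in> carrier G" "y \<in> carrier G" "L #> x = L #> (u [^] i)" "L #> y = L #> (u [^] j)"
    unfolding cyclic_over_def by blast
  then have "L #> (x \<otimes> y) = L #> (u [^] i \<otimes> u [^] j)" using u by (intro coset_mult[OF L]) auto
  then show "x \<otimes> y \<in> cyclic_over L u" using ij u by (auto simp: cyclic_over_def nat_pow_mult)
next
  fix x assume "x \<in> cyclic_over L u"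
  then obtain i :: nat where i: "x \<in> carrier G" "L #> x = L #> (u [^] i)" unfolding cyclic_over_def by blast
  have "inv u = u [^] (p ^ a - 1)"
  proof -
    have "u \<otimes> u [^] (p ^ a - 1) = \<one>"
      using nat_pow_Suc2[OF u, of "p ^ a - 1"] pow_p_pow_a[OF u] prime_gt_0_nat[OF prime_p] by simp
    then show ?thesis using u by (metis inv_equality inv_inv inv_closed nat_pow_closed)
  qed
  then have "inv (u [^] i) = u [^] ((p ^ a - 1) * i)" using u by (metis nat_pow_inv nat_pow_pow)
  moreover have "L #> inv x = L #> inv (u [^] i)" using i u by (intro coset_inv[OF L]) auto
  ultimately show "inv x \<in> cyclic_over L u" using i by (auto simp: cyclic_over_def)
qed

lemma cyclic_over_self: "u \<in> carrier G \<Longrightarrow> u \<in> cyclic_over L u"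
  unfolding cyclic_over_def by (auto intro!: exI[of _ "1::nat"])

lemma cyclic_over_base:
  assumes L: "L \<lhd> G" shows "L \<subseteq> cyclic_over L u"
proof
  fix x assume x: "x \<in> L"
  have "x \<in> carrier G" using x normal_imp_subgroup[OF L] subgroup.mem_carrier by metis
  moreover from this have "L #> x = L #> (u [^] (0::nat))" using coset_one_iff[OF L] x by simp
  ultimately show "x \<in> cyclic_over L u" unfolding cyclic_over_def by blast
qed

lemma cyclic_over_least:
  assumes L: "L \<lhd> G" and H: "subgroup H G" "L \<subseteq> H" "u \<in> H"
  shows "cyclic_over L u \<subseteq> H"
proof
  fix x assume "x \<in> cyclic_over L u"
  then obtain i :: nat where x: "x \<in> carrier G" "L #> x = L #> (u [^] i)" unfolding cyclic_over_def by blast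
  have uc: "u \<in> carrier G" using H subgroup.mem_carrier by metis
  have "u [^] i \<in> H" using subgroup_pow_mem[OF H(1,3)] .
  then show "x \<in> H" using coset_mem_iff[OF L H(2,1) x(1) _ x(2)] uc by simp
qed

lemma cyclic_over_trans:
  assumes L: "L \<lhd> G" and "u \<in> carrier G" "v \<in> cyclic_over L u" "w \<in> cyclic_over L v"
  shows "w \<in> cyclic_over L u"
  using cyclic_over_least[OF L cyclic_over_subgroup cyclic_over_base] assms by blast

text \<open>Index at most \<open>p\<close> leaves no room strictly between \<open>L\<close> and
  \<open>M\<close>, since a strict inclusion of subgroups multiplies the order by at least
  \<open>p\<close>.\<close>

lemma prime_index_generator:
  assumes L: "L \<lhd> G" and M: "subgroup M G" and LM: "L \<subseteq> M" and card: "card M \<le> p * card L"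
    and v: "v \<in> M" "v \<notin> L" and n: "n \<in> M"
  shows "n \<in> cyclic_over L v"
proof -
  have vc: "v \<in> carrier G" using v M subgroup.mem_carrier by metis
  have "L \<subset> cyclic_over L v" using cyclic_over_base[OF L] cyclic_over_self[OF vc] v by blast
  then have "p * card L \<le> card (cyclic_over L v)"
    using card_subgroup_less normal_imp_subgroup[OF L] cyclic_over_subgroup[OF L vc] by blast
  moreover have "cyclic_over L v \<subseteq> M" using cyclic_over_least[OF L M LM v(1)] .
  ultimately have "cyclic_over L v = M" using card finite_subset_carrier[OF M]
    by (metis card_seteq le_trans)
  then show ?thesis using n by simp
qed

end

section \<open>The chain below a lower central subgroup\<close>

context group
begin

abbreviation lnc :: "'a list \<Rightarrow> 'a" where "lnc \<equiv> left_normed_commutator G"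

lemma lnc_append: "bs \<noteq> [] \<Longrightarrow> lnc (bs @ zs) = foldl cm (lnc bs) zs"
  by (cases bs) simp_all

lemma lnc_closed [simp]: "set xs \<subseteq> carrier G \<Longrightarrow> lnc xs \<in> carrier G"
  by (cases xs) simp_all

end

locale lower_chain = verbal_chain G N p e + finite_p_group G p a
  for G (structure) and N p e a +
  fixes r :: nat
  assumes r_ge_2: "r \<ge> 2"
    and N_0: "N 0 = generate G {left_normed_commutator G xs | xs. length xs = r \<and> set xs \<subseteq> carrier G}"
begin

lemma lnc_mem_N_0: "length xs = r \<Longrightarrow> set xs \<subseteq> carrier G \<Longrightarrow> lnc xs \<in> N 0"
  unfolding N_0 by (rule generate.incl) blast

lemma N_0_subset: "subgroup H G \<Longrightarrow> (\<And>xs. length xs = r \<Longrightarrow> set xs \<subseteq> carrier G \<Longrightarrow> lnc xs \<in> H) \<Longrightarrow> N 0 \<subseteq> H"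
  unfolding N_0 by (intro generate_subgroup_incl) auto

lemma mem_Z_I:
  assumes "v \<in> carrier G" "\<And>zs. length zs = m \<Longrightarrow> set zs \<subseteq> carrier G \<Longrightarrow> foldl cm v zs \<in> N k"
  shows "v \<in> Z m k"
  using assms
proof (induction m arbitrary: v)
  case 0 then show ?case using "0.prems"(2)[of "[]"] by simp
next
  case (Suc m)
  have "cm v g \<in> Z m k" if g: "g \<in> carrier G" for g
  proof (rule Suc.IH)
    fix zs :: "'a list" assume "length zs = m" "set zs \<subseteq> carrier G"
    then show "foldl cm (cm v g) zs \<in> N k" using Suc.prems(2)[of "g # zs"] g by simp
  qed (use Suc.prems g in simp)
  then show ?case using Suc.prems by simp
qed

text \<open>Commutators of length \<open>r\<close> lie in \<open>N 0\<close>, so in layer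
  \<open>0\<close> every \<open>h\<close> meets the side condition of \<open>covers\<close>.\<close>

lemma slice_mem_Z:
  assumes "bs \<noteq> []" "set bs \<subseteq> carrier G" "h \<in> carrier G" "length bs + 1 + m = r"
  shows "cm (lnc bs) h \<in> Z m 0"
proof (rule mem_Z_I)
  fix zs :: "'a list" assume zs: "length zs = m" "set zs \<subseteq> carrier G"
  have "foldl cm (cm (lnc bs) h) zs = lnc (bs @ h # zs)" using assms(1) by (simp add: lnc_append)
  then show "foldl cm (cm (lnc bs) h) zs \<in> N 0" using assms zs by (auto intro!: lnc_mem_N_0)
qed (use assms in simp)

text \<open>\<open>N (k + e)\<close> is generated by commutators and \<open>p\<close>-th powers of
  elements of \<open>N k\<close>, so it lies in the proper subgroup supplied by
  \<open>frattini_like\<close>, and orders decrease.\<close>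

lemma chain_terminates: "\<exists>k. N k = {\<one>}"
proof -
  have "\<exists>l. N l = {\<one>}" if "card (N k) = n" for n k
    using that
  proof (induction n arbitrary: k rule: less_induct)
    case (less n)
    show ?case
    proof (cases "N k = {\<one>}")
      case False
      have "{\<one>} \<subset> N k" using False N_one by blast
      then obtain L where L: "L \<lhd> G" "L \<subset> N k" "\<And>x g. x \<in> N k \<Longrightarrow> g \<in> carrier G \<Longrightarrow> cm x g \<in> L"
        "\<And>x. x \<in> N k \<Longrightarrow> x [^] p \<in> L"
        using frattini_like[OF N_normal one_is_normal] by metis
      obtain l where l: "k + e = Suc l" "l - (e - 1) = k" "k \<le> l" using e_cases by fastforce
      have "N (k + e) \<subseteq> L"
        unfolding l(1) N_Suc l(2)
        using L(3,4) N_antimono[OF l(3)] by (intro generate_subgroup_incl normal_imp_subgroup[OF L(1)]) auto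
      then have "card (N (k + e)) < card (N k)"
        using L(2) finite_subset_carrier[OF N_subgroup] by (intro psubset_card_mono) auto
      then show ?thesis using less by blast
    qed auto
  qed
  then show ?thesis by blast
qed

lemma slice_surj:
  assumes cov: "\<And>k. covers b ys k" and b: "b \<in> carrier G" and ys: "set ys \<subseteq> carrier G" and n: "n \<in> N 0"
  shows "\<exists>g\<in>carrier G. foldl cm (cm b g) ys = n"
proof -
  obtain k where k: "N k = {\<one>}" using chain_terminates by blast
  obtain g where g: "g \<in> carrier G" "N k #> foldl cm (cm b g) ys = N k #> n"
    using covers_approx[OF cov b ys n] by blast
  have nc: "n \<in> carrier G" using n N_carrier by blast
  then have "\<exists>c\<in>N k. foldl cm (cm b g) ys = n \<otimes> c"
    using g b ys N_coset_eq_iff[of "foldl cm (cm b g) ys" n k] by simp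
  then show ?thesis using k nc g(1) by auto
qed

lemma comm_cong_N_1:
  assumes u: "u \<in> N 0" "v \<in> N 0" "g \<in> carrier G" and uv: "N 1 #> v = N 1 #> (u [^] (i::nat))"
  shows "N 2 #> cm v g = N 2 #> (cm u g [^] i)"
proof -
  have c: "u \<in> carrier G" "v \<in> carrier G" using u N_carrier by blast+
  have s: "N 1 \<subseteq> Z 1 2" using Z_subset_Suc_Suc[of 0 1] by (simp add: numeral_2_eq_2)
  have "Z 1 2 #> v = Z 1 2 #> (u [^] i)"
    using coset_mono[OF N_normal Z_normal s c(2) _ uv] c by blast
  then have "N 2 #> cm v g = N 2 #> cm (u [^] i) g"
    using foldl_comm_cong[of "[g]" 1 2 v "u [^] i"] c u by simp
  also have "\<dots> = N 2 #> (cm u g [^] i)"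
  proof -
    have "u \<in> Z 2 2" using u(1) Z_subset_Suc_Suc[of 0 0] Z_subset_Suc_Suc[of 1 1]
      by (metis One_nat_def Suc_1 Z.simps(1) in_mono)
    then show ?thesis using foldl_comm_pow[of "[g]" 1 u 2 i] u by (simp add: numeral_2_eq_2)
  qed
  finally show ?thesis .
qed

text \<open>The centralizer of \<open>N 0 / N 2\<close>, called \<open>D\<close> in the
  overview.\<close>

definition centr :: "'a set" where
  "centr = {d \<in> carrier G. \<forall>n\<in>N 0. cm n d \<in> N 2}"

lemma centr_eqI:
  assumes u: "u \<in> N 0" "\<And>n. n \<in> N 0 \<Longrightarrow> n \<in> cyclic_over (N 1) u"
    and d: "d \<in> carrier G" "cm u d \<in> N 2"
  shows "d \<in> centr"
proof -
  have "cm n d \<in> N 2" if n: "n \<in> N 0" for n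
  proof -
    obtain i :: nat where "N 1 #> n = N 1 #> (u [^] i)" using u(2)[OF n] unfolding cyclic_over_def by blast
    then have eq: "N 2 #> cm n d = N 2 #> (cm u d [^] i)" using comm_cong_N_1[OF u(1) n d(1)] by blast
    have "n \<in> carrier G" "u \<in> carrier G" using n u N_carrier by auto
    then show ?thesis
      using N_mem_cong[OF _ _ eq] d subgroup_pow_mem[OF N_subgroup d(2)] by simp
  qed
  then show ?thesis using d centr_def by simp
qed

text \<open>If \<open>u\<close> generates \<open>N 0\<close> over \<open>N 1\<close>, then
  \<open>g |-> [u, g]\<close> is a homomorphism modulo \<open>N 2\<close> with kernel
  \<open>centr\<close>. By \<open>c\<close> any \<open>t\<close> outside the kernel is sent to a
  generator of \<open>N 1 / N 2\<close>.\<close>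

lemma centr_complement:
  assumes u: "u \<in> N 0" "\<And>n. n \<in> N 0 \<Longrightarrow> n \<in> cyclic_over (N 1) u"
    and c: "\<And>c n. c \<in> N 1 \<Longrightarrow> c \<notin> N 2 \<Longrightarrow> n \<in> N 1 \<Longrightarrow> n \<in> cyclic_over (N 2) c"
  obtains t where "t \<in> carrier G" "\<And>g. g \<in> carrier G \<Longrightarrow> \<exists>d\<in>centr. \<exists>i::nat. g = d \<otimes> t [^] i"
    "centr \<noteq> carrier G \<Longrightarrow> t \<notin> centr"
proof (cases "centr = carrier G")
  case True
  show thesis
  proof (rule that[of \<one>])
    fix g assume "g \<in> carrier G"
    then show "\<exists>d\<in>centr. \<exists>i::nat. g = d \<otimes> \<one> [^] i" using True by (intro bexI[of _ g] exI[of _ 0]) auto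
  qed (use True in auto)
next
  case False
  then obtain t where t: "t \<in> carrier G" "t \<notin> centr" unfolding centr_def by blast
  have uc: "u \<in> carrier G" using u N_carrier by blast
  have N2: "cm u g \<in> Z 0 1" if "g \<in> carrier G" for g using N_comm[OF u(1) that] by simp
  have ut: "cm u t \<in> N 1" "cm u t \<notin> N 2" using N2[OF t(1)] centr_eqI[OF u t(1)] t by auto
  show thesis
  proof (rule that[OF t(1) _ t(2)])
    fix g assume g: "g \<in> carrier G"
    obtain i :: nat where i: "N 2 #> cm u g = N 2 #> (cm u t [^] i)"
      using c[OF ut] N2[OF g] unfolding cyclic_over_def by auto
    have "N 2 #> cm u (t [^] i) = N 2 #> (cm u t [^] i)"
      using foldl_comm_arg_pow(2)[of "[]" 0 u t 1 i] uc t N2[OF t(1)] by (simp add: numeral_2_eq_2)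
    then have eq: "N 2 #> cm u g = N 2 #> cm u (t [^] i)" using i by simp
    define d where "d = g \<otimes> inv (t [^] i)"
    have dc: "d \<in> carrier G" using g t d_def by simp
    have gd: "g = d \<otimes> t [^] i" using g t d_def by (simp add: m_assoc)
    have "N 2 #> cm u g = N 2 #> (cm u (t [^] i) \<otimes> cm u d)"
      using foldl_comm_arg_mult[of "[]" 0 u "t [^] i" d 1] gd uc t dc N2[OF dc] by (simp add: numeral_2_eq_2)
    then have "N 2 #> (cm u (t [^] i) \<otimes> cm u d) = N 2 #> cm u (t [^] i)" using eq by simp
    then have "cm u d \<in> N 2"
      using coset_eq_iff[OF N_normal, of "cm u (t [^] i) \<otimes> cm u d" "cm u (t [^] i)" 2] uc t dc by simp
    then have "d \<in> centr" using centr_eqI[OF u dc] by blast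
    then show "\<exists>d\<in>centr. \<exists>i::nat. g = d \<otimes> t [^] i" using gd by blast
  qed
qed

lemma foldl_snoc_N:
  "foldl cm v zs \<in> N k \<Longrightarrow> t \<in> carrier G \<Longrightarrow> foldl cm v (zs @ [t]) \<in> N (Suc k)"
  using N_comm by simp

lemma replicate_Suc_snoc: "replicate (Suc m) t = replicate m t @ [t]"
  by (simp add: replicate_append_same)

text \<open>Choose the last position \<open>s + 1\<close> in which an entry from \<open>D\<close>, followed only by entries \<open>t\<close>,
  can contribute a value outside \<open>N 1\<close>.\<close>

lemma selection:
  assumes ne: "\<not> N 0 \<subseteq> N 1" and t: "t \<in> carrier G"
    and D: "D \<subseteq> carrier G" "\<And>g. g \<in> carrier G \<Longrightarrow> \<exists>d\<in>D. \<exists>i::nat. g = d \<otimes> t [^] i"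
  obtains bs d where "bs \<noteq> []" "length bs < r" "set bs \<subseteq> carrier G" "d \<in> D"
    "lnc (bs @ d # replicate (r - 1 - length bs) t) \<notin> N 1"
    "\<And>bs' d'. length bs < length bs' \<Longrightarrow> length bs' < r \<Longrightarrow> set bs' \<subseteq> carrier G \<Longrightarrow> d' \<in> D \<Longrightarrow>
      lnc (bs' @ d' # replicate (r - 1 - length bs') t) \<in> N 1"
proof -
  define P where "P s \<longleftrightarrow> s \<ge> 1 \<and> s < r \<and> (\<exists>bs d. length bs = s \<and> set bs \<subseteq> carrier G \<and> d \<in> D \<and>
    lnc (bs @ d # replicate (r - 1 - s) t) \<notin> N 1)" for s
  have "\<exists>s. P s"
  proof (rule ccontr)
    assume "\<not> (\<exists>s. P s)"
    then have nP: "lnc (bs @ d # replicate (r - 1 - length bs) t) \<in> N 1"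
      if "bs \<noteq> []" "length bs < r" "set bs \<subseteq> carrier G" "d \<in> D" for bs d
      using that unfolding P_def by (metis One_nat_def Suc_leI length_greater_0_conv)
    \<comment> \<open>With \<open>x = d t^i\<close> and multiplicativity modulo \<open>N 1\<close>,
      an arbitrary entry reduces to one from \<open>D\<close> and to the entry
      \<open>t\<close>.\<close>
    have lin: "foldl cm (cm (lnc bs) x) (replicate (r - 1 - length bs) t) \<in> N 1"
      if bs: "bs \<noteq> []" "length bs < r" "set bs \<subseteq> carrier G" and x: "x \<in> carrier G"
        and tt: "foldl cm (cm (lnc bs) t) (replicate (r - 1 - length bs) t) \<in> N 1" for bs x
    proof -
      let ?ys = "replicate (r - 1 - length bs) t"
      obtain d i where d: "d \<in> D" "x = d \<otimes> t [^] (i::nat)" using D(2)[OF x] by blast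
      have dc: "d \<in> carrier G" using d D by blast
      have ys: "set ?ys \<subseteq> carrier G" using t by auto
      have bc: "lnc bs \<in> carrier G" using bs by simp
      have Z0: "cm (lnc bs) g \<in> Z (length ?ys) 0" if "g \<in> carrier G" for g
        using slice_mem_Z[of bs g] bs that by simp
      have E: "N 1 #> foldl cm (cm (lnc bs) x) ?ys
          = N 1 #> (foldl cm (cm (lnc bs) (t [^] i)) ?ys \<otimes> foldl cm (cm (lnc bs) d) ?ys)"
        using foldl_comm_arg_mult[OF refl bc _ dc ys Z0[OF dc], of "t [^] i"] d t by simp
      have E2: "N 1 #> foldl cm (cm (lnc bs) (t [^] i)) ?ys = N 1 #> (foldl cm (cm (lnc bs) t) ?ys [^] i)"
        using foldl_comm_arg_pow(2)[OF refl bc t ys Z0[OF t], of i] by simp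
      have 1: "foldl cm (cm (lnc bs) (t [^] i)) ?ys \<in> N 1"
        using N_mem_cong[OF _ _ E2] subgroup_pow_mem[OF N_subgroup tt] bc t ys
        by simp
      have 2: "foldl cm (cm (lnc bs) d) ?ys \<in> N 1" using nP[OF bs d(1)] bs(1) by (simp add: lnc_append)
      show ?thesis
        using N_mem_cong[OF _ _ E] N_mult[OF 1 2] bc t ys x dc
        by simp
    qed
    \<comment> \<open>The entries \<open>t\<close> are released one by one from the left; at
      \<open>s = r\<close> no prescribed entry is left.\<close>
    have V: "\<forall>bs. length bs = s \<longrightarrow> set bs \<subseteq> carrier G \<longrightarrow> lnc (bs @ replicate (r - s) t) \<in> N 1"
      if "1 \<le> s" "s \<le> r" for s
      using that
    proof (induction s rule: dec_induct)
      case base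
      show ?case
      proof (intro allI impI)
        fix bs assume bs: "length bs = 1" "set bs \<subseteq> carrier G"
        then obtain x where x: "bs = [x]" "x \<in> carrier G" by (cases bs) auto
        obtain q where q: "r = Suc (Suc q)" using r_ge_2 by (metis One_nat_def Suc_1 Suc_leD Suc_le_D Suc_le_mono)
        let ?ys = "replicate q t"
        have ys: "set ?ys \<subseteq> carrier G" using t by auto
        \<comment> \<open>A slice varies an entry after the first, so \<open>[x, t, ...]\<close> is
          traded for the inverse of \<open>[t, x, ...]\<close>, for which the value at
          \<open>x = t\<close> is the identity.\<close>
        have "foldl cm (cm t x) ?ys \<in> N 1"
          using lin[of "[t]" x] t x q ys foldl_comm_one[OF ys] N_one by simp
        moreover have Zt: "cm t x \<in> Z (Suc q) 1"
          using slice_mem_Z[of "[t]" x q] q t x Z_subset_Suc_Suc[of q 0] by auto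
        have E: "N 1 #> foldl cm (inv (cm t x)) ?ys = N 1 #> inv (foldl cm (cm t x) ?ys)"
          using foldl_comm_inv[OF _ Zt ys] by simp
        ultimately have "foldl cm (cm x t) ?ys \<in> N 1"
          using N_mem_cong[OF _ _ E] N_inv x t ys
          by (simp add: inv_comm)
        then show "lnc (bs @ replicate (r - 1) t) \<in> N 1" using x q by simp
      qed
    next
      case (step s)
      show ?case
      proof (intro allI impI)
        fix cs assume cs: "length cs = Suc s" "set cs \<subseteq> carrier G"
        then obtain bs x where bx: "cs = bs @ [x]" "length bs = s" "set bs \<subseteq> carrier G" "x \<in> carrier G"
          by (cases cs rule: rev_cases) auto
        have ne: "bs \<noteq> []" using bx step by auto
        have rs: "r - s = Suc (r - 1 - s)" using step by auto
        have "foldl cm (cm (lnc bs) t) (replicate (r - 1 - length bs) t) \<in> N 1"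
          using step(3) step.prems bx ne rs by (auto simp: lnc_append)
        then have "foldl cm (cm (lnc bs) x) (replicate (r - 1 - length bs) t) \<in> N 1"
          using lin[OF ne _ bx(3,4)] bx step by simp
        then show "lnc (cs @ replicate (r - Suc s) t) \<in> N 1" using bx ne by (simp add: lnc_append)
      qed
    qed
    have "N 0 \<subseteq> N 1"
      using V[of r] r_ge_2 by (intro N_0_subset N_subgroup) auto
    then show False using ne by blast
  qed
  moreover have "P s \<Longrightarrow> s \<le> r" for s unfolding P_def by simp
  ultimately obtain s where s: "P s" and max: "\<And>s'. P s' \<Longrightarrow> s' \<le> s"
    using Nat.ex_has_greatest_nat[of P _ r] by blast
  from s obtain bs d where bs: "length bs = s" "set bs \<subseteq> carrier G" "d \<in> D" "s \<ge> 1" "s < r"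
    "lnc (bs @ d # replicate (r - 1 - s) t) \<notin> N 1" unfolding P_def by blast
  show thesis
  proof (rule that[of bs d])
    fix bs' d'
    assume "length bs < length bs'" "length bs' < r" "set bs' \<subseteq> carrier G" "d' \<in> D"
    then show "lnc (bs' @ d' # replicate (r - 1 - length bs') t) \<in> N 1"
      using max[of "length bs'"] bs unfolding P_def by force
  qed (use bs in auto)
qed

section \<open>Two ways to find a covering slice in a finite p-group\<close>

definition slice_onto :: bool where
  "slice_onto \<longleftrightarrow> (\<exists>bs ys. length bs + 1 + length ys = r \<and> set bs \<subseteq> carrier G \<and> set ys \<subseteq> carrier G \<and>
     (\<forall>n\<in>N 0. \<exists>g\<in>carrier G. lnc (bs @ [g] @ ys) = n))"

lemma slice_ontoI:
  assumes "bs \<noteq> []" "length bs + 1 + length ys = r" "set bs \<subseteq> carrier G" "set ys \<subseteq> carrier G"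
    and "\<And>k. covers (lnc bs) ys k"
  shows slice_onto
  unfolding slice_onto_def
proof (intro exI conjI ballI)
  fix n assume "n \<in> N 0"
  then obtain g where "g \<in> carrier G" "foldl cm (cm (lnc bs) g) ys = n"
    using slice_surj[OF assms(5) _ assms(4)] assms(3) by auto
  then show "\<exists>g\<in>carrier G. lnc (bs @ [g] @ ys) = n" using assms(1) by (auto simp: lnc_append)
qed (use assms in auto)

text \<open>For \<open>e = 1\<close> the \<open>p\<close>-th power of \<open>d\<close> covers layer
  \<open>1\<close>. For \<open>e = 2\<close> it lands in layer \<open>2\<close>, so layer
  \<open>1\<close> needs an element of its own, built from some \<open>t\<close> that acts
  nontrivially on \<open>N 0 / N 2\<close>; hence the hypothesis \<open>moved\<close>.\<close>

lemma slice_onto_split: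
  assumes ne: "\<not> N 0 \<subseteq> N 1"
    and idx0: "card (N 0) \<le> p * card (N 1)" and idx1: "card (N 1) \<le> p * card (N 2)"
    and base: "\<And>x g. x \<in> N (e - 1) \<Longrightarrow> g \<in> carrier G \<Longrightarrow> pth_power 0 (cm x g)"
    and moved: "e = 2 \<Longrightarrow> centr \<noteq> carrier G"
  shows slice_onto
proof -
  have gen0: "n \<in> cyclic_over (N 1) v" if "v \<in> N 0" "v \<notin> N 1" "n \<in> N 0" for v n
    using prime_index_generator[OF N_normal N_subgroup _ idx0] that N_desc[of 0] by simp
  have gen1: "n \<in> cyclic_over (N 2) v" if "v \<in> N 1" "v \<notin> N 2" "n \<in> N 1" for v n
    using prime_index_generator[OF N_normal N_subgroup _ idx1] that N_desc[of 1] by (simp add: numeral_2_eq_2)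
  obtain u where u: "u \<in> N 0" "u \<notin> N 1" using ne by blast
  obtain t where t: "t \<in> carrier G" "\<And>g. g \<in> carrier G \<Longrightarrow> \<exists>d\<in>centr. \<exists>i::nat. g = d \<otimes> t [^] i"
    "centr \<noteq> carrier G \<Longrightarrow> t \<notin> centr"
    using centr_complement[OF u(1) gen0[OF u] gen1] by blast
  have Dc: "centr \<subseteq> carrier G" by (auto simp: centr_def)
  obtain bs d where bs: "bs \<noteq> []" "length bs < r" "set bs \<subseteq> carrier G" and d: "d \<in> centr"
    and out: "lnc (bs @ d # replicate (r - 1 - length bs) t) \<notin> N 1"
    and max: "\<And>bs' d'. length bs < length bs' \<Longrightarrow> length bs' < r \<Longrightarrow> set bs' \<subseteq> carrier G \<Longrightarrow> d' \<in> centr \<Longrightarrow>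
      lnc (bs' @ d' # replicate (r - 1 - length bs') t) \<in> N 1"
    using selection[OF ne t(1) Dc t(2)] by blast
  define b m ys where "b = lnc bs" and "m = r - 1 - length bs" and "ys = replicate m t"
  have b: "b \<in> carrier G" using bs b_def by simp
  have ys: "set ys \<subseteq> carrier G" "length ys = m" using t ys_def by auto
  have r: "length bs + 1 + m = r" using bs m_def by simp
  have dc: "d \<in> carrier G" using d Dc by blast
  have Z0: "cm b g \<in> Z m 0" if "g \<in> carrier G" for g
    using slice_mem_Z[OF bs(1,3) that r] b_def by simp
  define v where "v = foldl cm (cm b d) ys"
  have v: "v \<in> N 0" "v \<notin> N 1"
    using foldl_comm_mem[OF ys(2) Z0[OF dc] ys(1)] out bs(1) unfolding v_def b_def ys_def m_def
    by (simp_all add: lnc_append)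
  \<comment> \<open>These commutators have length \<open>r + 1\<close>. If \<open>q\<close> has
    length \<open>r\<close>, then \<open>d\<close> centralizes \<open>N 0\<close> modulo
    \<open>N 2\<close>; if \<open>q\<close> is shorter, maximality gives \<open>N 1\<close> before
    the last \<open>t\<close>, and that \<open>t\<close> gains the second layer.\<close>
  have late: "foldl cm (cm (lnc q) d) (replicate (r - length q) t) \<in> N 2"
    if q: "length bs < length q" "length q \<le> r" "set q \<subseteq> carrier G" for q
  proof (cases "length q = r")
    case True
    then show ?thesis using lnc_mem_N_0[OF True q(3)] d by (simp add: centr_def)
  next
    case False
    then have l: "r - length q = Suc (r - 1 - length q)" using q by auto
    have "q \<noteq> []" using q by auto
    then have "foldl cm (cm (lnc q) d) (replicate (r - 1 - length q) t) \<in> N 1"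
      using max[OF q(1) _ q(3) d] False q by (simp add: lnc_append)
    then show ?thesis using foldl_snoc_N[OF _ t(1)] unfolding l replicate_Suc_snoc
      by (metis One_nat_def Suc_1)
  qed
  have err1: "foldl cm (cm (cm b d) d) ys \<in> N 2"
    using late[of "bs @ [d]"] bs dc b_def ys_def m_def by (simp add: lnc_append)
  \<comment> \<open>The length is now \<open>r + 2\<close>, and a third layer must be won: by the
    last \<open>d\<close> if no \<open>t\<close> follows, otherwise by the last \<open>t\<close>,
    after an application of \<open>late\<close> without it.\<close>
  have err2: "foldl cm (cm (cm (cm b d) d) d) ys \<in> N 3"
  proof (cases m)
    case 0
    then have "cm (cm b d) d \<in> N 2" using err1 ys_def by simp
    from N_comm[OF this dc] show ?thesis using 0 ys_def by (simp add: eval_nat_numeral)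
  next
    case (Suc m')
    have l: "r - Suc (Suc (length bs)) = m'" using Suc m_def by simp
    have "foldl cm (cm (cm (cm b d) d) d) (replicate m' t) \<in> N 2"
      using late[of "bs @ [d, d]"] bs dc b_def Suc r l by (simp add: lnc_append)
    then show ?thesis using foldl_snoc_N[OF _ t(1), of _ _ 2] unfolding ys_def Suc replicate_Suc_snoc
      by (simp add: eval_nat_numeral)
  qed
  note C = pth_power_chain[OF base]
  have g0: "\<exists>i::nat. N (Suc 0) #> n = N (Suc 0) #> (foldl cm (cm b d) ys [^] i)" if "n \<in> N 0" for n
    using gen0[OF v that] v_def unfolding cyclic_over_def by auto
  have c0: "covers b ys 0"
    using covers_generator(1)[OF b ys(1) dc] Z0[OF dc] g0 ys(2) by blast
  have ce: "deep_covers b ys (0 + e)"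
  proof (rule deep_covers_generator[OF C b ys(1) dc])
    show "cm b d \<in> Z (length ys) 0" using Z0[OF dc] ys(2) by simp
    show "foldl cm (cm (cm b d) d) ys \<in> N (0 + 2)" "foldl cm (cm (cm (cm b d) d) d) ys \<in> N (0 + 3)"
      unfolding add_0 by (fact err1 err2)+
  qed (use g0 in auto)
  have c1: "deep_covers b ys 1"
  proof (cases "e = 1")
    case True then show ?thesis using ce by simp
  next
    case False
    then have "e = 2" using e_cases by simp
    then have tD: "t \<notin> centr" using t(3) moved by blast
    \<comment> \<open>Being a commutator, \<open>h\<close> is deep, so it serves in layer
      \<open>1\<close> without conditions on error terms.\<close>
    define h where "h = cm d t"
    have h: "h \<in> carrier G" "deep h" using h_def dc t(1) deep_comm by auto
    have Zbh: "cm b h \<in> Z (length ys) 1"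
      unfolding h_def ys(2) using b dc t(1) Z0 Z_comm[of _ m 0] by (intro comm_comm_mem Z_normal) auto
    have cg: "cm (cm (cm b x) y) z \<in> Z m 2" if "x \<in> carrier G" "y \<in> carrier G" "z \<in> carrier G" for x y z
      using Z_comm[OF Z_comm[OF Z0]] that by (simp add: numeral_2_eq_2)
    define w1 w2 where "w1 = cm (cm b d) t" and "w2 = cm (cm b t) d"
    have w: "w1 \<in> Z m 1" "w2 \<in> Z m 1" "w1 \<in> carrier G" "w2 \<in> carrier G"
      using Z_comm[OF Z0] dc t(1) b unfolding w1_def w2_def by auto
    have w': "w1 \<in> Z (Suc m) 2" "w2 \<in> Z (Suc m) 2"
      using w Z_subset_Suc_Suc[of m 1] by (auto simp: numeral_2_eq_2)
    \<comment> \<open>By the Jacobi identity the value at \<open>h\<close> splits into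
      \<open>[b, d, t, ...]\<close> and the inverse of \<open>[b, t, d, ...]\<close>. The latter is
      negligible by \<open>late\<close>; the former equals \<open>[v, t]\<close>, because all
      entries after \<open>d\<close> are \<open>t\<close>.\<close>
    have "Z m 2 #> cm b h = Z m 2 #> (w1 \<otimes> inv w2)"
      unfolding h_def w1_def w2_def using comm_comm_expand_mod[OF Z_normal b dc t(1) cg] .
    then have "N 2 #> foldl cm (cm b h) ys = N 2 #> foldl cm (w1 \<otimes> inv w2) ys"
      by (rule foldl_comm_cong[OF ys(2)]) (use b h w ys(1) in auto)
    also have "\<dots> = N 2 #> (foldl cm w1 ys \<otimes> foldl cm (inv w2) ys)"
      using foldl_comm_mult[OF ys(2) Z_inv[OF w'(2)] w(3) ys(1)] .
    also have "\<dots> = N 2 #> (foldl cm w1 ys \<otimes> \<one>)"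
    proof (rule N_coset_mult)
      have "foldl cm w2 ys \<in> N 2"
        using late[of "bs @ [t]"] bs t(1) b_def ys_def m_def w2_def by (simp add: lnc_append)
      then have "inv (foldl cm w2 ys) \<in> N 2" using N_inv by blast
      then have "N 2 #> inv (foldl cm w2 ys) = N 2 #> \<one>" using N_coset_one_iff w ys by simp
      then show "N 2 #> foldl cm (inv w2) ys = N 2 #> \<one>"
        using foldl_comm_inv[OF ys(2) w'(2) ys(1)] by simp
    qed (use w ys in auto)
    finally have E: "N 2 #> foldl cm (cm b h) ys = N 2 #> foldl cm w1 ys" using w ys by simp
    have "foldl cm w1 ys = cm v t"
    proof -
      have "foldl cm w1 ys = foldl cm (cm b d) (t # replicate m t)" unfolding w1_def ys_def by simp
      also have "t # replicate m t = replicate m t @ [t]" by (simp add: replicate_append_same)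
      finally show ?thesis by (simp add: v_def ys_def)
    qed
    moreover have "cm v t \<notin> N 2" using centr_eqI[OF v(1) gen0[OF v] t(1)] tD by blast
    ultimately have hout: "foldl cm (cm b h) ys \<notin> N 2"
      using N_mem_cong[OF _ _ E] b h w ys t(1) N_carrier[OF v(1)] by simp
    have hin: "foldl cm (cm b h) ys \<in> N 1" using foldl_comm_mem[OF refl Zbh ys(1)] .
    show ?thesis
    proof (rule covers_generator(2)[OF b ys(1) h(1) Zbh _ h(2)])
      fix n assume "n \<in> N 1"
      then show "\<exists>i::nat. N (Suc 1) #> n = N (Suc 1) #> (foldl cm (cm b h) ys [^] i)"
        using gen1[OF hin hout] unfolding cyclic_over_def by (auto simp: numeral_2_eq_2)
    qed
  qed
  show ?thesis
  proof (rule slice_ontoI[OF bs(1) _ bs(3) ys(1)])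
    show "length bs + 1 + length ys = r" using r ys by simp
    show "covers (lnc bs) ys k" for k
    proof -
      have "deep_covers b ys 2" if "e = 2" using ce that unfolding add_0 by (simp only:)
      then show ?thesis using covers_all[OF C b ys(1) c0 c1] b_def by blast
    qed
  qed
qed

text \<open>If no slice covered layer \<open>0\<close>, each would have its image in a subgroup of
  order at most \<open>p\<close> of \<open>N 0 / N 1\<close>. An argument on bilinear maps then puts
  all commutators of length \<open>r\<close> on one line, so a slice in the last entry covers after
  all. With \<open>p\<close> odd and \<open>e = 1\<close> the error conditions are vacuous, so a
  covering of layer \<open>0\<close> is enough.\<close>

lemma slice_onto_central:
  assumes ne: "\<not> N 0 \<subseteq> N 1" and e1: "e = 1" and p_odd: "odd p"
    and idx: "card (N 0) \<le> p * (p * card (N 1))"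
    and base: "\<And>x g. x \<in> N 0 \<Longrightarrow> g \<in> carrier G \<Longrightarrow> pth_power 0 (cm x g)"
  shows slice_onto
proof (rule ccontr)
  assume nslice: "\<not> slice_onto"
  have C': "\<And>k n. n \<in> N (k + e) \<Longrightarrow> pth_power k n" using pth_power_chain base e1 by simp
  have ncov: "\<not> covers (lnc bs) ys 0"
    if bs: "bs \<noteq> []" "length bs + 1 + length ys = r" "set bs \<subseteq> carrier G" and ys: "set ys \<subseteq> carrier G" for bs ys
  proof
    assume c0: "covers (lnc bs) ys 0"
    have b: "lnc bs \<in> carrier G" using bs by simp
    have p2: "p \<noteq> 2" and e2: "e \<noteq> 2" using p_odd e1 by auto
    have "deep_covers (lnc bs) ys (0 + e)"
    proof (rule deep_covers_step[OF C' b ys])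
      fix n assume "n \<in> N 0"
      then show "\<exists>h\<in>carrier G. cm (lnc bs) h \<in> Z (length ys) 0 \<and>
          N (Suc 0) #> foldl cm (cm (lnc bs) h) ys = N (Suc 0) #> n \<and>
          (p = 2 \<longrightarrow> foldl cm (cm (cm (lnc bs) h) h) ys \<in> N (0 + 2)) \<and>
          (e = 2 \<longrightarrow> foldl cm (cm (cm (cm (lnc bs) h) h) h) ys \<in> N (0 + 3))"
        using c0 p2 e2 unfolding covers_def by blast
    qed
    then have "covers (lnc bs) ys k" for k
      using covers_all[OF C' b ys c0] e1 by simp
    then show False using slice_ontoI[OF bs ys] nslice by blast
  qed
  have N1: "N 1 \<subseteq> N 0" using N_desc[of 0] by simp
  \<comment> \<open>Linear dependence: modulo \<open>N 1\<close> the set spans at most a line. It is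
    stated through powers, without a vector space structure on \<open>N 0 / N 1\<close>.\<close>
  define dep where "dep S \<longleftrightarrow> (\<forall>u\<in>S. \<forall>v\<in>S. u \<notin> N 1 \<longrightarrow> v \<in> cyclic_over (N 1) u)" for S
  have slice_dep: "dep {foldl cm (cm (lnc bs) y) ys | y. y \<in> carrier G}"
    if bs: "bs \<noteq> []" "length bs + 1 + length ys = r" "set bs \<subseteq> carrier G" and ys: "set ys \<subseteq> carrier G" for bs ys
  proof -
    define f where "f y = foldl cm (cm (lnc bs) y) ys" for y
    have b: "lnc bs \<in> carrier G" using bs by simp
    have Z0: "cm (lnc bs) y \<in> Z (length ys) 0" if "y \<in> carrier G" for y using slice_mem_Z[OF bs(1,3) that bs(2)] .
    have f_in: "f y \<in> N 0" if "y \<in> carrier G" for y unfolding f_def using foldl_comm_mem[OF refl Z0[OF that] ys] .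
    have f_c: "f y \<in> carrier G" if "y \<in> carrier G" for y using N_carrier[OF f_in[OF that]] .
    have f_mult: "N 1 #> f (y \<otimes> x) = N 1 #> (f x \<otimes> f y)" if "x \<in> carrier G" "y \<in> carrier G" for x y
      unfolding f_def using foldl_comm_arg_mult[OF refl b that ys Z0[OF that(2)]] by simp
    have f_pow: "N 1 #> f (y [^] i) = N 1 #> (f y [^] i)" if "y \<in> carrier G" for y and i :: nat
      unfolding f_def using foldl_comm_arg_pow(2)[OF refl b that ys Z0[OF that]] by simp
    \<comment> \<open>The image of the slice, lifted to \<open>N 0\<close>. By \<open>ncov\<close>
      it is proper, so it has index at most \<open>p\<close> over \<open>N 1\<close>.\<close>
    define S where "S = {x \<in> N 0. \<exists>y\<in>carrier G. N 1 #> f y = N 1 #> x}"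
    have Ss: "subgroup S G"
    proof
      show "S \<subseteq> carrier G" using N_carrier S_def by auto
      have "N 1 #> f \<one> = N 1 #> \<one>" using f_pow[of \<one> 0] by simp
      then show "\<one> \<in> S" unfolding S_def using N_one by blast
    next
      fix x x' assume "x \<in> S" "x' \<in> S"
      then obtain y y' where y: "x \<in> N 0" "x' \<in> N 0" "y \<in> carrier G" "y' \<in> carrier G"
        "N 1 #> f y = N 1 #> x" "N 1 #> f y' = N 1 #> x'" unfolding S_def by blast
      have "N 1 #> f (y' \<otimes> y) = N 1 #> (x \<otimes> x')"
        unfolding f_mult[OF y(3,4)] using y f_c N_carrier by (intro N_coset_mult) auto
      then show "x \<otimes> x' \<in> S" unfolding S_def using y N_mult by blast
    next
      fix x assume "x \<in> S"
      then obtain y where y: "x \<in> N 0" "y \<in> carrier G" "N 1 #> f y = N 1 #> x" unfolding S_def by blast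
      have xc: "x \<in> carrier G" using y N_carrier by blast
      have "N 1 #> (f y \<otimes> f (inv y)) = N 1 #> f \<one>" using f_mult[of y "inv y"] y by simp
      also have "\<dots> = N 1 #> \<one>" using f_pow[of \<one> 0] by simp
      finally have "N 1 #> (f y \<otimes> f (inv y)) = N 1 #> \<one>" .
      moreover have "N 1 #> (f y \<otimes> f (inv y)) = N 1 #> (x \<otimes> f (inv y))"
        using y f_c xc by (intro N_coset_mult) auto
      ultimately have "N 1 #> (inv x \<otimes> (x \<otimes> f (inv y))) = N 1 #> (inv x \<otimes> \<one>)"
        using y f_c xc by (intro N_coset_mult) auto
      then have "N 1 #> f (inv y) = N 1 #> inv x" using y f_c xc by simp
      then show "inv x \<in> S" unfolding S_def using y N_inv[OF y(1)] by blast
    qed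
    have SN: "S \<subset> N 0"
    proof -
      have "S \<noteq> N 0"
      proof
        assume S: "S = N 0"
        have "covers (lnc bs) ys 0" unfolding covers_def
        proof
          fix n assume "n \<in> N 0"
          then obtain y where "y \<in> carrier G" "N 1 #> f y = N 1 #> n" using S S_def by blast
          then show "\<exists>h\<in>carrier G. cm (lnc bs) h \<in> Z (length ys) 0 \<and>
              N (Suc 0) #> foldl cm (cm (lnc bs) h) ys = N (Suc 0) #> n"
            using Z0 unfolding f_def by auto
        qed
        then show False using ncov[OF bs ys] by blast
      qed
      then show ?thesis by (auto simp: S_def)
    qed
    have N1S: "N 1 \<subseteq> S"
    proof
      fix x assume x: "x \<in> N 1"
      have "N 1 #> f \<one> = N 1 #> \<one>" using f_pow[of \<one> 0] by simp
      also have "\<dots> = N 1 #> x" using N_coset_one_iff[OF N_carrier[OF x], of 1] x by metis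
      finally show "x \<in> S" unfolding S_def using x N1 by blast
    qed
    have cardS: "card S \<le> p * card (N 1)"
    proof -
      have "p * card S \<le> card (N 0)" using card_subgroup_less[OF Ss N_subgroup SN] .
      then have "p * card S \<le> p * (p * card (N 1))" using idx by (rule le_trans)
      then show ?thesis using nat_mult_le_cancel1[OF prime_gt_0_nat[OF prime_p]] by blast
    qed
    have fS: "f y \<in> S" if "y \<in> carrier G" for y unfolding S_def using f_in that by blast
    have "v \<in> cyclic_over (N 1) u" if "u \<in> S" "u \<notin> N 1" "v \<in> S" for u v
      using prime_index_generator[OF N_normal Ss N1S cardS that] .
    then show ?thesis unfolding dep_def f_def[symmetric] using fS by auto
  qed
  \<comment> \<open>This serves to vary the first entry: since \<open>[x, y]\<close> is the inverse
    of \<open>[y, x]\<close>, it becomes the second entry of a slice.\<close>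
  have dep_cong: "dep S" if S: "\<And>x. x \<in> S \<Longrightarrow> x \<in> carrier G \<and> (\<exists>y\<in>S'. y \<in> carrier G \<and> N 1 #> x = N 1 #> inv y)"
    and S': "dep S'" for S S'
    unfolding dep_def
  proof (intro ballI impI)
    fix u v assume uv: "u \<in> S" "v \<in> S" "u \<notin> N 1"
    obtain u' where u': "u' \<in> S'" "u' \<in> carrier G" "u \<in> carrier G" "N 1 #> u = N 1 #> inv u'" using S uv(1) by blast
    obtain v' where v': "v' \<in> S'" "v' \<in> carrier G" "v \<in> carrier G" "N 1 #> v = N 1 #> inv v'" using S uv(2) by blast
    have "inv u' \<notin> N 1"
      using N_mem_cong[OF _ _ u'(4)] u' uv(3) by simp
    then have "u' \<notin> N 1" using N_inv by blast
    then have "v' \<in> cyclic_over (N 1) u'" using S' u' v' unfolding dep_def by blast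
    then obtain i :: nat where i: "N 1 #> v' = N 1 #> (u' [^] i)" unfolding cyclic_over_def by blast
    have "N 1 #> v = N 1 #> inv (u' [^] i)"
      unfolding v'(4) using i u' v' by (intro coset_inv[OF N_normal]) auto
    also have "inv (u' [^] i) = inv u' [^] i" using u' by (simp add: nat_pow_inv)
    also have "N 1 #> (inv u' [^] i) = N 1 #> (u [^] i)" using u' by (intro coset_pow[OF N_normal]) auto
    finally show "v \<in> cyclic_over (N 1) u" using v' unfolding cyclic_over_def by blast
  qed
  \<comment> \<open>Induction on the number \<open>s\<close> of free entries at the front, the other
    \<open>r - s\<close> being fixed.\<close>
  have dep_all: "\<forall>ys. length ys = r - s \<longrightarrow> set ys \<subseteq> carrier G \<longrightarrow>
      dep {lnc (bs @ ys) | bs. length bs = s \<and> set bs \<subseteq> carrier G}" if "1 \<le> s" "s \<le> r" for s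
    using that
  proof (induction s rule: dec_induct)
    case base
    show ?case
    proof (intro allI impI)
      fix ys assume ys: "length ys = r - 1" "set ys \<subseteq> carrier G"
      then obtain y zs where yz: "ys = y # zs" "length zs = r - 2" "y \<in> carrier G" "set zs \<subseteq> carrier G"
        using r_ge_2 by (cases ys) auto
      have l: "length [y] + 1 + length zs = r" using yz r_ge_2 by simp
      have "dep {foldl cm (cm (lnc [y]) x) zs | x. x \<in> carrier G}"
        using slice_dep[of "[y]" zs] l yz by simp
      moreover have "x \<in> carrier G \<and> (\<exists>v\<in>{foldl cm (cm (lnc [y]) x) zs | x. x \<in> carrier G}.
          v \<in> carrier G \<and> N 1 #> x = N 1 #> inv v)"
        if x': "x \<in> {lnc (bs @ ys) | bs. length bs = 1 \<and> set bs \<subseteq> carrier G}" for x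
      proof -
        obtain bs where "x = lnc (bs @ ys)" "length bs = 1" "set bs \<subseteq> carrier G" using x' by blast
        then obtain x1 where x: "x = lnc ([x1] @ ys)" "x1 \<in> carrier G" by (cases bs) auto
        have Zy: "cm y x1 \<in> Z (Suc (length zs)) 1"
          using slice_mem_Z[of "[y]" x1 "length zs"] l yz x Z_subset_Suc_Suc[of "length zs" 0] by auto
        have "x = foldl cm (inv (cm y x1)) zs" using x yz by (simp add: inv_comm)
        then have "N 1 #> x = N 1 #> inv (foldl cm (cm y x1) zs)"
          using foldl_comm_inv[OF refl Zy yz(4)] by simp
        moreover have "x \<in> carrier G" "foldl cm (cm y x1) zs \<in> carrier G" using x yz by simp_all
        moreover have "foldl cm (cm y x1) zs \<in> {foldl cm (cm (lnc [y]) x) zs | x. x \<in> carrier G}"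
          using x(2) by auto
        ultimately show ?thesis by blast
      qed
      ultimately show "dep {lnc (bs @ ys) | bs. length bs = 1 \<and> set bs \<subseteq> carrier G}" using dep_cong by blast
    qed
  next
    case (step s)
    show ?case
    proof (intro allI impI)
      fix ys assume ys: "length ys = r - Suc s" "set ys \<subseteq> carrier G"
      define B where "B b y = foldl cm (cm (lnc b) y) ys" for b y
      define OK where "OK b \<longleftrightarrow> length b = s \<and> set b \<subseteq> carrier G" for b
      have bne: "b \<noteq> []" if "OK b" for b using that step OK_def by auto
      have bl: "length b + 1 + length ys = r" if "OK b" for b using that step ys OK_def by simp
      have slice: "v \<in> cyclic_over (N 1) u"
        if "OK b" "u = B b y" "v = B b y'" "u \<notin> N 1" "y \<in> carrier G" "y' \<in> carrier G" for b u v y y'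
        using slice_dep[OF bne bl _ ys(2), of b] that unfolding dep_def B_def OK_def by blast
      have IH: "v \<in> cyclic_over (N 1) u"
        if "OK b" "OK b'" "u = B b y" "v = B b' y" "u \<notin> N 1" "y \<in> carrier G" for b b' u v y
      proof -
        have B: "B b y = lnc (b @ y # ys)" if "OK b" for b using bne[OF that] unfolding B_def by (simp add: lnc_append)
        have len: "length (y # ys) = r - s" using ys step by simp
        have "dep {lnc (bs @ y # ys) | bs. length bs = s \<and> set bs \<subseteq> carrier G}"
          using step len ys that(6) by simp
        then show ?thesis using that B unfolding dep_def OK_def by blast
      qed
      have B_in: "B b y \<in> carrier G" if "OK b" "y \<in> carrier G" for b y
        unfolding B_def using that OK_def ys by auto
      have add: "N 1 #> B b (y1 \<otimes> y2) = N 1 #> (B b y2 \<otimes> B b y1)"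
        if "OK b" "y1 \<in> carrier G" "y2 \<in> carrier G" for b y1 y2
        unfolding B_def using foldl_comm_arg_mult[OF refl _ that(3,2) ys(2), of "lnc b" 0]
          slice_mem_Z[OF bne[OF that(1)] _ that(2) bl[OF that(1)]] that(1) unfolding OK_def by auto
      \<comment> \<open>A map additive in \<open>y\<close> whose rows and columns each span at most
        a line has all its values on one line. If both mixed values vanish, then at
        \<open>y1 y2\<close> the row of \<open>b1\<close> takes its value at \<open>y1\<close> and
        the row of \<open>b2\<close> its value at \<open>y2\<close>, and the column of
        \<open>y1 y2\<close> links the two.\<close>
      have key: "B b2 y2 \<in> cyclic_over (N 1) (B b1 y1)"
        if ok: "OK b1" "OK b2" and y: "y1 \<in> carrier G" "y2 \<in> carrier G" and u: "B b1 y1 \<notin> N 1" for b1 b2 y1 y2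
      proof -
        note T = cyclic_over_trans[OF N_normal B_in[OF ok(1) y(1)]]
        consider "B b1 y2 \<notin> N 1" | "B b2 y1 \<notin> N 1" | "B b1 y2 \<in> N 1" "B b2 y1 \<in> N 1" by blast
        then show ?thesis
        proof cases
          case 1
          show ?thesis using T[OF slice[OF ok(1) refl refl u y] IH[OF ok refl refl 1 y(2)]] .
        next
          case 2
          show ?thesis using T[OF IH[OF ok refl refl u y(1)] slice[OF ok(2) refl refl 2 y]] .
        next
          case 3
          have y12: "y1 \<otimes> y2 \<in> carrier G" using y by simp
          have "N 1 #> B b1 (y1 \<otimes> y2) = N 1 #> (\<one> \<otimes> B b1 y1)"
            unfolding add[OF ok(1) y] using 3 N_coset_one_iff B_in ok y
            by (intro N_coset_mult) auto
          then have e1: "N 1 #> B b1 (y1 \<otimes> y2) = N 1 #> B b1 y1" using B_in ok y by simp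
          have "N 1 #> B b2 (y1 \<otimes> y2) = N 1 #> (B b2 y2 \<otimes> \<one>)"
            unfolding add[OF ok(2) y] using 3 N_coset_one_iff B_in ok y
            by (intro N_coset_mult) auto
          then have e2: "N 1 #> B b2 (y1 \<otimes> y2) = N 1 #> B b2 y2" using B_in ok y by simp
          have "B b1 (y1 \<otimes> y2) \<notin> N 1"
            using N_mem_cong[OF _ _ e1] u B_in ok y y12 by simp
          from IH[OF ok refl refl this y12] obtain i :: nat
            where i: "N 1 #> B b2 (y1 \<otimes> y2) = N 1 #> (B b1 (y1 \<otimes> y2) [^] i)" unfolding cyclic_over_def by blast
          have "N 1 #> (B b1 (y1 \<otimes> y2) [^] i) = N 1 #> (B b1 y1 [^] i)"
            using e1 B_in ok y y12 by (intro coset_pow[OF N_normal]) auto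
          then show ?thesis using i e2 B_in ok y unfolding cyclic_over_def by auto
        qed
      qed
      have "\<exists>b y. OK b \<and> y \<in> carrier G \<and> lnc (cs @ ys) = B b y"
        if cs: "length cs = Suc s" "set cs \<subseteq> carrier G" for cs
      proof -
        obtain b y where "cs = b @ [y]" using cs by (cases cs rule: rev_cases) auto
        then have "OK b" "y \<in> carrier G" "lnc (cs @ ys) = B b y"
          using cs bne[of b] unfolding OK_def B_def by (auto simp: lnc_append)
        then show ?thesis by blast
      qed
      then show "dep {lnc (bs @ ys) | bs. length bs = Suc s \<and> set bs \<subseteq> carrier G}"
        unfolding dep_def using key by (auto; metis)
    qed
  qed
  have dep_r: "dep {lnc bs | bs. length bs = r \<and> set bs \<subseteq> carrier G}"
    using dep_all[of r] r_ge_2 by simp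
  obtain xs where xs: "length xs = r" "set xs \<subseteq> carrier G" "lnc xs \<notin> N 1"
    using N_0_subset[OF N_subgroup, of 1] ne by blast
  then obtain bs y where xs_eq: "xs = bs @ [y]" by (metis length_0_conv not_numeral_le_zero r_ge_2 rev_exhaust)
  have bs: "bs \<noteq> []" "length bs + 1 + length ([]::'a list) = r" "set bs \<subseteq> carrier G" "y \<in> carrier G"
    using xs_eq xs r_ge_2 by auto
  have val: "lnc xs = cm (lnc bs) y" using xs_eq bs by (simp add: lnc_append)
  have all: "N 0 \<subseteq> cyclic_over (N 1) (lnc xs)"
    using dep_r xs unfolding dep_def by (intro N_0_subset cyclic_over_subgroup[OF N_normal]) auto
  \<comment> \<open>A single commutator generates \<open>N 0\<close> over \<open>N 1\<close>, so
    powers of its last entry reach everything.\<close>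
  have "covers (lnc bs) [] 0"
  proof (rule covers_generator(1))
    show "cm (lnc bs) y \<in> Z (length ([]::'a list)) 0" using val lnc_mem_N_0[OF xs(1,2)] by simp
    fix n assume "n \<in> N 0"
    then show "\<exists>i::nat. N (Suc 0) #> n = N (Suc 0) #> (foldl cm (cm (lnc bs) y) [] [^] i)"
      using all val unfolding cyclic_over_def by auto
  qed (use bs in auto)
  then show False using ncov[of bs "[]"] bs by simp
qed

end

section \<open>Lower central subgroups of finite p-groups\<close>

text \<open>An explicit model of \<open>verbal_chain\<close>, with \<open>e\<close> as a parameter
  so that both chains start from the same subgroup.\<close>

fun vchain :: "('a, 'b) monoid_scheme \<Rightarrow> nat \<Rightarrow> nat \<Rightarrow> 'a set \<Rightarrow> nat \<Rightarrow> 'a set" where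
  "vchain G p e M 0 = M"
| "vchain G p e M (Suc k) =
    generate G ({commutator G x g | x g. x \<in> vchain G p e M k \<and> g \<in> carrier G} \<union>
      {x [^]\<^bsub>G\<^esub> p | x. x \<in> vchain G p e M (k - (e - 1))})"

context group
begin

lemma conj_lnc:
  assumes g: "g \<in> carrier G" and xs: "set xs \<subseteq> carrier G"
  shows "g \<otimes> lnc xs \<otimes> inv g = lnc (map (\<lambda>x. g \<otimes> x \<otimes> inv g) xs)"
proof -
  have "g \<otimes> foldl cm x ys \<otimes> inv g = foldl cm (g \<otimes> x \<otimes> inv g) (map (\<lambda>x. g \<otimes> x \<otimes> inv g) ys)"
    if "x \<in> carrier G" "set ys \<subseteq> carrier G" for x ys
    using that by (induction ys arbitrary: x) (simp_all add: conj_comm[OF g])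
  then show ?thesis using g xs by (cases xs) auto
qed

definition gamma :: "nat \<Rightarrow> 'a set" where
  "gamma r = generate G {lnc xs | xs. length xs = r \<and> set xs \<subseteq> carrier G}"

lemma gamma_normal: "gamma r \<lhd> G"
  unfolding gamma_def
proof (rule normal_generateI)
  fix h g assume "h \<in> {lnc xs | xs. length xs = r \<and> set xs \<subseteq> carrier G}" and g: "g \<in> carrier G"
  then obtain xs where xs: "h = lnc xs" "length xs = r" "set xs \<subseteq> carrier G" by blast
  let ?ys = "map (\<lambda>x. g \<otimes> x \<otimes> inv g) xs"
  have "g \<otimes> h \<otimes> inv g = lnc ?ys" "length ?ys = r" "set ?ys \<subseteq> carrier G"
    using conj_lnc[OF g xs(3)] xs g by auto
  then show "g \<otimes> h \<otimes> inv g \<in> {lnc xs | xs. length xs = r \<and> set xs \<subseteq> carrier G}" by blast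
qed auto

lemma gamma_comm:
  assumes "r \<ge> 2"
  shows "gamma r \<subseteq> generate G {cm x y | x y. x \<in> carrier G \<and> y \<in> carrier G}"
  unfolding gamma_def
proof (rule mono_generate)
  show "{lnc xs | xs. length xs = r \<and> set xs \<subseteq> carrier G} \<subseteq> {cm x y | x y. x \<in> carrier G \<and> y \<in> carrier G}"
  proof
    fix h assume "h \<in> {lnc xs | xs. length xs = r \<and> set xs \<subseteq> carrier G}"
    then obtain xs where xs: "h = lnc xs" "length xs = r" "set xs \<subseteq> carrier G" by blast
    then obtain bs y where xs_eq: "xs = bs @ [y]" using assms by (cases xs rule: rev_cases) auto
    then have "bs \<noteq> []" using xs assms by auto
    then have "h = cm (lnc bs) y" "lnc bs \<in> carrier G" "y \<in> carrier G" using xs_eq xs by (simp_all add: lnc_append)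
    then show "h \<in> {cm x y | x y. x \<in> carrier G \<and> y \<in> carrier G}" by blast
  qed
qed

lemma card_le_cosets:
  assumes L: "L \<lhd> G" "finite L" and I: "finite I"
    and M: "\<And>x. x \<in> M \<Longrightarrow> x \<in> carrier G \<and> (\<exists>i\<in>I. f i \<in> carrier G \<and> L #> x = L #> f i)"
  shows "card M \<le> card I * card L"
proof -
  define J where "J = {i \<in> I. f i \<in> carrier G}"
  have J: "finite J" "card J \<le> card I" using I J_def by (auto intro: card_mono)
  have Lc: "L \<subseteq> carrier G" using L normal_imp_subgroup subgroup.subset by blast
  have fin: "finite (L #> f i)" "card (L #> f i) = card L" if "i \<in> J" for i
  proof -
    have "L #> f i \<in> rcosets L" using that Lc by (auto simp: J_def intro!: rcosetsI)
    then show "card (L #> f i) = card L" using card_cosets_equal[OF _ Lc] bij_betw_same_card by metis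
    show "finite (L #> f i)" using L(2) by (simp add: r_coset_def)
  qed
  have "M \<subseteq> (\<Union>i\<in>J. L #> f i)"
  proof
    fix x assume x: "x \<in> M"
    then obtain i where i: "i \<in> J" "L #> x = L #> f i" "x \<in> carrier G" using M[OF x] J_def by blast
    then show "x \<in> (\<Union>i\<in>J. L #> f i)" using rcos_self[OF i(3) normal_imp_subgroup[OF L(1)]] by auto
  qed
  then have "card M \<le> card (\<Union>i\<in>J. L #> f i)" using J fin by (intro card_mono) auto
  also have "\<dots> \<le> (\<Sum>i\<in>J. card (L #> f i))" by (rule card_UN_le) (use J in simp)
  also have "\<dots> = card J * card L" using fin by simp
  finally show ?thesis using J(2) by (meson le_trans mult_le_mono1)
qed

lemma pow_mod_coset:
  assumes L: "L \<lhd> G" and u: "u \<in> carrier G" "u [^] p \<in> L" and p: "p > (0::nat)"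
  shows "L #> (u [^] (i::int)) = L #> (u [^] nat (i mod int p))"
proof -
  have "(u [^] p) [^] (i div int p) \<in> L"
    using subgroup_int_pow_closed[OF normal_imp_subgroup[OF L] u(2)] .
  then have k: "u [^] (int p * (i div int p)) \<in> L" using u(1) by (simp add: int_pow_pow int_pow_int[symmetric])
  have m: "int (nat (i mod int p)) = i mod int p" using p by simp
  have "u [^] i = u [^] (i mod int p + int p * (i div int p))" by simp
  also have "\<dots> = u [^] (i mod int p) \<otimes> u [^] (int p * (i div int p))" using u(1) int_pow_mult by blast
  finally have "u [^] i = u [^] (nat (i mod int p)) \<otimes> u [^] (int p * (i div int p))"
    using m by (metis int_pow_int)
  then show ?thesis using k u(1) coset_eq_iff'[OF L] by (metis int_pow_closed nat_pow_closed)
qed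

text \<open>Collection to a normal form: moving a power of \<open>u\<close> past a power of
  \<open>v\<close> produces a commutator in the normal subgroup \<open>L\<close>. Exponents are
  integers as inverses of the generators occur; \<open>pow_mod_coset\<close> later reduces them
  modulo \<open>p\<close>.\<close>

lemma two_generator_cosets:
  assumes L: "L \<lhd> G" and ab: "u \<in> carrier G" "v \<in> carrier G"
    and com: "\<And>x y. x \<in> generate G {u, v} \<Longrightarrow> y \<in> generate G {u, v} \<Longrightarrow> cm x y \<in> L"
    and x: "x \<in> generate G {u, v}"
  shows "\<exists>(i::int) (j::int). L #> x = L #> (u [^] i \<otimes> v [^] j)"
  using x
proof (induction rule: generate.induct)
  case one then show ?case by (intro exI[of _ 0]) simp
next
  case (incl h)
  then consider "h = u" | "h = v" by blast
  then show ?case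
  proof cases
    case 1 then show ?thesis using ab by (intro exI[of _ 1] exI[of _ 0]) simp
  next
    case 2 then show ?thesis using ab by (intro exI[of _ 0] exI[of _ 1]) simp
  qed
next
  case (inv h)
  then consider "h = u" | "h = v" by blast
  then show ?case
  proof cases
    case 1 then show ?thesis using ab by (intro exI[of _ "-1"] exI[of _ 0]) (simp add: int_pow_neg)
  next
    case 2 then show ?thesis using ab by (intro exI[of _ 0] exI[of _ "-1"]) (simp add: int_pow_neg)
  qed
next
  case (eng x y)
  have sg: "subgroup (generate G {u, v}) G" using ab by (intro generate_is_subgroup) auto
  have uv: "u \<in> generate G {u, v}" "v \<in> generate G {u, v}" by (auto intro: generate.incl)
  obtain i j k l :: int where ij: "L #> x = L #> (u [^] i \<otimes> v [^] j)" "L #> y = L #> (u [^] k \<otimes> v [^] l)"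
    using eng by blast
  have c: "x \<in> carrier G" "y \<in> carrier G" using eng subgroup.mem_carrier[OF sg] by auto
  have cmL: "cm (v [^] j) (u [^] k) \<in> L" using com subgroup_int_pow_closed[OF sg] uv by blast
  define q where "q = cm (v [^] j) (u [^] k)"
  have qc: "q \<in> carrier G" using q_def ab by simp
  have pc: "u [^] n \<in> carrier G" "v [^] n \<in> carrier G" for n :: int using ab by auto
  have q': "cm q (v [^] l) \<in> L" using comm_in_normal_left[OF L] cmL q_def pc by blast
  have "L #> (x \<otimes> y) = L #> (u [^] i \<otimes> v [^] j \<otimes> (u [^] k \<otimes> v [^] l))"
    using ij c pc by (intro coset_mult[OF L]) auto
  also have "u [^] i \<otimes> v [^] j \<otimes> (u [^] k \<otimes> v [^] l) = u [^] i \<otimes> (v [^] j \<otimes> u [^] k) \<otimes> v [^] l"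
    using pc by (simp add: m_assoc)
  also have "\<dots> = u [^] i \<otimes> (u [^] k \<otimes> v [^] j \<otimes> q) \<otimes> v [^] l"
    unfolding q_def using mult_comm_swap[of "v [^] j" "u [^] k"] pc by simp
  also have "\<dots> = u [^] i \<otimes> u [^] k \<otimes> v [^] j \<otimes> (q \<otimes> v [^] l)" using pc qc by (simp add: m_assoc)
  also have "q \<otimes> v [^] l = v [^] l \<otimes> q \<otimes> cm q (v [^] l)" using mult_comm_swap[OF qc pc(2)] .
  also have "u [^] i \<otimes> u [^] k \<otimes> v [^] j \<otimes> (v [^] l \<otimes> q \<otimes> cm q (v [^] l)) =
      (u [^] i \<otimes> u [^] k) \<otimes> (v [^] j \<otimes> v [^] l) \<otimes> (q \<otimes> cm q (v [^] l))"
    using pc qc by (simp add: m_assoc)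
  also have "\<dots> = u [^] (i + k) \<otimes> v [^] (j + l) \<otimes> (q \<otimes> cm q (v [^] l))" using ab by (simp add: int_pow_mult)
  also have "L #> \<dots> = L #> (u [^] (i + k) \<otimes> v [^] (j + l))"
  proof -
    have "q \<otimes> cm q (v [^] l) \<in> L"
      using cmL q' q_def subgroup.m_closed[OF normal_imp_subgroup[OF L]] by blast
    then show ?thesis using pc qc by (subst coset_eq_iff'[OF L]) auto
  qed
  finally show ?case by (intro exI[of _ "i + k"] exI[of _ "j + l"])
qed

end

section \<open>The Frattini subgroup of \<open>N 0\<close> and the three cases\<close>

context lower_chain
begin

lemma N_0_not_subset: "N 0 \<noteq> {\<one>} \<Longrightarrow> \<not> N 0 \<subseteq> N 1"
proof -
  assume "N 0 \<noteq> {\<one>}"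
  then have "{\<one>} \<subset> N 0" using N_one by blast
  then obtain L where L: "L \<lhd> G" "L \<subset> N 0" "\<And>x g. x \<in> N 0 \<Longrightarrow> g \<in> carrier G \<Longrightarrow> cm x g \<in> L"
      "\<And>x. x \<in> N 0 \<Longrightarrow> x [^] p \<in> L"
    using frattini_like[OF N_normal one_is_normal] by metis
  have "N (Suc 0) \<subseteq> L" unfolding N_Suc
    using L(3,4) by (intro generate_subgroup_incl normal_imp_subgroup[OF L(1)]) auto
  then show ?thesis using L(2) by auto
qed

text \<open>It depends on the chain only through \<open>N 0\<close>, so it is the same for
  \<open>e = 1\<close> and \<open>e = 2\<close>.\<close>

definition frattini :: "'a set" where
  "frattini = generate G ({x [^] p | x. x \<in> N 0} \<union> {cm x y | x y. x \<in> N 0 \<and> y \<in> N 0})"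

lemma frattini_normal: "frattini \<lhd> G"
  unfolding frattini_def
proof (rule normal_generateI)
  fix h g
  assume h: "h \<in> {x [^] p | x. x \<in> N 0} \<union> {cm x y | x y. x \<in> N 0 \<and> y \<in> N 0}" and g: "g \<in> carrier G"
  have cj: "g \<otimes> x \<otimes> inv g \<in> N 0" if "x \<in> N 0" for x
    using normal.inv_op_closed2[OF N_normal g that] .
  from h show "g \<otimes> h \<otimes> inv g \<in> {x [^] p | x. x \<in> N 0} \<union> {cm x y | x y. x \<in> N 0 \<and> y \<in> N 0}"
  proof (elim UnE CollectE exE conjE)
    fix x assume "h = x [^] p" "x \<in> N 0"
    then show ?thesis using conj_pow[OF g N_carrier, of x 0 p] cj by blast
  next
    fix x y assume "h = cm x y" "x \<in> N 0" "y \<in> N 0"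
    then show ?thesis using conj_comm[OF g N_carrier N_carrier, of x 0 y 0] cj by blast
  qed
qed (use N_carrier in auto)

lemmas frattini_subgroup = normal_imp_subgroup[OF frattini_normal]

lemma frattini_subset: "subgroup H G \<Longrightarrow> (\<And>x. x \<in> N 0 \<Longrightarrow> x [^] p \<in> H) \<Longrightarrow>
    (\<And>x y. x \<in> N 0 \<Longrightarrow> y \<in> N 0 \<Longrightarrow> cm x y \<in> H) \<Longrightarrow> frattini \<subseteq> H"
  unfolding frattini_def by (intro generate_subgroup_incl) auto

lemma pow_frattini: "x \<in> N 0 \<Longrightarrow> x [^] p \<in> frattini"
  unfolding frattini_def by (rule generate.incl) blast

lemma comm_frattini: "x \<in> N 0 \<Longrightarrow> y \<in> N 0 \<Longrightarrow> cm x y \<in> frattini"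
  unfolding frattini_def by (rule generate.incl) blast

lemma frattini_subset_N_1: "frattini \<subseteq> N 1"
  using N_pow_sub[of _ 0] N_comm[of _ 0] N_carrier by (intro frattini_subset N_subgroup) auto

lemma card_N_0_frattini:
  assumes "N 0 = generate G {u, v}" "u \<in> carrier G" "v \<in> carrier G"
  shows "card (N 0) \<le> p * (p * card frattini)"
proof -
  have fin: "finite frattini" using finite_subset_carrier frattini_subgroup by blast
  have uv: "u \<in> N 0" "v \<in> N 0" unfolding assms(1) by (auto intro: generate.incl)
  define f where "f = (\<lambda>(i::nat, j::nat). u [^] i \<otimes> v [^] j)"
  have "card (N 0) \<le> card ({..<p} \<times> {..<p}) * card frattini"
  proof (rule card_le_cosets[OF frattini_normal fin, where f = f])
    fix x assume x: "x \<in> N 0"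
    then obtain i j :: int where ij: "frattini #> x = frattini #> (u [^] i \<otimes> v [^] j)"
      using two_generator_cosets[OF frattini_normal assms(2,3)] comm_frattini unfolding assms(1) by blast
    have p0: "p > 0" using prime_gt_0_nat[OF prime_p] .
    have "frattini #> x = frattini #> (u [^] nat (i mod int p) \<otimes> v [^] nat (j mod int p))"
      unfolding ij using pow_mod_coset[OF frattini_normal] pow_frattini uv assms(2,3) p0
      by (intro coset_mult[OF frattini_normal]) auto
    then have "frattini #> x = frattini #> f (nat (i mod int p), nat (j mod int p))" by (simp add: f_def)
    moreover have "(nat (i mod int p), nat (j mod int p)) \<in> {..<p} \<times> {..<p}"
      using p0 by (simp add: nat_less_iff)
    moreover have "f (nat (i mod int p), nat (j mod int p)) \<in> carrier G" using assms by (simp add: f_def)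
    ultimately show "x \<in> carrier G \<and> (\<exists>i\<in>{..<p} \<times> {..<p}. f i \<in> carrier G \<and> frattini #> x = frattini #> f i)"
      using N_carrier[OF x] by blast
  qed auto
  then show ?thesis by (simp add: mult.assoc)
qed

text \<open>Modulo \<open>N (e + 1)\<close> only the \<open>p\<close>-th powers among the generators
  of \<open>frattini\<close> survive.\<close>

lemma frattini_pth_power:
  assumes "\<And>x y. x \<in> N 0 \<Longrightarrow> y \<in> N 0 \<Longrightarrow> cm x y \<in> N (e + 1)" and x: "x \<in> frattini"
  shows "pth_power 0 x"
proof -
  have "frattini \<subseteq> Collect (pth_power 0)"
  proof (rule frattini_subset[OF pth_power_subgroup])
    fix x y assume xy: "x \<in> N 0" "y \<in> N 0"
    have c: "cm x y \<in> carrier G" using N_carrier[OF xy(1)] N_carrier[OF xy(2)] by simp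
    have "N (0 + e + 1) #> cm x y = N (0 + e + 1) #> (\<one> [^] p)"
      using N_coset_one_iff[OF c] assms(1)[OF xy] by simp
    then show "cm x y \<in> Collect (pth_power 0)"
      unfolding pth_power_def using c N_one by blast
  qed (use pth_power_pow in auto)
  then show ?thesis using x by blast
qed

text \<open>Commutators \<open>[x, g]\<close> lie in \<open>frattini\<close> and are thus
  \<open>p\<close>-th powers modulo \<open>N 2\<close>, which is the start that
  \<open>pth_power_chain\<close> asks for with \<open>e = 1\<close>.\<close>

lemma slice_onto_two_generator_central:
  assumes "N 0 = generate G {u, v}" "u \<in> carrier G" "v \<in> carrier G" "N 0 \<noteq> {\<one>}" "odd p" "e = 1"
    and "\<And>x g. x \<in> N 0 \<Longrightarrow> g \<in> carrier G \<Longrightarrow> cm x g \<in> frattini"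
  shows slice_onto
proof (rule slice_onto_central[OF N_0_not_subset[OF assms(4)] assms(6,5)])
  have "card frattini \<le> card (N 1)"
    using card_mono[OF finite_subset_carrier[OF N_subgroup] frattini_subset_N_1] .
  then show "card (N 0) \<le> p * (p * card (N 1))"
    using card_N_0_frattini[OF assms(1-3)] by (meson le_trans mult_le_mono2)
  fix x g assume "x \<in> N 0" "g \<in> carrier G"
  then show "pth_power 0 (cm x g)"
    using frattini_pth_power comm_N_N[of _ 0 _ 0] assms(6,7) by simp
qed

text \<open>\<open>frattini\<close> has index at most \<open>p^2\<close> in \<open>N 0\<close>, and
  both inclusions \<open>frattini < N 1 < N 0\<close> are strict, so each has index
  \<open>p\<close>. This leaves no room between \<open>frattini\<close> and \<open>N 1\<close> and
  forces \<open>N 2\<close> to be \<open>frattini\<close>.\<close>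

lemma slice_onto_two_generator_split:
  assumes "N 0 = generate G {u, v}" "u \<in> carrier G" "v \<in> carrier G" and ne: "N 0 \<noteq> {\<one>}" and e2: "e = 2"
    and moved: "x0 \<in> N 0" "g0 \<in> carrier G" "cm x0 g0 \<notin> frattini"
  shows slice_onto
proof -
  have p0: "p > 1" using prime_gt_1_nat[OF prime_p] .
  have F1: "frattini \<subset> N 1" using frattini_subset_N_1 N_comm[OF moved(1,2)] moved(3) by auto
  have N10: "N 1 \<subset> N 0" using N_0_not_subset[OF ne] N_desc[of 0] by auto
  have c1: "p * card frattini \<le> card (N 1)" using card_subgroup_less[OF frattini_subgroup N_subgroup F1] .
  have c0: "p * card (N 1) \<le> card (N 0)" using card_subgroup_less[OF N_subgroup N_subgroup N10] .
  have c2: "card (N 0) \<le> p * (p * card frattini)" using card_N_0_frattini[OF assms(1-3)] .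
  have c3: "card (N 1) \<le> p * card frattini"
  proof -
    have "p * card (N 1) \<le> p * (p * card frattini)" using c0 c2 by (rule le_trans)
    then show ?thesis using p0 by (metis nat_mult_le_cancel1 prime_gt_0_nat prime_p)
  qed
  have c4: "card (N 0) \<le> p * card (N 1)" using c2 mult_le_mono2[OF c1, of p] by (rule le_trans)
  have N2: "N 2 = frattini"
  proof
    obtain L where L: "L \<lhd> G" "frattini \<subseteq> L" "L \<subset> N 1"
      "\<And>x g. x \<in> N 1 \<Longrightarrow> g \<in> carrier G \<Longrightarrow> cm x g \<in> L"
      using frattini_like[OF N_normal frattini_normal F1] by metis
    have Ls: "subgroup L G" using normal_imp_subgroup[OF L(1)] .
    have "\<not> frattini \<subset> L"
    proof
      assume "frattini \<subset> L"
      then have "p * card frattini \<le> card L" using card_subgroup_less[OF frattini_subgroup Ls] by blast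
      moreover have "p * card L \<le> card (N 1)" using card_subgroup_less[OF Ls N_subgroup L(3)] .
      ultimately have "p * card L \<le> card L" using c3 by linarith
      moreover have "card L > 0" using finite_subset_carrier[OF Ls] subgroup.one_closed[OF Ls] card_gt_0_iff by blast
      ultimately show False using p0 by simp
    qed
    then have LF: "L = frattini" using L(2) by blast
    have "N (Suc 1) \<subseteq> frattini" unfolding N_Suc
      using L(4) LF pow_frattini e2 by (intro generate_subgroup_incl frattini_subgroup) auto
    then show "N 2 \<subseteq> frattini" by (simp add: numeral_2_eq_2)
    show "frattini \<subseteq> N 2"
      using comm_N_N[of _ 0 _ 0] chain_pow[of _ 0] e2 by (intro frattini_subset N_subgroup) (auto simp: numeral_2_eq_2)
  qed
  obtain w where w: "w \<in> N 0" "w \<notin> N 1" using N10 by blast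
  have wc: "w \<in> carrier G" using w N_carrier by blast
  have cyc: "n \<in> cyclic_over (N 1) w" if "n \<in> N 0" for n
    using prime_index_generator[OF N_normal N_subgroup _ c4 w that] N10 by blast
  \<comment> \<open>One layer better than \<open>comm_N_N\<close>: \<open>N 0\<close> is cyclic over
    \<open>N 1\<close>, powers of \<open>w\<close> commute with each other, and what remains are
    commutators of \<open>N 1\<close> with \<open>N 0\<close>.\<close>
  have deep3: "cm x y \<in> N 3" if xy: "x \<in> N 0" "y \<in> N 0" for x y
  proof -
    have dec: "\<exists>i::nat. \<exists>c\<in>N 1. n = w [^] i \<otimes> c" if n: "n \<in> N 0" for n
    proof -
      obtain i :: nat where i: "N 1 #> n = N 1 #> (w [^] i)" using cyc[OF n] unfolding cyclic_over_def by blast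
      then show ?thesis using N_coset_eq_iff[of n "w [^] i" 1] N_carrier[OF n] wc by auto
    qed
    obtain i j :: nat and c d where x: "c \<in> N 1" "x = w [^] i \<otimes> c" and y: "d \<in> N 1" "y = w [^] j \<otimes> d"
      using dec[OF xy(1)] dec[OF xy(2)] by blast
    have wN: "w [^] k \<in> N 0" for k :: nat using subgroup_pow_mem[OF N_subgroup w(1)] .
    have cc: "c \<in> carrier G" "d \<in> carrier G" "x \<in> carrier G" "w [^] k \<in> carrier G" for k :: nat
      using x y xy N_carrier wc by auto
    have 3: "cm z n \<in> N 3" "cm n z \<in> N 3" if "z \<in> N 1" "n \<in> N 0" for z n
    proof -
      show zn: "cm z n \<in> N 3" using comm_N_N[OF that] by (simp add: eval_nat_numeral)
      show "cm n z \<in> N 3" using zn inv_comm N_inv[OF zn] N_carrier that by metis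
    qed
    have ww: "cm (w [^] i) (w [^] j) = \<one>"
      using comm_eq_one_iff wc by (simp add: nat_pow_mult add.commute)
    have "cm x (w [^] j) = cm (w [^] i) (w [^] j) \<otimes> cm (cm (w [^] i) (w [^] j)) c \<otimes> cm c (w [^] j)"
      unfolding x(2) using comm_mult_left cc by blast
    then have 4: "cm x (w [^] j) \<in> N 3" using ww 3(1)[OF x(1) wN] cc by simp
    have "cm x y = cm x d \<otimes> cm x (w [^] j) \<otimes> cm (cm x (w [^] j)) d"
      unfolding y(2) using comm_mult_right cc by blast
    moreover have "cm (cm x (w [^] j)) d \<in> N 3" using comm_in_normal_left[OF N_normal 4 cc(2)] .
    ultimately show ?thesis using 3(2)[OF y(1) xy(1)] 4 N_mult by metis
  qed
  show ?thesis
  proof (rule slice_onto_split[OF N_0_not_subset[OF ne] c4])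
    show "card (N 1) \<le> p * card (N 2)" using c3 N2 by simp
    show "centr \<noteq> carrier G" using moved N2 by (auto simp: centr_def)
    fix x g assume "x \<in> N (e - 1)" "g \<in> carrier G"
    then have "cm x g \<in> frattini" using N_comm[of x 1 g] e2 N2 by (simp add: numeral_2_eq_2)
    then show "pth_power 0 (cm x g)" using frattini_pth_power deep3 e2 by simp
  qed
qed

text \<open>Here \<open>N 1\<close> consists of the powers of \<open>u^p\<close>, since a power
  \<open>u^i\<close> in \<open>N 1\<close> with \<open>i\<close> prime to \<open>p\<close> would
  bring \<open>u\<close> into \<open>N 1\<close> by Bezout. So commutators \<open>[x, g]\<close> are
  exact \<open>p\<close>-th powers and the first two layers have order at most \<open>p\<close>,
  whatever the prime.\<close>

lemma slice_onto_cyclic: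
  assumes gen: "N 0 = generate G {u}" and u: "u \<in> carrier G" and ne: "N 0 \<noteq> {\<one>}" and e1: "e = 1"
  shows slice_onto
proof -
  have uN: "u \<in> N 0" unfolding gen by (auto intro: generate.incl)
  have pw: "\<exists>i::int. x = u [^] i" if "x \<in> N 0" for x using that generate_pow[OF u] gen by auto
  have p0: "p > 0" using prime_gt_0_nat[OF prime_p] .
  have up: "u [^] p \<in> N 1" using chain_pow[OF uN] e1 by simp
  have upp: "(u [^] p) [^] p \<in> N 2" using chain_pow[OF up] e1 by (simp add: numeral_2_eq_2)
  have N1: "\<exists>j::int. x = (u [^] p) [^] j" if x: "x \<in> N 1" for x
  proof -
    obtain i :: int where i: "x = u [^] i" using pw x N_desc[of 0] by auto
    have "int p dvd i"
    proof (rule ccontr)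
      assume "\<not> int p dvd i"
      then have "coprime (int p) i" using prime_p by (simp add: prime_imp_coprime)
      then obtain s t where st: "s * int p + t * i = 1" using bezout_int[of "int p" i] by auto
      have "u = u [^] (s * int p + t * i)" using st u by simp
      also have "\<dots> = (u [^] p) [^] s \<otimes> x [^] t"
        using u i by (simp add: int_pow_mult int_pow_pow mult.commute flip: int_pow_int)
      also have "\<dots> \<in> N 1"
        using subgroup_int_pow_closed[OF N_subgroup] up x N_mult by blast
      finally have "N 0 \<subseteq> N 1" unfolding gen by (intro generate_subgroup_incl N_subgroup) simp
      then show False using N_0_not_subset[OF ne] by blast
    qed
    then obtain j where "i = int p * j" by blast
    then show ?thesis using i u by (auto simp: int_pow_pow simp flip: int_pow_int)
  qed
  have idx: "card M \<le> p * card L"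
    if L: "L \<lhd> G" and w: "w \<in> carrier G" "w [^] p \<in> L" and M: "\<And>x. x \<in> M \<Longrightarrow> \<exists>i::int. x = w [^] i" for L M w
  proof -
    have "card M \<le> card {..<p} * card L"
    proof (rule card_le_cosets[OF L finite_subset_carrier[OF normal_imp_subgroup[OF L]], where f = "\<lambda>i. w [^] i"])
      fix x assume "x \<in> M"
      then obtain i :: int where i: "x = w [^] i" using M by blast
      have "nat (i mod int p) \<in> {..<p}" using p0 by (simp add: nat_less_iff)
      moreover have "L #> x = L #> (w [^] nat (i mod int p))" unfolding i using pow_mod_coset[OF L w p0] .
      ultimately show "x \<in> carrier G \<and> (\<exists>i\<in>{..<p}. w [^] i \<in> carrier G \<and> L #> x = L #> (w [^] i))"
        using i w(1) by blast
    qed auto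
    then show ?thesis by simp
  qed
  show ?thesis
  proof (rule slice_onto_split[OF N_0_not_subset[OF ne]])
    show "card (N 0) \<le> p * card (N 1)" using idx[OF N_normal u up pw] .
    show "card (N 1) \<le> p * card (N 2)" using idx[OF N_normal _ upp N1] u by simp
    show "centr \<noteq> carrier G" if "e = 2" using e1 that by simp
    fix x g assume "x \<in> N (e - 1)" "g \<in> carrier G"
    then have "cm x g \<in> N 1" using N_comm[of x 0] e1 by simp
    then obtain j :: int where "cm x g = (u [^] p) [^] j" using N1 by blast
    also have "\<dots> = (u [^] j) [^] p" using u by (simp add: int_pow_pow mult.commute flip: int_pow_int)
    finally show "pth_power 0 (cm x g)" using pth_power_pow subgroup_int_pow_closed[OF N_subgroup uN] by simp
  qed
qed

end

context finite_p_group
begin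

lemma lower_chain_vchain:
  assumes "r \<ge> 2" "e = 1 \<or> e = 2 \<and> odd p"
  shows "lower_chain G (vchain G p e (gamma r)) p e a r"
  using assms prime_p gamma_normal gamma_comm
  by (intro lower_chain.intro verbal_chain.intro verbal_chain_axioms.intro lower_chain_axioms.intro
      is_group finite_p_group_axioms) (auto simp: gamma_def)

theorem gamma_slice:
  assumes r: "r \<ge> 2"
    and gens: "(\<exists>u\<in>carrier G. gamma r = generate G {u}) \<or>
      odd p \<and> (\<exists>u\<in>carrier G. \<exists>v\<in>carrier G. gamma r = generate G {u, v})"
  shows "\<exists>bs ys. length bs + 1 + length ys = r \<and> set bs \<subseteq> carrier G \<and> set ys \<subseteq> carrier G \<and>
     (\<forall>n\<in>gamma r. \<exists>g\<in>carrier G. lnc (bs @ [g] @ ys) = n)"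
proof (cases "gamma r = {\<one>}")
  case True
  define bs where "bs = replicate (r - 1) \<one>"
  have "bs \<noteq> []" using r bs_def by simp
  moreover have bs: "set bs \<subseteq> carrier G" "length bs = r - 1" by (auto simp: bs_def)
  ultimately have "lnc (bs @ [\<one>] @ []) = \<one>" using lnc_append[of bs "[\<one>]"] by simp
  then show ?thesis using True r bs by (intro exI[of _ bs] exI[of _ "[]"]) auto
next
  case False
  interpret C1: lower_chain G "vchain G p 1 (gamma r)" p 1 a r
    using lower_chain_vchain[OF r] by blast
  have N0: "vchain G p e (gamma r) 0 = gamma r" for e by simp
  \<comment> \<open>The second alternative keeps \<open>odd p\<close>, which the chain with
    \<open>e = 2\<close> needs when it is interpreted again outside the case distinction.\<close>
  have "C1.slice_onto \<or> odd p \<and> lower_chain.slice_onto G (vchain G p 2 (gamma r)) r"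
  proof (cases "\<exists>u\<in>carrier G. gamma r = generate G {u}")
    case True
    then obtain u where "u \<in> carrier G" "gamma r = generate G {u}" by blast
    then show ?thesis using C1.slice_onto_cyclic[of u] False by simp
  next
    case nc: False
    then obtain u v where uv: "u \<in> carrier G" "v \<in> carrier G" "gamma r = generate G {u, v}" and odd: "odd p"
      using gens by blast
    interpret C2: lower_chain G "vchain G p 2 (gamma r)" p 2 a r
      using lower_chain_vchain[OF r] odd by blast
    have F: "C1.frattini = C2.frattini" unfolding C1.frattini_def C2.frattini_def by simp
    show ?thesis
    proof (cases "\<forall>x\<in>gamma r. \<forall>g\<in>carrier G. cm x g \<in> C1.frattini")
      case True
      then have "C1.slice_onto"
        using C1.slice_onto_two_generator_central[of u v] uv False odd by simp
      then show ?thesis by blast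
    next
      case False
      then obtain x g where "x \<in> gamma r" "g \<in> carrier G" "cm x g \<notin> C2.frattini" using F by auto
      then have "C2.slice_onto"
        using C2.slice_onto_two_generator_split[of u v x g] uv \<open>gamma r \<noteq> {\<one>}\<close> by simp
      then show ?thesis using odd by blast
    qed
  qed
  then show ?thesis
  proof
    assume "C1.slice_onto" then show ?thesis unfolding C1.slice_onto_def N0 .
  next
    assume h: "odd p \<and> lower_chain.slice_onto G (vchain G p 2 (gamma r)) r"
    interpret C2: lower_chain G "vchain G p 2 (gamma r)" p 2 a r
      using lower_chain_vchain[OF r] h by blast
    from h show ?thesis unfolding C2.slice_onto_def N0 by blast
  qed
qed

end

section \<open>Profinite groups\<close>

context topological_group
begin

lemma continuous_mult_fun:
  "continuous_map S T f \<Longrightarrow> continuous_map S T g \<Longrightarrow> continuous_map S T (\<lambda>x. f x \<otimes> g x)"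
  using continuous_map_compose[OF continuous_map_pairedI continuous_mult, of S f g] by (simp add: o_def)

lemma continuous_inv_fun: "continuous_map S T f \<Longrightarrow> continuous_map S T (\<lambda>x. inv (f x))"
  using continuous_map_compose[OF _ continuous_inv, of S f] by (simp add: o_def)

lemma continuous_comm_fun:
  "continuous_map S T f \<Longrightarrow> continuous_map S T g \<Longrightarrow> continuous_map S T (\<lambda>x. cm (f x) (g x))"
  unfolding commutator_def by (intro continuous_mult_fun continuous_inv_fun)

text \<open>The entries are functions of \<open>g\<close>, in the application constant or the
  identity, so one induction serves all slice positions.\<close>

lemma continuous_lnc:
  assumes "\<And>h. h \<in> set hs \<Longrightarrow> continuous_map T T h"
  shows "continuous_map T T (\<lambda>g. lnc (map (\<lambda>h. h g) hs))"
proof (cases hs)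
  case Nil then show ?thesis by (simp add: topspace_eq)
next
  case (Cons k ks)
  have "continuous_map T T (\<lambda>g. foldl cm (k g) (map (\<lambda>h. h g) ks))"
    if "continuous_map T T k" "\<And>h. h \<in> set ks \<Longrightarrow> continuous_map T T h" for k and ks :: "('a \<Rightarrow> 'a) list"
    using that
  proof (induction ks arbitrary: k)
    case (Cons h ks)
    have "continuous_map T T (\<lambda>g. cm (k g) (h g))" using Cons by (intro continuous_comm_fun) auto
    from Cons.IH[OF this] show ?case using Cons.prems by simp
  qed simp
  then show ?thesis using assms Cons by simp
qed

lemma open_right_translate:
  assumes "openin T U" "a \<in> carrier G"
  shows "openin T {x \<in> carrier G. x \<otimes> a \<in> U}"
proof -
  have "continuous_map T T (\<lambda>x. x \<otimes> a)"
    using assms by (intro continuous_mult_fun) (auto simp: topspace_eq)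
  from openin_continuous_map_preimage[OF this assms(1)] show ?thesis by (simp add: topspace_eq)
qed

lemma open_coset:
  assumes "openin T H" "a \<in> carrier G"
  shows "openin T (H #> a)"
proof -
  have s: "H \<subseteq> carrier G" using assms openin_subset topspace_eq by blast
  have "H #> a = {x \<in> carrier G. x \<otimes> inv a \<in> H}"
  proof
    show "H #> a \<subseteq> {x \<in> carrier G. x \<otimes> inv a \<in> H}"
      using s assms(2) by (auto simp: r_coset_def m_assoc)
    show "{x \<in> carrier G. x \<otimes> inv a \<in> H} \<subseteq> H #> a"
      using assms(2) unfolding r_coset_def by (auto simp: m_assoc intro!: bexI[of _ "_ \<otimes> inv a"])
  qed
  then show ?thesis using open_right_translate[OF assms(1), of "inv a"] assms by simp
qed

text \<open>The coset of \<open>x\<close> is an open neighbourhood of \<open>x\<close> and so meets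
  \<open>A\<close>. Closures are thus invisible modulo open normal subgroups.\<close>

lemma closure_subset_cosets:
  assumes K: "K \<lhd> G" "openin T K" and x: "x \<in> T closure_of A" and A: "A \<subseteq> carrier G"
  shows "\<exists>a\<in>A. K #> x = K #> a"
proof -
  have xc: "x \<in> carrier G" using x in_closure_of topspace_eq by metis
  have "x \<in> K #> x" using rcos_self[OF xc normal_imp_subgroup[OF K(1)]] .
  then obtain a where a: "a \<in> A" "a \<in> K #> x"
    using x open_coset[OF K(2) xc] unfolding in_closure_of by blast
  then show ?thesis using repr_independence[OF a(2) xc normal_imp_subgroup[OF K(1)]] by blast
qed

end

context profinite_group
begin

text \<open>The cosets are a disjoint open cover, so a finite subcover contains them all.\<close>

lemma open_subgroup_finite_index:
  assumes H: "subgroup H G" "openin T H"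
  shows "finite (rcosets H)"
proof -
  have "\<forall>U\<in>rcosets H. openin T U" using open_coset[OF H(2)] by (auto simp: RCOSETS_def)
  moreover have "\<Union>(rcosets H) = topspace T" using rcosets_part_G[OF H(1)] topspace_eq by simp
  ultimately obtain F where F: "finite F" "F \<subseteq> rcosets H" "\<Union>F = topspace T"
    using compact[unfolded compact_space, rule_format, of "rcosets H"] by auto
  have "rcosets H \<subseteq> F"
  proof
    fix C assume C: "C \<in> rcosets H"
    then obtain a where a: "a \<in> carrier G" "C = H #> a" by (auto simp: RCOSETS_def)
    then obtain D where D: "D \<in> F" "a \<in> D" using F(3) topspace_eq by blast
    then obtain b where b: "b \<in> carrier G" "D = H #> b" using F(2) by (auto simp: RCOSETS_def)
    have "H #> b = H #> a" using repr_independence[OF _ b(1) H(1)] D b by blast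
    then show "C \<in> F" using a b D by simp
  qed
  then show ?thesis by (rule finite_subset[OF _ F(1)])
qed

text \<open>The intersection of the conjugates of \<open>H\<close>. A conjugate depends only on the
  coset of the conjugating element, so the intersection is finite and hence open.\<close>

lemma open_normal_core:
  assumes H: "subgroup H G" "openin T H"
  obtains K where "K \<lhd> G" "openin T K" "K \<subseteq> H"
proof -
  interpret H: subgroup H G by fact
  define S where "S g = {x \<in> carrier G. g \<otimes> x \<otimes> inv g \<in> H}" for g
  define rep where "rep C = (SOME g. g \<in> carrier G \<and> C = H #> g)" for C
  have rep: "rep C \<in> carrier G \<and> C = H #> rep C" if "C \<in> rcosets H" for C
    unfolding rep_def by (rule someI_ex) (use that in \<open>auto simp: RCOSETS_def\<close>)
  define K where "K = (\<Inter>C\<in>rcosets H. S (rep C))"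
  have S_open: "openin T (S g)" if g: "g \<in> carrier G" for g
  proof -
    have "continuous_map T T (\<lambda>x. g \<otimes> x \<otimes> inv g)"
      using g by (intro continuous_mult_fun) (auto simp: topspace_eq)
    from openin_continuous_map_preimage[OF this H(2)] show ?thesis by (simp add: S_def topspace_eq)
  qed
  have S_coset: "S g \<subseteq> S h" if gh: "g \<in> carrier G" "h \<in> carrier G" "H #> g = H #> h" for g h
  proof
    fix x assume x: "x \<in> S g"
    have "h \<in> H #> g" using rcos_self[OF gh(2) H(1)] gh by simp
    then obtain k where k: "k \<in> H" "h = k \<otimes> g" by (auto simp: r_coset_def)
    have "h \<otimes> x \<otimes> inv h = k \<otimes> (g \<otimes> x \<otimes> inv g) \<otimes> inv k"
      using k x gh H.subset by (simp add: S_def inv_mult_group m_assoc subset_iff)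
    then show "x \<in> S h" using k x gh by (simp add: S_def)
  qed
  have ne: "rcosets H \<noteq> {}" using H.rcosets_carrier rcosetsI[OF H.subset one_closed] by blast
  have K_iff: "x \<in> K \<longleftrightarrow> x \<in> carrier G \<and> (\<forall>g\<in>carrier G. g \<otimes> x \<otimes> inv g \<in> H)" for x
  proof
    assume x: "x \<in> K"
    have "x \<in> S g" if g: "g \<in> carrier G" for g
    proof -
      have C: "H #> g \<in> rcosets H" using rcosetsI[OF H.subset g] .
      then have "x \<in> S (rep (H #> g))" using x K_def by blast
      then show ?thesis using S_coset[of "rep (H #> g)" g] rep[OF C] g by blast
    qed
    then show "x \<in> carrier G \<and> (\<forall>g\<in>carrier G. g \<otimes> x \<otimes> inv g \<in> H)" using one_closed by (auto simp: S_def)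
  next
    assume "x \<in> carrier G \<and> (\<forall>g\<in>carrier G. g \<otimes> x \<otimes> inv g \<in> H)"
    then show "x \<in> K" using rep by (auto simp: K_def S_def)
  qed
  have "subgroup K G"
  proof
    show "K \<subseteq> carrier G" using K_iff by blast
    show "\<one> \<in> K" unfolding K_iff by simp
  next
    fix x y assume xy: "x \<in> K" "y \<in> K"
    show "x \<otimes> y \<in> K" unfolding K_iff
    proof (intro conjI ballI)
      fix g assume g: "g \<in> carrier G"
      have "g \<otimes> (x \<otimes> y) \<otimes> inv g = (g \<otimes> x \<otimes> inv g) \<otimes> (g \<otimes> y \<otimes> inv g)"
        using g xy K_iff by (simp add: m_assoc)
      then show "g \<otimes> (x \<otimes> y) \<otimes> inv g \<in> H" using g xy K_iff by simp
    qed (use xy K_iff in simp)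
  next
    fix x assume x: "x \<in> K"
    show "inv x \<in> K" unfolding K_iff
    proof (intro conjI ballI)
      fix g assume g: "g \<in> carrier G"
      have "g \<otimes> inv x \<otimes> inv g = inv (g \<otimes> x \<otimes> inv g)"
        using g x K_iff by (simp add: m_assoc inv_mult_group)
      then show "g \<otimes> inv x \<otimes> inv g \<in> H" using g x K_iff by simp
    qed (use x K_iff in simp)
  qed
  moreover have "h \<otimes> x \<otimes> inv h \<in> K" if h: "h \<in> carrier G" and x: "x \<in> K" for h x
    unfolding K_iff
  proof (intro conjI ballI)
    fix g assume g: "g \<in> carrier G"
    have "g \<otimes> (h \<otimes> x \<otimes> inv h) \<otimes> inv g = (g \<otimes> h) \<otimes> x \<otimes> inv (g \<otimes> h)"
      using g h x K_iff by (simp add: m_assoc inv_mult_group)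
    then show "g \<otimes> (h \<otimes> x \<otimes> inv h) \<otimes> inv g \<in> H" using g h x K_iff by simp
  qed (use h x K_iff in simp)
  ultimately have "K \<lhd> G" unfolding normal_inv_iff by blast
  moreover have "openin T K" unfolding K_def
    using open_subgroup_finite_index[OF H] ne rep S_open by (intro openin_Inter) auto
  moreover have "K \<subseteq> H"
  proof
    fix x assume "x \<in> K"
    then have "x \<in> carrier G" "\<one> \<otimes> x \<otimes> inv \<one> \<in> H" unfolding K_iff by blast+
    then show "x \<in> H" by simp
  qed
  ultimately show thesis using that by blast
qed

lemma open_normal_translate:
  assumes "openin T U" "n \<in> U"
  obtains K where "K \<lhd> G" "openin T K" "K #> n \<subseteq> U"
proof -
  have n: "n \<in> carrier G" using assms openin_subset topspace_eq by blast
  obtain H where H: "subgroup H G" "openin T H" "H \<subseteq> {x \<in> carrier G. x \<otimes> n \<in> U}"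
    using open_subgroup_base[OF open_right_translate[OF assms(1) n]] n assms by auto
  obtain K where K: "K \<lhd> G" "openin T K" "K \<subseteq> H" using open_normal_core[OF H(1,2)] by blast
  then have "K #> n \<subseteq> U" using H(3) by (auto simp: r_coset_def)
  then show thesis using that K by blast
qed

end

section \<open>Commutators and lower central subgroups in quotients\<close>

lemma (in group_hom) hom_lnc:
  assumes "set xs \<subseteq> carrier G"
  shows "h (left_normed_commutator G xs) = left_normed_commutator H (map h xs)"
proof -
  have "h (foldl (commutator G) x ys) = foldl (commutator H) (h x) (map h ys)"
    if "x \<in> carrier G" "set ys \<subseteq> carrier G" for x ys
    using that by (induction ys arbitrary: x) (simp_all add: hom_commutator G.comm_closed)
  then show ?thesis using assms by (cases xs) auto
qed

context group
begin

lemma lnc_image: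
  assumes K: "K \<lhd> G" and zs: "set zs \<subseteq> carrier (G Mod K)"
  obtains xs where "set xs \<subseteq> carrier G" "map (\<lambda>x. K #> x) xs = zs"
proof -
  have "zs \<in> lists ((\<lambda>x. K #> x) ` carrier G)" using zs by (auto simp: carrier_FactGroup)
  then show thesis using that by (auto simp: lists_image)
qed

lemma gamma_quotient:
  assumes K: "K \<lhd> G"
  shows "group.gamma (G Mod K) r = (\<lambda>x. K #> x) ` gamma r"
proof -
  interpret h: group_hom G "G Mod K" "\<lambda>x. K #> x" by (rule group_hom_coset) fact
  have "{left_normed_commutator (G Mod K) zs | zs. length zs = r \<and> set zs \<subseteq> carrier (G Mod K)} =
    (\<lambda>x. K #> x) ` {lnc xs | xs. length xs = r \<and> set xs \<subseteq> carrier G}" (is "?A = ?B")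
  proof
    show "?A \<subseteq> ?B"
    proof
      fix z assume "z \<in> ?A"
      then obtain zs where zs: "z = left_normed_commutator (G Mod K) zs" "length zs = r" "set zs \<subseteq> carrier (G Mod K)"
        by blast
      obtain xs where xs: "set xs \<subseteq> carrier G" "map (\<lambda>x. K #> x) xs = zs" using lnc_image[OF K zs(3)] by blast
      then have "z = K #> lnc xs" "length xs = r" using zs h.hom_lnc[OF xs(1)] by auto
      then show "z \<in> ?B" using xs by blast
    qed
    show "?B \<subseteq> ?A"
    proof
      fix z assume "z \<in> ?B"
      then obtain xs where xs: "z = K #> lnc xs" "length xs = r" "set xs \<subseteq> carrier G" by blast
      then have "z = left_normed_commutator (G Mod K) (map (\<lambda>x. K #> x) xs)" using h.hom_lnc[OF xs(3)] by simp
      moreover have "length (map (\<lambda>x. K #> x) xs) = r" "set (map (\<lambda>x. K #> x) xs) \<subseteq> carrier (G Mod K)"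
        using xs h.hom_closed by auto
      ultimately show "z \<in> ?A" by blast
    qed
  qed
  moreover have "{lnc xs | xs. length xs = r \<and> set xs \<subseteq> carrier G} \<subseteq> carrier G" by auto
  ultimately show ?thesis unfolding gamma_def h.H.gamma_def using h.generate_img by simp
qed

end

section \<open>Compactness: from finite quotients to the pro-p group\<close>

context pro_p_group
begin

abbreviation "lcl \<equiv> lower_central G T"

lemma lower_central_eq: "lcl r = T closure_of (gamma r)"
  by (simp add: lower_central_def gamma_def)

lemma gamma_carrier: "gamma r \<subseteq> carrier G"
  using normal_imp_subgroup[OF gamma_normal] subgroup.subset by blast

lemma gamma_subset: "gamma r \<subseteq> lcl r"
  unfolding lower_central_eq using closure_of_subset gamma_carrier topspace_eq by metis

lemma lower_central_carrier: "lcl r \<subseteq> carrier G"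
  unfolding lower_central_eq using closure_of_subset_topspace topspace_eq by metis

text \<open>The entries form a function rather than two lists, so that tuples are points of one
  product space for all \<open>j\<close>; the entry at \<open>j\<close> is overwritten by
  \<open>g\<close>.\<close>

definition good :: "nat \<Rightarrow> 'a set \<Rightarrow> nat \<Rightarrow> (nat \<Rightarrow> 'a) \<Rightarrow> bool" where
  "good r K j f \<longleftrightarrow> (\<forall>n\<in>lcl r. \<exists>g\<in>carrier G. K #> lnc (map (f(j := g)) [0..<r]) = K #> n)"

text \<open>Modulo the open \<open>K\<close> closures disappear: \<open>gamma r\<close> and the
  subgroup generated by the topological generators have the same image, so the result on finite
  \<open>p\<close>-groups applies to \<open>G Mod K\<close>.\<close>

lemma slice_mod:
  assumes p: "Factorial_Ring.prime p" and r: "r \<ge> 2" and K: "K \<lhd> G" "openin T K"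
    and gens: "procyclic G T (lcl r) \<or> odd p \<and> (\<exists>a b. topologically_generates G T {a, b} (lcl r))"
  shows "\<exists>j<r. \<exists>f\<in>PiE {..<r} (\<lambda>_. carrier G). good r K j f"
proof -
  interpret h: group_hom G "G Mod K" "\<lambda>x. K #> x" by (rule group_hom_coset) fact
  obtain c where c: "card (rcosets K) = p ^ c" using index_open_normal[OF K] by blast
  then have "order (G Mod K) = p ^ c" by (simp add: order_def FactGroup_def)
  then interpret Q: finite_p_group "G Mod K" p c
    using p by (intro finite_p_group.intro finite_p_group_axioms.intro h.H.is_group)
  have img: "group.gamma (G Mod K) r = generate (G Mod K) ((\<lambda>x. K #> x) ` S)"
    if S: "topologically_generates G T S (lcl r)" for S
  proof -
    have Sc: "S \<subseteq> carrier G" using S lower_central_carrier by (auto simp: topologically_generates_def)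
    have SL: "generate G S \<subseteq> lcl r" "lcl r \<subseteq> T closure_of generate G S"
    proof -
      have "generate G S \<subseteq> T closure_of generate G S"
        using generate_in_carrier[OF Sc] by (intro closure_of_subset) (auto simp: topspace_eq)
      then show "generate G S \<subseteq> lcl r" "lcl r \<subseteq> T closure_of generate G S"
        using S unfolding topologically_generates_def by blast+
    qed
    have sub: "\<exists>y\<in>B. K #> x = K #> y" if "A \<subseteq> T closure_of B" "B \<subseteq> carrier G" "x \<in> A" for A B x
      using closure_subset_cosets[OF K _ that(2)] that by blast
    have gS: "generate G S \<subseteq> carrier G" using generate_in_carrier[OF Sc] by blast
    have "(\<lambda>x. K #> x) ` gamma r = (\<lambda>x. K #> x) ` generate G S"
    proof
      show "(\<lambda>x. K #> x) ` gamma r \<subseteq> (\<lambda>x. K #> x) ` generate G S"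
        using sub[of "gamma r" "generate G S"] gamma_subset SL(2) gS by blast
      show "(\<lambda>x. K #> x) ` generate G S \<subseteq> (\<lambda>x. K #> x) ` gamma r"
        using sub[of "generate G S" "gamma r"] SL(1) gamma_carrier unfolding lower_central_eq by blast
    qed
    then show ?thesis using gamma_quotient[OF K(1)] h.generate_img[OF Sc] by simp
  qed
  have gen_in: "S \<subseteq> carrier G" if "topologically_generates G T S (lcl r)" for S
    using that lower_central_carrier by (auto simp: topologically_generates_def)
  have "(\<exists>u\<in>carrier (G Mod K). h.H.gamma r = generate (G Mod K) {u}) \<or>
      odd p \<and> (\<exists>u\<in>carrier (G Mod K). \<exists>v\<in>carrier (G Mod K). h.H.gamma r = generate (G Mod K) {u, v})"
    using gens
  proof
    assume "procyclic G T (lcl r)"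
    then obtain a where a: "topologically_generates G T {a} (lcl r)" unfolding procyclic_def by blast
    then have "h.H.gamma r = generate (G Mod K) {K #> a}" "K #> a \<in> carrier (G Mod K)"
      using img[OF a] gen_in[OF a] h.hom_closed by auto
    then show ?thesis by blast
  next
    assume "odd p \<and> (\<exists>a b. topologically_generates G T {a, b} (lcl r))"
    then obtain a b where o: "odd p" and ab: "topologically_generates G T {a, b} (lcl r)" by blast
    then have "h.H.gamma r = generate (G Mod K) {K #> a, K #> b}" "K #> a \<in> carrier (G Mod K)" "K #> b \<in> carrier (G Mod K)"
      using img[OF ab] gen_in[OF ab] h.hom_closed by auto
    then show ?thesis using o by blast
  qed
  from Q.gamma_slice[OF r this] obtain bs' ys' where q: "length bs' + 1 + length ys' = r"
    "set bs' \<subseteq> carrier (G Mod K)" "set ys' \<subseteq> carrier (G Mod K)"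
    "\<forall>n\<in>h.H.gamma r. \<exists>g\<in>carrier (G Mod K). left_normed_commutator (G Mod K) (bs' @ [g] @ ys') = n" by blast
  obtain bs where bs: "set bs \<subseteq> carrier G" "map (\<lambda>x. K #> x) bs = bs'" using lnc_image[OF K(1) q(2)] by blast
  obtain ys where ys: "set ys \<subseteq> carrier G" "map (\<lambda>x. K #> x) ys = ys'" using lnc_image[OF K(1) q(3)] by blast
  define f where "f = (\<lambda>i\<in>{..<r}. (bs @ \<one> # ys) ! i)"
  have len: "length bs + 1 + length ys = r" using q bs ys by auto
  have f: "f \<in> PiE {..<r} (\<lambda>_. carrier G)"
  proof -
    have "set (bs @ \<one> # ys) \<subseteq> carrier G" using bs ys by simp
    then have "(bs @ \<one> # ys) ! i \<in> carrier G" if "i < r" for i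
      using that len nth_mem[of i "bs @ \<one> # ys"] by auto
    then show ?thesis by (auto simp: f_def)
  qed
  have mapf: "map (f(length bs := g)) [0..<r] = bs @ [g] @ ys" for g
    using len by (intro nth_equalityI) (auto simp: f_def nth_append nth_Cons')
  have "good r K (length bs) f" unfolding good_def
  proof
    fix n assume n: "n \<in> lcl r"
    then obtain n' where n': "n' \<in> gamma r" "K #> n = K #> n'"
      using closure_subset_cosets[OF K _ gamma_carrier] unfolding lower_central_eq by blast
    then have "K #> n' \<in> h.H.gamma r" using gamma_quotient[OF K(1)] by blast
    then obtain g' where g': "g' \<in> carrier (G Mod K)" "left_normed_commutator (G Mod K) (bs' @ [g'] @ ys') = K #> n'"
      using q(4) by blast
    obtain g where g: "g \<in> carrier G" "g' = K #> g" using coset_hom_image[OF g'(1)] by blast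
    have "K #> lnc (bs @ [g] @ ys) = left_normed_commutator (G Mod K) (map (\<lambda>x. K #> x) (bs @ [g] @ ys))"
      using bs ys g by (intro h.hom_lnc) auto
    also have "\<dots> = K #> n" using g' g bs ys n' by simp
    finally show "\<exists>g\<in>carrier G. K #> lnc (map (f(length bs := g)) [0..<r]) = K #> n"
      unfolding mapf using g(1) by blast
  qed
  then show ?thesis using f len by (intro exI[of _ "length bs"]) auto
qed

text \<open>Tuples that are not good thus come in whole boxes of open cosets, which makes the set of
  good tuples closed.\<close>

lemma good_cong:
  assumes K: "K \<lhd> G" and ff': "\<And>i. i < r \<Longrightarrow> f i \<in> carrier G \<and> f' i \<in> carrier G \<and> K #> f i = K #> f' i"
    and "good r K j f"
  shows "good r K j f'"
proof -
  interpret h: group_hom G "G Mod K" "\<lambda>x. K #> x" by (rule group_hom_coset) fact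
  have "K #> lnc (map (f'(j := g)) [0..<r]) = K #> lnc (map (f(j := g)) [0..<r])" if g: "g \<in> carrier G" for g
  proof -
    have "set (map (f(j := g)) [0..<r]) \<subseteq> carrier G" "set (map (f'(j := g)) [0..<r]) \<subseteq> carrier G"
      using ff' g by auto
    moreover have "map (\<lambda>x. K #> x) (map (f(j := g)) [0..<r]) = map (\<lambda>x. K #> x) (map (f'(j := g)) [0..<r])"
      using ff' by auto
    ultimately show ?thesis using h.hom_lnc by metis
  qed
  then show ?thesis using assms(3) unfolding good_def by metis
qed

lemma good_mono:
  assumes K: "K \<lhd> G" "L \<lhd> G" "K \<subseteq> L" and f: "\<And>i. i < r \<Longrightarrow> f i \<in> carrier G" and "good r K j f"
  shows "good r L j f"
  unfolding good_def
proof
  fix n assume n: "n \<in> lcl r"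
  then obtain g where g: "g \<in> carrier G" "K #> lnc (map (f(j := g)) [0..<r]) = K #> n"
    using assms(5) unfolding good_def by blast
  have "set (map (f(j := g)) [0..<r]) \<subseteq> carrier G" using f g by auto
  then have "L #> lnc (map (f(j := g)) [0..<r]) = L #> n"
    using coset_mono[OF K _ _ g(2)] n lower_central_carrier lnc_closed by blast
  then show "\<exists>g\<in>carrier G. L #> lnc (map (f(j := g)) [0..<r]) = L #> n" using g by blast
qed

text \<open>The solution sets \<open>C K\<close> are closed in a compact space and shrink with
  \<open>K\<close>; as open normal subgroups are closed under finite intersections, these sets have
  the finite intersection property. The position \<open>j\<close> may vary with \<open>K\<close>, so
  it joins the space as a finite discrete factor.\<close>

lemma uniform_slice:
  assumes p: "Factorial_Ring.prime p" and r: "r \<ge> 2"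
    and gens: "procyclic G T (lcl r) \<or> odd p \<and> (\<exists>a b. topologically_generates G T {a, b} (lcl r))"
  shows "\<exists>j<r. \<exists>f\<in>PiE {..<r} (\<lambda>_. carrier G). \<forall>K. K \<lhd> G \<and> openin T K \<longrightarrow> good r K j f"
proof -
  define P where "P = prod_topology (discrete_topology {..<r}) (product_topology (\<lambda>_. T) {..<r})"
  define C where "C K = {(j, f). j < r \<and> f \<in> PiE {..<r} (\<lambda>_. carrier G) \<and> good r K j f}" for K
  have top: "topspace P = {..<r} \<times> PiE {..<r} (\<lambda>_. carrier G)"
    by (simp add: P_def topspace_eq)
  have cpt: "compact_space P"
    unfolding P_def compact_space_prod_topology compact_space_product_topology
    using compact by (simp add: compact_space_discrete_topology)
  have closed: "closedin P (C K)" if K: "K \<lhd> G" "openin T K" for K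
    unfolding closedin_def
  proof
    show "C K \<subseteq> topspace P" unfolding top C_def by auto
    show "openin P (topspace P - C K)"
    proof (subst openin_subopen, intro ballI)
      fix z assume z: "z \<in> topspace P - C K"
      then obtain j f where jf: "z = (j, f)" "j < r" "f \<in> PiE {..<r} (\<lambda>_. carrier G)" "\<not> good r K j f"
        unfolding top C_def by auto
      define B where "B = {j} \<times> PiE {..<r} (\<lambda>i. K #> f i)"
      have fc: "f i \<in> carrier G" if "i < r" for i using jf(3) that by auto
      have op: "openin T (K #> f i)" if "i < r" for i using open_coset[OF K(2) fc[OF that]] .
      have "openin P B" unfolding B_def P_def openin_prod_Times_iff openin_PiE_gen
        using jf(2) op by auto
      moreover have "z \<in> B" unfolding B_def
        using jf rcos_self[OF fc normal_imp_subgroup[OF K(1)]] by (auto simp: PiE_iff)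
      moreover have "B \<subseteq> topspace P - C K"
      proof
        fix z' assume "z' \<in> B"
        then obtain f' where f': "z' = (j, f')" "f' \<in> PiE {..<r} (\<lambda>i. K #> f i)" unfolding B_def by auto
        have eq: "f' i \<in> carrier G \<and> f i \<in> carrier G \<and> K #> f' i = K #> f i" if i: "i < r" for i
        proof -
          have m: "f' i \<in> K #> f i" using f'(2) i by auto
          have "f' i \<in> carrier G" using m openin_subset[OF op[OF i]] topspace_eq by blast
          then show ?thesis using repr_independence[OF m fc[OF i] normal_imp_subgroup[OF K(1)]] fc[OF i] by simp
        qed
        have "\<not> good r K j f'"
        proof
          assume "good r K j f'"
          from good_cong[OF K(1) _ this, where f' = f] show False using eq jf(4) by blast
        qed
        moreover have "f' \<in> PiE {..<r} (\<lambda>_. carrier G)" using f'(2) eq by (auto simp: PiE_iff)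
        ultimately show "z' \<in> topspace P - C K" unfolding top C_def using f'(1) jf(2) by auto
      qed
      ultimately show "\<exists>B. openin P B \<and> z \<in> B \<and> B \<subseteq> topspace P - C K" by blast
    qed
  qed
  define O' where "O' = {K. K \<lhd> G \<and> openin T K}"
  have carr: "carrier G \<in> O'" unfolding O'_def using normal_self openin_topspace[of T] topspace_eq by simp
  have fin: "\<Inter>F \<noteq> {}" if F: "finite F" "F \<subseteq> C ` O'" for F
  proof -
    obtain A where A: "A \<subseteq> O'" "finite A" "F = C ` A" using finite_subset_image[OF F] by blast
    have "\<exists>K\<in>O'. \<forall>L\<in>A. K \<subseteq> L" using A(2,1)
    proof (induction A rule: finite_induct)
      case empty then show ?case using carr by blast
    next
      case (insert L A)
      then obtain K where K: "K \<in> O'" "\<forall>L\<in>A. K \<subseteq> L" by blast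
      have "K \<inter> L \<in> O'" using K insert.prems normal_subgroup_intersect unfolding O'_def by auto
      then show ?case using K(2) by (intro bexI[of _ "K \<inter> L"]) auto
    qed
    then obtain K where K: "K \<in> O'" "\<forall>L\<in>A. K \<subseteq> L" by blast
    obtain j f where jf: "j < r" "f \<in> PiE {..<r} (\<lambda>_. carrier G)" "good r K j f"
      using slice_mod[OF p r _ _ gens, of K] K(1) unfolding O'_def by blast
    have "(j, f) \<in> C L" if "L \<in> A" for L
    proof -
      have "good r L j f"
        using good_mono[of K L r f j] jf K that A(1) unfolding O'_def by (auto simp: PiE_iff)
      then show ?thesis using jf unfolding C_def by simp
    qed
    then show ?thesis using A(3) by blast
  qed
  have "\<Inter>(C ` O') \<noteq> {}"
    using cpt[unfolded compact_space_fip, rule_format, of "C ` O'"] closed fin unfolding O'_def by blast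
  then obtain z where z: "\<And>K. K \<in> O' \<Longrightarrow> z \<in> C K" by blast
  obtain j f where "z = (j, f)" by (cases z)
  then show ?thesis using z z[OF carr] unfolding C_def O'_def by auto
qed

text \<open>The image of the slice is compact, hence closed. An \<open>n\<close> outside it would
  have a coset neighbourhood modulo some open normal \<open>K\<close> that avoids the image, against
  solvability modulo \<open>K\<close>.\<close>

theorem lower_central_slice:
  assumes p: "Factorial_Ring.prime p" and r: "r \<ge> 2"
    and gens: "procyclic G T (lcl r) \<or> odd p \<and> (\<exists>a b. topologically_generates G T {a, b} (lcl r))"
  shows "\<exists>j<r. \<exists>f\<in>PiE {..<r} (\<lambda>_. carrier G). lcl r = (\<lambda>g. lnc (map (f(j := g)) [0..<r])) ` carrier G"
proof -
  obtain j f where j: "j < r" and f: "f \<in> PiE {..<r} (\<lambda>_. carrier G)"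
    and good: "\<forall>K. K \<lhd> G \<and> openin T K \<longrightarrow> good r K j f"
    using uniform_slice[OF p r gens] by (elim exE conjE bexE) (rule that)
  define \<phi> where "\<phi> g = lnc (map (f(j := g)) [0..<r])" for g
  have fc: "f i \<in> carrier G" if "i < r" for i using PiE_mem[OF f, of i] that by simp
  have lst: "set (map (f(j := g)) [0..<r]) \<subseteq> carrier G" if "g \<in> carrier G" for g
    using fc that by (simp add: image_subset_iff)
  have "continuous_map T T (\<lambda>g. lnc (map (\<lambda>h. h g) (map (\<lambda>i g. (f(j := g)) i) [0..<r])))"
    by (rule continuous_lnc) (use fc in \<open>auto simp: topspace_eq\<close>)
  moreover have "\<phi> = (\<lambda>g. lnc (map (\<lambda>h. h g) (map (\<lambda>i g. (f(j := g)) i) [0..<r])))"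
    by (simp add: \<phi>_def fun_eq_iff o_def fun_upd_def)
  ultimately have cont: "continuous_map T T \<phi>" by simp
  have "compactin T (\<phi> ` carrier G)"
    using image_compactin[OF _ cont] compact topspace_eq unfolding compact_space_def by metis
  then have closed: "closedin T (\<phi> ` carrier G)" using compactin_imp_closedin[OF hausdorff] by blast
  have "lcl r = \<phi> ` carrier G"
  proof
    show "\<phi> ` carrier G \<subseteq> lcl r"
    proof
      fix y assume "y \<in> \<phi> ` carrier G"
      then obtain g where g: "g \<in> carrier G" "y = lnc (map (f(j := g)) [0..<r])" unfolding \<phi>_def by blast
      have "length (map (f(j := g)) [0..<r]) = r" by simp
      then have "y \<in> gamma r" unfolding gamma_def g(2) using lst[OF g(1)] by (intro generate.incl) blast
      then show "y \<in> lcl r" using gamma_subset by blast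
    qed
    show "lcl r \<subseteq> \<phi> ` carrier G"
    proof (rule ccontr)
      assume "\<not> lcl r \<subseteq> \<phi> ` carrier G"
      then obtain n where n: "n \<in> lcl r" "n \<notin> \<phi> ` carrier G" by blast
      have nc: "n \<in> carrier G" using n lower_central_carrier by blast
      have "openin T (topspace T - \<phi> ` carrier G)" using closed by blast
      then obtain K where K: "K \<lhd> G" "openin T K" "K #> n \<subseteq> topspace T - \<phi> ` carrier G"
        using open_normal_translate[of "topspace T - \<phi> ` carrier G" n] n nc topspace_eq by blast
      obtain g where g: "g \<in> carrier G" "K #> \<phi> g = K #> n"
        using good[rule_format, OF conjI[OF K(1,2)]] n(1) unfolding good_def \<phi>_def by blast
      have "\<phi> g \<in> carrier G" unfolding \<phi>_def using lst[OF g(1)] by (rule lnc_closed)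
      then have "\<phi> g \<in> K #> n" using rcos_self[OF _ normal_imp_subgroup[OF K(1)]] g(2) by metis
      then show False using K(3) g(1) by blast
    qed
  qed
  then show ?thesis using j f unfolding \<phi>_def by blast
qed

end

theorem theoremB:
  fixes p r :: nat and G :: "('a, 'b) monoid_scheme" and T :: "'a topology"
  assumes "Factorial_Ring.prime p"
    and "pro_p_group p G T"
    and "r \<ge> 2"
    and "procyclic G T (lower_central G T r) \<or>
         (odd p \<and> (\<exists>a b. topologically_generates G T {a, b} (lower_central G T r)))"
  shows "\<exists>j xs ys. 1 \<le> j \<and> j \<le> r \<and>
           length xs = j - 1 \<and> set xs \<subseteq> carrier G \<and>
           length ys = r - j \<and> set ys \<subseteq> carrier G \<and>
           lower_central G T r =
             {left_normed_commutator G (xs @ [g] @ ys) | g. g \<in> carrier G}"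
proof -
  interpret pro_p_group p G T by fact
  obtain j f where j: "j < r" and f: "f \<in> PiE {..<r} (\<lambda>_. carrier G)"
    and eq: "lower_central G T r = (\<lambda>g. lnc (map (f(j := g)) [0..<r])) ` carrier G"
    using lower_central_slice[OF assms(1,3,4)] by blast
  \<comment> \<open>Positions count from \<open>0\<close> here and from \<open>1\<close> in the
    statement, so the final witness is \<open>Suc j\<close>.\<close>
  define xs ys where "xs = map f [0..<j]" and "ys = map f [Suc j..<r]"
  have "[0..<r] = [0..<j] @ [j] @ [Suc j..<r]"
    using upt_add_eq_append[of 0 j "r - j"] upt_conv_Cons[OF j] j by simp
  then have list_eq: "map (f(j := g)) [0..<r] = xs @ [g] @ ys" for g by (simp add: xs_def ys_def)
  have "lower_central G T r = {lnc (xs @ [g] @ ys) | g. g \<in> carrier G}"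
    unfolding eq list_eq by (rule Setcompr_eq_image[symmetric])
  moreover have "set xs \<subseteq> carrier G" "set ys \<subseteq> carrier G"
    using PiE_mem[OF f] j by (auto simp: xs_def ys_def)
  moreover have "length xs = Suc j - 1" "length ys = r - Suc j" "1 \<le> Suc j" "Suc j \<le> r"
    using j by (simp_all add: xs_def ys_def)
  ultimately show ?thesis by blast
qed

end
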